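(* The following are provable in $\mathbf{ZF}$: (i) $\mathbf{CMC}\rightarrow(\mathbf{G}(T_{3\frac12},\mathcal{G}_{\delta\delta},\mathcal{G}_{\delta})\wedge\mathbf{Z}(CR,\mathcal{Z}_{\delta},\mathcal{Z}))$. (ii) $\mathbf{G}(T_{3\frac12},\mathcal{G}_{\delta\delta},\mathcal{G}_{\delta})\rightarrow(\mathbf{UT}(\aleph_0,cuc,cuc)\wedge\mathbf{UT}(\aleph_0,cuf,cuf))$. (iii) $\mathbf{Z}(CR,\mathcal{Z}_{\delta},\mathcal{Z})\rightarrow(\mathbf{UT}(\aleph_0,cuc,cuc)\wedge\mathbf{UT}(\aleph_0,cuf,cuf))$.
   Context: The base theory is $\mathbf{ZF}$ (no Axiom of Choice). A set is countable if it is equipotent to a subset of $\omega$, and denumerable if it is infinite and countable. A cuf set is a countable union of finite sets; a cuc set is a countable union of countable sets. A family $\mathcal{A}$ is stable under countable intersections if $\bigcap\mathcal{U}\in\mathcal{A}$ for every non-empty countable $\mathcal{U}\subseteq\mathcal{A}$. For a topological space $\mathbf{X}$, $\mathcal{G}_\delta(\mathbf{X})$ is the family of all $G_\delta$-sets and $\mathcal{Z}(\mathbf{X})$ the family of all zero-sets $f^{-1}[\{0\}]$ with $f:\mathbf{X}\to\mathbb{R}$ continuous. $\mathbf{X}$ is completely regular if complements of zero-sets form a base; a $T_{3\frac12}$-space is a completely regular $T_1$-space. - $\mathbf{CMC}$: every denumerable family of non-empty sets has a multiple choice function, i.e. a function assigning to each member (index) a non-empty finite subset of it. - $\mathbf{G}(T_{3\frac12},\mathcal{G}_{\delta\delta},\mathcal{G}_\delta)$: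 for every $T_{3\frac12}$-space $\mathbf{X}$, the family $\mathcal{G}_\delta(\mathbf{X})$ is stable under countable intersections. - $\mathbf{Z}(CR,\mathcal{Z}_\delta,\mathcal{Z})$: for every completely regular space $\mathbf{X}$, the family $\mathcal{Z}(\mathbf{X})$ is stable under countable intersections. - $\mathbf{UT}(\aleph_0,cuc,cuc)$: every countable union of cuc sets is a cuc set. - $\mathbf{UT}(\aleph_0,cuf,cuf)$: every countable union of cuf sets is a cuf set. *)

theory Defs
  imports Main
begin

text \<open>
  HOL itself satisfies the axiom of choice, so the statement is rendered as derivability of
  sentences from the axioms of ZF in first-order logic, both of which are formalized here.
\<close>

section \<open>First-order logic over the language of set theory\<close>

text \<open>Variables are de Bruijn indices; as there are no function symbols, variables are the only terms.\<close>

datatype fm = Fls | Mem nat nat | Eq nat nat | Imp fm fm | All fm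

primrec bounded :: "nat \<Rightarrow> fm \<Rightarrow> bool" \<comment> \<open>all free variables are less than \<open>n\<close>\<close> where
  "bounded n Fls \<longleftrightarrow> True"
| "bounded n (Mem i j) \<longleftrightarrow> i < n \<and> j < n"
| "bounded n (Eq i j) \<longleftrightarrow> i < n \<and> j < n"
| "bounded n (Imp p q) \<longleftrightarrow> bounded n p \<and> bounded n q"
| "bounded n (All p) \<longleftrightarrow> bounded (Suc n) p"

text \<open>Simultaneous substitution of variables for variables; it avoids capture.\<close>

primrec rename :: "(nat \<Rightarrow> nat) \<Rightarrow> fm \<Rightarrow> fm" where
  "rename r Fls = Fls"
| "rename r (Mem i j) = Mem (r i) (r j)"
| "rename r (Eq i j) = Eq (r i) (r j)"
| "rename r (Imp p q) = Imp (rename r p) (rename r q)"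
| "rename r (All p) = All (rename (case_nat 0 (\<lambda>k. Suc (r k))) p)"

definition lift :: "fm \<Rightarrow> fm" where
  "lift = rename Suc"

definition inst :: "nat \<Rightarrow> fm \<Rightarrow> fm" \<comment> \<open>substitutes \<open>t\<close> for the variable 0 and lowers the others\<close> where
  "inst t = rename (case_nat t id)"

text \<open>Classical natural deduction with equality.\<close>

inductive derives :: "fm set \<Rightarrow> fm \<Rightarrow> bool" (infix "\<turnstile>" 50) where
  assm: "p \<in> \<Gamma> \<Longrightarrow> \<Gamma> \<turnstile> p"
| impI: "insert p \<Gamma> \<turnstile> q \<Longrightarrow> \<Gamma> \<turnstile> Imp p q"
| impE: "\<Gamma> \<turnstile> Imp p q \<Longrightarrow> \<Gamma> \<turnstile> p \<Longrightarrow> \<Gamma> \<turnstile> q"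
| raa: "insert (Imp p Fls) \<Gamma> \<turnstile> Fls \<Longrightarrow> \<Gamma> \<turnstile> p"
| allI: "lift ` \<Gamma> \<turnstile> p \<Longrightarrow> \<Gamma> \<turnstile> All p"
| allE: "\<Gamma> \<turnstile> All p \<Longrightarrow> \<Gamma> \<turnstile> inst t p"
| refl: "\<Gamma> \<turnstile> Eq t t"
| subst: "\<Gamma> \<turnstile> Eq s t \<Longrightarrow> \<Gamma> \<turnstile> inst s p \<Longrightarrow> \<Gamma> \<turnstile> inst t p"


section \<open>Readable notation for formulas\<close>

text \<open>
  An open formula is written as a function \<open>f\<close> of the number \<open>n\<close> of quantifiers in whose scope it
  stands.  Within it, the variables are levels: level \<open>x\<close> is the variable bound by the \<open>x\<close>-th
  of these quantifiers, counted from the outside and starting with 0; its index at depth \<open>n\<close>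
  is \<open>n - Suc x\<close>.  A quantifier standing at depth \<open>n\<close> hence binds the level \<open>n\<close>.
  A sentence \<open>f\<close> denotes the formula \<open>f 0\<close>.
\<close>

type_synonym var = nat
type_synonym oform = "nat \<Rightarrow> fm"

definition fmem :: "var \<Rightarrow> var \<Rightarrow> oform" (infix "\<^bold>\<in>" 50) where
  "x \<^bold>\<in> y = (\<lambda>n. Mem (n - Suc x) (n - Suc y))"

definition feq :: "var \<Rightarrow> var \<Rightarrow> oform" (infix "\<^bold>=" 50) where
  "x \<^bold>= y = (\<lambda>n. Eq (n - Suc x) (n - Suc y))"

definition fimp :: "oform \<Rightarrow> oform \<Rightarrow> oform" (infixr "\<^bold>\<longrightarrow>" 25) where
  "(p \<^bold>\<longrightarrow> q) = (\<lambda>n. Imp (p n) (q n))"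

definition fnot :: "oform \<Rightarrow> oform" ("\<^bold>\<not> _" [40] 40) where
  "(\<^bold>\<not> p) = (\<lambda>n. Imp (p n) Fls)"

definition fand :: "oform \<Rightarrow> oform \<Rightarrow> oform" (infixr "\<^bold>\<and>" 35) where
  "(p \<^bold>\<and> q) = (\<^bold>\<not> (p \<^bold>\<longrightarrow> \<^bold>\<not> q))"

definition f_or :: "oform \<Rightarrow> oform \<Rightarrow> oform" (infixr "\<^bold>\<or>" 30) where
  "(p \<^bold>\<or> q) = (\<^bold>\<not> p \<^bold>\<longrightarrow> q)"

definition fiff :: "oform \<Rightarrow> oform \<Rightarrow> oform" (infixr "\<^bold>\<longleftrightarrow>" 25) where
  "(p \<^bold>\<longleftrightarrow> q) = ((p \<^bold>\<longrightarrow> q) \<^bold>\<and> (q \<^bold>\<longrightarrow> p))"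

definition fall :: "(var \<Rightarrow> oform) \<Rightarrow> oform" (binder "\<^bold>\<forall>" 10) where
  "fall p = (\<lambda>n. All (p n (Suc n)))"

definition fex :: "(var \<Rightarrow> oform) \<Rightarrow> oform" (binder "\<^bold>\<exists>" 10) where
  "fex p = (\<^bold>\<not> (\<^bold>\<forall>x. \<^bold>\<not> p x))"

text \<open>
  \<open>app p [x, y]\<close> is the formula \<open>p\<close> with the variables \<open>x\<close> and \<open>y\<close> for its indices 0 and 1; its
  remaining indices refer to parameters, free in the surrounding formula (index \<open>k\<close> at depth 0).
\<close>

definition app :: "fm \<Rightarrow> var list \<Rightarrow> oform" where
  "app p xs = (\<lambda>n. rename (\<lambda>k. if k < length xs then n - Suc (xs ! k) else n + (k - length xs)) p)"


section \<open>Elementary set-theoretic notions\<close>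

definition is_empty :: "var \<Rightarrow> oform" where
  "is_empty x = (\<^bold>\<forall>z. \<^bold>\<not> z \<^bold>\<in> x)"

definition nonempty :: "var \<Rightarrow> oform" where
  "nonempty x = (\<^bold>\<exists>z. z \<^bold>\<in> x)"

definition fsubset :: "var \<Rightarrow> var \<Rightarrow> oform" (infix "\<^bold>\<subseteq>" 50) where
  "x \<^bold>\<subseteq> y = (\<^bold>\<forall>z. z \<^bold>\<in> x \<^bold>\<longrightarrow> z \<^bold>\<in> y)"

definition is_succ :: "var \<Rightarrow> var \<Rightarrow> oform" where
  "is_succ s x = (\<^bold>\<forall>z. z \<^bold>\<in> s \<^bold>\<longleftrightarrow> z \<^bold>\<in> x \<^bold>\<or> z \<^bold>= x)"

definition is_Union :: "var \<Rightarrow> var \<Rightarrow> oform" where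
  "is_Union u F = (\<^bold>\<forall>z. z \<^bold>\<in> u \<^bold>\<longleftrightarrow> (\<^bold>\<exists>A. A \<^bold>\<in> F \<^bold>\<and> z \<^bold>\<in> A))"

definition is_Inter :: "var \<Rightarrow> var \<Rightarrow> oform" \<comment> \<open>meaningful only if \<open>F\<close> is nonempty\<close> where
  "is_Inter d F = (\<^bold>\<forall>z. z \<^bold>\<in> d \<^bold>\<longleftrightarrow> (\<^bold>\<forall>A. A \<^bold>\<in> F \<^bold>\<longrightarrow> z \<^bold>\<in> A))"

definition is_inter :: "var \<Rightarrow> var \<Rightarrow> var \<Rightarrow> oform" where
  "is_inter d x y = (\<^bold>\<forall>z. z \<^bold>\<in> d \<^bold>\<longleftrightarrow> z \<^bold>\<in> x \<^bold>\<and> z \<^bold>\<in> y)"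

definition is_diff :: "var \<Rightarrow> var \<Rightarrow> var \<Rightarrow> oform" where
  "is_diff d x y = (\<^bold>\<forall>z. z \<^bold>\<in> d \<^bold>\<longleftrightarrow> z \<^bold>\<in> x \<^bold>\<and> \<^bold>\<not> z \<^bold>\<in> y)"

definition is_upair :: "var \<Rightarrow> var \<Rightarrow> var \<Rightarrow> oform" where
  "is_upair p x y = (\<^bold>\<forall>z. z \<^bold>\<in> p \<^bold>\<longleftrightarrow> z \<^bold>= x \<^bold>\<or> z \<^bold>= y)"

definition is_pair :: "var \<Rightarrow> var \<Rightarrow> var \<Rightarrow> oform" \<comment> \<open>Kuratowski's ordered pair\<close> where
  "is_pair p x y = (\<^bold>\<exists>u v. is_upair u x x \<^bold>\<and> is_upair v x y \<^bold>\<and> is_upair p u v)"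

definition is_prod :: "var \<Rightarrow> var \<Rightarrow> var \<Rightarrow> oform" where
  "is_prod P A B = (\<^bold>\<forall>p. p \<^bold>\<in> P \<^bold>\<longleftrightarrow> (\<^bold>\<exists>x y. x \<^bold>\<in> A \<^bold>\<and> y \<^bold>\<in> B \<^bold>\<and> is_pair p x y))"

text \<open>For a function \<open>r\<close>, \<open>pair_in x y r\<close> says that its value at \<open>x\<close> is \<open>y\<close>.\<close>

definition pair_in :: "var \<Rightarrow> var \<Rightarrow> var \<Rightarrow> oform" where
  "pair_in x y r = (\<^bold>\<exists>p. is_pair p x y \<^bold>\<and> p \<^bold>\<in> r)"

definition is_rel :: "var \<Rightarrow> var \<Rightarrow> var \<Rightarrow> oform" where
  "is_rel r A B = (\<^bold>\<forall>p. p \<^bold>\<in> r \<^bold>\<longrightarrow> (\<^bold>\<exists>x y. x \<^bold>\<in> A \<^bold>\<and> y \<^bold>\<in> B \<^bold>\<and> is_pair p x y))"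

definition single_valued :: "var \<Rightarrow> oform" where
  "single_valued f = (\<^bold>\<forall>x y z. pair_in x y f \<^bold>\<and> pair_in x z f \<^bold>\<longrightarrow> y \<^bold>= z)"

definition is_fun :: "var \<Rightarrow> var \<Rightarrow> var \<Rightarrow> oform" where
  "is_fun f A B =
    (is_rel f A B \<^bold>\<and> single_valued f \<^bold>\<and> (\<^bold>\<forall>x. x \<^bold>\<in> A \<^bold>\<longrightarrow> (\<^bold>\<exists>y. pair_in x y f)))"

definition is_bij :: "var \<Rightarrow> var \<Rightarrow> var \<Rightarrow> oform" where
  "is_bij f A B =
    (is_fun f A B \<^bold>\<and>
     (\<^bold>\<forall>x y z. pair_in x z f \<^bold>\<and> pair_in y z f \<^bold>\<longrightarrow> x \<^bold>= y) \<^bold>\<and>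
     (\<^bold>\<forall>y. y \<^bold>\<in> B \<^bold>\<longrightarrow> (\<^bold>\<exists>x. pair_in x y f)))"

definition equipotent :: "var \<Rightarrow> var \<Rightarrow> oform" where
  "equipotent A B = (\<^bold>\<exists>f. is_bij f A B)"

definition is_inductive :: "var \<Rightarrow> oform" where
  "is_inductive w =
    ((\<^bold>\<exists>e. is_empty e \<^bold>\<and> e \<^bold>\<in> w) \<^bold>\<and>
     (\<^bold>\<forall>x. x \<^bold>\<in> w \<^bold>\<longrightarrow> (\<^bold>\<exists>s. is_succ s x \<^bold>\<and> s \<^bold>\<in> w)))"

definition is_omega :: "var \<Rightarrow> oform" where
  "is_omega w = (is_inductive w \<^bold>\<and> (\<^bold>\<forall>v. is_inductive v \<^bold>\<longrightarrow> w \<^bold>\<subseteq> v))"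


section \<open>The axioms of ZF\<close>

definition extensionality_ax :: oform where
  "extensionality_ax = (\<^bold>\<forall>x y. (\<^bold>\<forall>z. z \<^bold>\<in> x \<^bold>\<longleftrightarrow> z \<^bold>\<in> y) \<^bold>\<longrightarrow> x \<^bold>= y)"

definition foundation_ax :: oform where
  "foundation_ax = (\<^bold>\<forall>x. nonempty x \<^bold>\<longrightarrow> (\<^bold>\<exists>y. y \<^bold>\<in> x \<^bold>\<and> \<^bold>\<not> (\<^bold>\<exists>z. z \<^bold>\<in> x \<^bold>\<and> z \<^bold>\<in> y)))"

definition pairing_ax :: oform where
  "pairing_ax = (\<^bold>\<forall>x y. \<^bold>\<exists>p. is_upair p x y)"

definition union_ax :: oform where
  "union_ax = (\<^bold>\<forall>F. \<^bold>\<exists>u. is_Union u F)"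

definition power_set_ax :: oform where
  "power_set_ax = (\<^bold>\<forall>x. \<^bold>\<exists>P. \<^bold>\<forall>z. z \<^bold>\<in> P \<^bold>\<longleftrightarrow> z \<^bold>\<subseteq> x)"

definition infinity_ax :: oform where
  "infinity_ax = (\<^bold>\<exists>w. is_inductive w)"

definition separation :: "fm \<Rightarrow> oform" where
  "separation p = (\<^bold>\<forall>a. \<^bold>\<exists>b. \<^bold>\<forall>x. x \<^bold>\<in> b \<^bold>\<longleftrightarrow> x \<^bold>\<in> a \<^bold>\<and> app p [x])"

definition replacement :: "fm \<Rightarrow> oform" where
  "replacement p =
    ((\<^bold>\<forall>x y z. app p [x, y] \<^bold>\<and> app p [x, z] \<^bold>\<longrightarrow> y \<^bold>= z) \<^bold>\<longrightarrow>
     (\<^bold>\<forall>a. \<^bold>\<exists>b. \<^bold>\<forall>y. y \<^bold>\<in> b \<^bold>\<longleftrightarrow> (\<^bold>\<exists>x. x \<^bold>\<in> a \<^bold>\<and> app p [x, y])))"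

text \<open>The instances of the two schemes are universally closed over their parameters.\<close>

definition ZF :: "fm set" where
  "ZF =
    {extensionality_ax 0, foundation_ax 0, pairing_ax 0, union_ax 0, power_set_ax 0, infinity_ax 0} \<union>
    {(All ^^ m) (separation p 0) | m p. bounded m (separation p 0)} \<union>
    {(All ^^ m) (replacement p 0) | m p. bounded m (replacement p 0)}"


section \<open>Finiteness and countability\<close>

definition finite_set :: "var \<Rightarrow> oform" where
  "finite_set A = (\<^bold>\<exists>w n. is_omega w \<^bold>\<and> n \<^bold>\<in> w \<^bold>\<and> equipotent A n)"

definition countable_set :: "var \<Rightarrow> oform" where
  "countable_set A = (\<^bold>\<exists>w s. is_omega w \<^bold>\<and> s \<^bold>\<subseteq> w \<^bold>\<and> equipotent A s)"

definition denumerable_set :: "var \<Rightarrow> oform" where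
  "denumerable_set A = (\<^bold>\<not> finite_set A \<^bold>\<and> countable_set A)"

definition countable_union_of :: "(var \<Rightarrow> oform) \<Rightarrow> var \<Rightarrow> oform" where
  "countable_union_of K A =
    (\<^bold>\<exists>F. countable_set F \<^bold>\<and> (\<^bold>\<forall>B. B \<^bold>\<in> F \<^bold>\<longrightarrow> K B) \<^bold>\<and> is_Union A F)"

definition cuf_set :: "var \<Rightarrow> oform" where
  "cuf_set = countable_union_of finite_set"

definition cuc_set :: "var \<Rightarrow> oform" where
  "cuc_set = countable_union_of countable_set"


section \<open>The real numbers\<close>

text \<open>
  The field of real numbers is axiomatized as a complete ordered field, which ZF proves to exist
  and to be unique up to isomorphism.  It is given by its carrier \<open>R\<close>, its elements \<open>zero\<close> and
  \<open>one\<close>, its addition \<open>A\<close> and multiplication \<open>M\<close> (functions from \<open>R \<times> R\<close> to \<open>R\<close>), and its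
  non-strict order \<open>L\<close>.
\<close>

definition is_op :: "var \<Rightarrow> var \<Rightarrow> oform" where
  "is_op A R = (\<^bold>\<exists>P. is_prod P R R \<^bold>\<and> is_fun A P R)"

definition op_val :: "var \<Rightarrow> var \<Rightarrow> var \<Rightarrow> var \<Rightarrow> oform" \<comment> \<open>\<open>A(x, y) = z\<close>\<close> where
  "op_val A x y z = (\<^bold>\<exists>p. is_pair p x y \<^bold>\<and> pair_in p z A)"

definition comm_monoid :: "var \<Rightarrow> var \<Rightarrow> var \<Rightarrow> oform" where
  "comm_monoid R e A =
    (is_op A R \<^bold>\<and> e \<^bold>\<in> R \<^bold>\<and>
     (\<^bold>\<forall>x y z. op_val A x y z \<^bold>\<longrightarrow> op_val A y x z) \<^bold>\<and>
     (\<^bold>\<forall>x y z u v t. op_val A x y u \<^bold>\<and> op_val A u z t \<^bold>\<and> op_val A y z v \<^bold>\<longrightarrow> op_val A x v t) \<^bold>\<and>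
     (\<^bold>\<forall>x. x \<^bold>\<in> R \<^bold>\<longrightarrow> op_val A e x x))"

definition is_field :: "var \<Rightarrow> var \<Rightarrow> var \<Rightarrow> var \<Rightarrow> var \<Rightarrow> oform" where
  "is_field R zero one A M =
    (comm_monoid R zero A \<^bold>\<and> comm_monoid R one M \<^bold>\<and> \<^bold>\<not> zero \<^bold>= one \<^bold>\<and>
     (\<^bold>\<forall>x. x \<^bold>\<in> R \<^bold>\<longrightarrow> (\<^bold>\<exists>y. op_val A x y zero)) \<^bold>\<and>
     (\<^bold>\<forall>x. x \<^bold>\<in> R \<^bold>\<and> \<^bold>\<not> x \<^bold>= zero \<^bold>\<longrightarrow> (\<^bold>\<exists>y. op_val M x y one)) \<^bold>\<and>
     (\<^bold>\<forall>x y z s t u v. op_val A y z s \<^bold>\<and> op_val M x s t \<^bold>\<and> op_val M x y u \<^bold>\<and> op_val M x z v \<^bold>\<longrightarrow>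
        op_val A u v t))"

definition is_linear_order :: "var \<Rightarrow> var \<Rightarrow> oform" where
  "is_linear_order R L =
    (is_rel L R R \<^bold>\<and>
     (\<^bold>\<forall>x y. x \<^bold>\<in> R \<^bold>\<and> y \<^bold>\<in> R \<^bold>\<longrightarrow> pair_in x y L \<^bold>\<or> pair_in y x L) \<^bold>\<and>
     (\<^bold>\<forall>x y. pair_in x y L \<^bold>\<and> pair_in y x L \<^bold>\<longrightarrow> x \<^bold>= y) \<^bold>\<and>
     (\<^bold>\<forall>x y z. pair_in x y L \<^bold>\<and> pair_in y z L \<^bold>\<longrightarrow> pair_in x z L))"

definition upper_bound :: "var \<Rightarrow> var \<Rightarrow> var \<Rightarrow> var \<Rightarrow> oform" where
  "upper_bound R L S b = (b \<^bold>\<in> R \<^bold>\<and> (\<^bold>\<forall>x. x \<^bold>\<in> S \<^bold>\<longrightarrow> pair_in x b L))"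

definition complete_order :: "var \<Rightarrow> var \<Rightarrow> oform" where
  "complete_order R L =
    (\<^bold>\<forall>S. S \<^bold>\<subseteq> R \<^bold>\<and> nonempty S \<^bold>\<and> (\<^bold>\<exists>b. upper_bound R L S b) \<^bold>\<longrightarrow>
       (\<^bold>\<exists>s. upper_bound R L S s \<^bold>\<and> (\<^bold>\<forall>b. upper_bound R L S b \<^bold>\<longrightarrow> pair_in s b L)))"

definition is_reals :: "var \<Rightarrow> var \<Rightarrow> var \<Rightarrow> var \<Rightarrow> var \<Rightarrow> var \<Rightarrow> oform" where
  "is_reals R zero one A M L =
    (is_field R zero one A M \<^bold>\<and> is_linear_order R L \<^bold>\<and>
     (\<^bold>\<forall>x y z u v. pair_in x y L \<^bold>\<and> op_val A x z u \<^bold>\<and> op_val A y z v \<^bold>\<longrightarrow> pair_in u v L) \<^bold>\<and>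
     (\<^bold>\<forall>x y z. pair_in zero x L \<^bold>\<and> pair_in zero y L \<^bold>\<and> op_val M x y z \<^bold>\<longrightarrow> pair_in zero z L) \<^bold>\<and>
     complete_order R L)"

definition lt :: "var \<Rightarrow> var \<Rightarrow> var \<Rightarrow> oform" where
  "lt L x y = (pair_in x y L \<^bold>\<and> \<^bold>\<not> x \<^bold>= y)"

definition open_real :: "var \<Rightarrow> var \<Rightarrow> var \<Rightarrow> oform" where
  "open_real R L V =
    (V \<^bold>\<subseteq> R \<^bold>\<and>
     (\<^bold>\<forall>x. x \<^bold>\<in> V \<^bold>\<longrightarrow>
        (\<^bold>\<exists>a b. lt L a x \<^bold>\<and> lt L x b \<^bold>\<and> (\<^bold>\<forall>y. lt L a y \<^bold>\<and> lt L y b \<^bold>\<longrightarrow> y \<^bold>\<in> V))))"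


section \<open>Topological spaces\<close>

text \<open>A space is given by its underlying set \<open>X\<close> and its family \<open>T\<close> of open sets.\<close>

definition topological_space :: "var \<Rightarrow> var \<Rightarrow> oform" where
  "topological_space X T =
    ((\<^bold>\<forall>U. U \<^bold>\<in> T \<^bold>\<longrightarrow> U \<^bold>\<subseteq> X) \<^bold>\<and> X \<^bold>\<in> T \<^bold>\<and>
     (\<^bold>\<forall>U V D. U \<^bold>\<in> T \<^bold>\<and> V \<^bold>\<in> T \<^bold>\<and> is_inter D U V \<^bold>\<longrightarrow> D \<^bold>\<in> T) \<^bold>\<and>
     (\<^bold>\<forall>S U. S \<^bold>\<subseteq> T \<^bold>\<and> is_Union U S \<^bold>\<longrightarrow> U \<^bold>\<in> T))"

definition T1_space :: "var \<Rightarrow> var \<Rightarrow> oform" where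
  "T1_space X T =
    (topological_space X T \<^bold>\<and>
     (\<^bold>\<forall>x y. x \<^bold>\<in> X \<^bold>\<and> y \<^bold>\<in> X \<^bold>\<and> \<^bold>\<not> x \<^bold>= y \<^bold>\<longrightarrow> (\<^bold>\<exists>U. U \<^bold>\<in> T \<^bold>\<and> x \<^bold>\<in> U \<^bold>\<and> \<^bold>\<not> y \<^bold>\<in> U)))"

text \<open>Families of subsets that are definable from the space are represented by their defining formulas.\<close>

definition is_base :: "(var \<Rightarrow> oform) \<Rightarrow> var \<Rightarrow> oform" where
  "is_base \<B> T =
    ((\<^bold>\<forall>U. \<B> U \<^bold>\<longrightarrow> U \<^bold>\<in> T) \<^bold>\<and>
     (\<^bold>\<forall>U x. U \<^bold>\<in> T \<^bold>\<and> x \<^bold>\<in> U \<^bold>\<longrightarrow> (\<^bold>\<exists>V. \<B> V \<^bold>\<and> x \<^bold>\<in> V \<^bold>\<and> V \<^bold>\<subseteq> U)))"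

definition stable_under_countable_intersections :: "(var \<Rightarrow> oform) \<Rightarrow> oform" where
  "stable_under_countable_intersections \<A> =
    (\<^bold>\<forall>\<U> D. nonempty \<U> \<^bold>\<and> countable_set \<U> \<^bold>\<and> (\<^bold>\<forall>U. U \<^bold>\<in> \<U> \<^bold>\<longrightarrow> \<A> U) \<^bold>\<and> is_Inter D \<U> \<^bold>\<longrightarrow> \<A> D)"

definition G_delta :: "var \<Rightarrow> var \<Rightarrow> oform" where
  "G_delta T D = (\<^bold>\<exists>\<U>. nonempty \<U> \<^bold>\<and> countable_set \<U> \<^bold>\<and> \<U> \<^bold>\<subseteq> T \<^bold>\<and> is_Inter D \<U>)"

definition continuous_real :: "var \<Rightarrow> var \<Rightarrow> var \<Rightarrow> var \<Rightarrow> var \<Rightarrow> oform" where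
  "continuous_real R L X T f =
    (is_fun f X R \<^bold>\<and>
     (\<^bold>\<forall>V P. open_real R L V \<^bold>\<and> (\<^bold>\<forall>x. x \<^bold>\<in> P \<^bold>\<longleftrightarrow> (\<^bold>\<exists>y. y \<^bold>\<in> V \<^bold>\<and> pair_in x y f)) \<^bold>\<longrightarrow> P \<^bold>\<in> T))"

definition zero_set :: "var \<Rightarrow> var \<Rightarrow> var \<Rightarrow> var \<Rightarrow> var \<Rightarrow> var \<Rightarrow> oform" where
  "zero_set R zero L X T Z =
    (\<^bold>\<exists>f. continuous_real R L X T f \<^bold>\<and> (\<^bold>\<forall>x. x \<^bold>\<in> Z \<^bold>\<longleftrightarrow> pair_in x zero f))"

definition completely_regular :: "var \<Rightarrow> var \<Rightarrow> var \<Rightarrow> var \<Rightarrow> var \<Rightarrow> oform" where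
  "completely_regular R zero L X T =
    (topological_space X T \<^bold>\<and>
     is_base (\<lambda>U. \<^bold>\<exists>Z. zero_set R zero L X T Z \<^bold>\<and> is_diff U X Z) T)"

definition T3_half_space :: "var \<Rightarrow> var \<Rightarrow> var \<Rightarrow> var \<Rightarrow> var \<Rightarrow> oform" where
  "T3_half_space R zero L X T = (completely_regular R zero L X T \<^bold>\<and> T1_space X T)"


section \<open>The principles\<close>

definition CMC :: oform where
  "CMC =
    (\<^bold>\<forall>F. denumerable_set F \<^bold>\<and> (\<^bold>\<forall>A. A \<^bold>\<in> F \<^bold>\<longrightarrow> nonempty A) \<^bold>\<longrightarrow>
       (\<^bold>\<exists>f K. is_fun f F K \<^bold>\<and>
          (\<^bold>\<forall>A B. pair_in A B f \<^bold>\<longrightarrow> nonempty B \<^bold>\<and> finite_set B \<^bold>\<and> B \<^bold>\<subseteq> A)))"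

definition G_T3half_Gdd_Gd :: oform where
  "G_T3half_Gdd_Gd =
    (\<^bold>\<forall>R zero one A M L. is_reals R zero one A M L \<^bold>\<longrightarrow>
       (\<^bold>\<forall>X T. T3_half_space R zero L X T \<^bold>\<longrightarrow>
          stable_under_countable_intersections (G_delta T)))"

definition Z_CR_Zd_Z :: oform where
  "Z_CR_Zd_Z =
    (\<^bold>\<forall>R zero one A M L. is_reals R zero one A M L \<^bold>\<longrightarrow>
       (\<^bold>\<forall>X T. completely_regular R zero L X T \<^bold>\<longrightarrow>
          stable_under_countable_intersections (zero_set R zero L X T)))"

definition UT_countable :: "(var \<Rightarrow> oform) \<Rightarrow> oform" where
  "UT_countable K =
    (\<^bold>\<forall>F U. countable_set F \<^bold>\<and> (\<^bold>\<forall>A. A \<^bold>\<in> F \<^bold>\<longrightarrow> K A) \<^bold>\<and> is_Union U F \<^bold>\<longrightarrow> K U)"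

definition UT_cuc_cuc :: oform where
  "UT_cuc_cuc = UT_countable cuc_set"

definition UT_cuf_cuf :: oform where
  "UT_cuf_cuf = UT_countable cuf_set"

end

theory Submission
  imports Defs "HOL-Library.Countable" "HOL-Library.Infinite_Set" "HOL-Computational_Algebra.Fraction_Field"
begin

text \<open>
  By completeness of the calculus it suffices to prove the three implications in every model of ZF,
  where separation and replacement are available for definable predicates and terms only.

  (i) Multiple choice selects, for the \<open>n\<close>-th member of a countable family of \<open>G\<^sub>\<delta>\<close>-sets (zero-sets),
  finitely many sequences of open sets (continuous functions) witnessing that it is one.  Finitely
  many witnesses merge canonically into one, by intersecting the open sets or by taking the maximum
  of the absolute values; no further choice is needed to combine the resulting sequence.

  (ii), (iii) Let \<open>X\<close> be the union of a countable family of sets each of which is a countable union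
  of sets from an ideal \<open>I\<close> (the finite or the countable sets).  Add to the discrete space \<open>X\<close> a
  point \<open>p\<close> whose neighbourhoods are the complements of members of \<open>I\<close>.  This space is
  zero-dimensional and \<open>T\<^sub>1\<close>, hence \<open>T\<^sub>3\<^sub>\<onehalf>\<close>.  Complements of members of \<open>I\<close> are clopen,
  so \<open>{p}\<close> is an iterated countable intersection of zero-sets; if it is a \<open>G\<^sub>\<delta>\<close>, then \<open>X\<close> is a
  countable union of members of \<open>I\<close>.  Here the hypothesis only applies once ZF is known to prove
  that a complete ordered field exists.
\<close>


section \<open>Completeness of the natural deduction calculus\<close>

text \<open>The main obstacle is the existence of a complete ordered field. A model of ZF may have
  nonstandard natural numbers; seen from outside, its rationals need not be Archimedean, and then
  subtraction and inversion fail for arbitrary Dedekind cuts. They succeed for cuts that are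
  definable in the model, because the model satisfies induction for definable predicates.
  Definability is therefore tracked through every construction. Fraction fields, differences and
  cuts are built as HOL types, so the natural numbers of the model must become a type as well. A
  type cannot depend on a model; hence one model without reals, if there is any, is fixed globally
  and finally refuted. This is possible because completeness is proved for models whose universe is
  all of \<open>nat\<close> and whose equality is identity. In the topological part, G-delta sets
  and zero-sets are treated together: the argument only uses a stable class of sets that contains
  the clopen sets and consists of G-delta sets.\<close>

primrec fv :: "fm \<Rightarrow> nat set" where
  "fv Fls = {}"
| "fv (Mem i j) = {i, j}"
| "fv (Eq i j) = {i, j}"
| "fv (Imp p q) = fv p \<union> fv q"
| "fv (All p) = {k. Suc k \<in> fv p}"

lemma finite_fv: "finite (fv p)"
proof (induction p)
  case (All p)
  have "{k. Suc k \<in> fv p} = Suc -` fv p" by auto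
  then show ?case using All by (simp add: finite_vimageI)
qed auto

lemma bounded_fv: "bounded n p \<longleftrightarrow> (\<forall>k\<in>fv p. k < n)"
proof (induction p arbitrary: n)
  case (All p)
  show ?case
  proof
    assume "bounded n (All p)"
    then show "\<forall>k\<in>fv (All p). k < n" using All[of "Suc n"] by auto
  next
    assume *: "\<forall>k\<in>fv (All p). k < n"
    have "k < Suc n" if "k \<in> fv p" for k using * that by (cases k) auto
    then show "bounded n (All p)" using All[of "Suc n"] by auto
  qed
qed auto

lemma rename_cong: "(\<And>k. k \<in> fv p \<Longrightarrow> r k = r' k) \<Longrightarrow> rename r p = rename r' p"
proof (induction p arbitrary: r r')
  case (All p)
  have "case_nat 0 (\<lambda>k. Suc (r k)) k = case_nat 0 (\<lambda>k. Suc (r' k)) k" if "k \<in> fv p" for k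
    using All.prems that by (cases k) auto
  then show ?case using All.IH[of "case_nat 0 (\<lambda>k. Suc (r k))" "case_nat 0 (\<lambda>k. Suc (r' k))"] by simp
next
  case (Imp p q)
  then show ?case by (metis UnCI fv.simps(4) rename.simps(4))
qed auto

lemma rename_rename: "rename r (rename s p) = rename (\<lambda>k. r (s k)) p"
proof (induction p arbitrary: r s)
  case (All p)
  have "(\<lambda>k. case_nat 0 (\<lambda>k. Suc (r k)) (case_nat 0 (\<lambda>k. Suc (s k)) k)) =
      case_nat 0 (\<lambda>k. Suc (r (s k)))"
    by (auto simp: fun_eq_iff split: nat.split)
  then show ?case using All by simp
qed auto

lemma rename_id: "rename (\<lambda>k. k) p = p"
proof (induction p)
  case (All p)
  have "case_nat 0 (\<lambda>k. Suc k) = (\<lambda>k. k)" by (auto simp: fun_eq_iff split: nat.split)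
  then show ?case using All by simp
qed auto

lemma rename_inst: "rename r (inst t p) = inst (r t) (rename (case_nat 0 (\<lambda>k. Suc (r k))) p)"
  unfolding inst_def rename_rename
  by (rule arg_cong[where f = "\<lambda>f. rename f p"]) (auto simp: fun_eq_iff split: nat.split)

lemma rename_lift: "rename (case_nat 0 (\<lambda>k. Suc (r k))) (lift p) = lift (rename r p)"
  unfolding lift_def rename_rename by simp

section \<open>Structural properties of derivations\<close>

lemma derives_weaken: "\<Gamma> \<turnstile> p \<Longrightarrow> \<Gamma> \<subseteq> \<Delta> \<Longrightarrow> \<Delta> \<turnstile> p"
proof (induction arbitrary: \<Delta> rule: derives.induct)
  case (assm p \<Gamma>) then show ?case by (auto intro: derives.assm)
next
  case (impI p \<Gamma> q) show ?case by (rule derives.impI, rule impI.IH) (use impI in auto)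
next
  case (impE \<Gamma> p q) then show ?case by (blast intro: derives.impE)
next
  case (raa p \<Gamma>) show ?case by (rule derives.raa, rule raa.IH) (use raa in auto)
next
  case (allI \<Gamma> p) show ?case by (rule derives.allI, rule allI.IH) (use allI in auto)
next
  case (allE \<Gamma> p t) then show ?case by (blast intro: derives.allE)
next
  case (refl \<Gamma> t) show ?case by (rule derives.refl)
next
  case (subst \<Gamma> s t p) then show ?case by (blast intro: derives.subst)
qed

text \<open>The rule \<open>allI\<close> only generalizes variable 0; renaming is what lets any
  fresh variable take that role in \<open>derives_generalize\<close>.\<close>

lemma derives_rename: "\<Gamma> \<turnstile> p \<Longrightarrow> rename r ` \<Gamma> \<turnstile> rename r p"
proof (induction arbitrary: r rule: derives.induct)
  case (assm p \<Gamma>) then show ?case by (auto intro: derives.assm)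
next
  case (impI p \<Gamma> q) then show ?case by (simp add: derives.impI)
next
  case (impE \<Gamma> p q) then show ?case by (metis derives.impE rename.simps(4))
next
  case (raa p \<Gamma>)
  show ?case by (rule derives.raa) (use raa.IH[of r] in simp)
next
  case (allI \<Gamma> p)
  let ?r = "case_nat 0 (\<lambda>k. Suc (r k))"
  have "rename ?r ` lift ` \<Gamma> = lift ` rename r ` \<Gamma>"
    by (simp add: image_image rename_lift)
  then show ?case using allI.IH[of ?r] by (simp add: derives.allI)
next
  case (allE \<Gamma> p t)
  then show ?case unfolding rename_inst using derives.allE by fastforce
next
  case (refl \<Gamma> t) show ?case by (simp add: derives.refl)
next
  case (subst \<Gamma> s t p)
  then show ?case unfolding rename_inst using derives.subst by fastforce
qed

text \<open>Compactness: an inconsistency of the limit of the Henkin construction already shows at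
  some stage.\<close>

lemma derives_finite: "\<Gamma> \<turnstile> p \<Longrightarrow> \<exists>\<Delta>. finite \<Delta> \<and> \<Delta> \<subseteq> \<Gamma> \<and> \<Delta> \<turnstile> p"
proof (induction rule: derives.induct)
  case (assm p \<Gamma>)
  then show ?case by (intro exI[of _ "{p}"]) (auto intro: derives.assm)
next
  case (impI p \<Gamma> q)
  then obtain \<Delta> where \<Delta>: "finite \<Delta>" "\<Delta> \<subseteq> insert p \<Gamma>" "\<Delta> \<turnstile> q" by blast
  have "insert p (\<Delta> - {p}) \<turnstile> q" using \<Delta>(3) by (rule derives_weaken) auto
  then have "\<Delta> - {p} \<turnstile> Imp p q" by (rule derives.impI)
  then show ?case using \<Delta> by (intro exI[of _ "\<Delta> - {p}"]) auto
next
  case (impE \<Gamma> p q)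
  then obtain \<Delta> \<Delta>' where "finite \<Delta>" "\<Delta> \<subseteq> \<Gamma>" "\<Delta> \<turnstile> Imp p q" "finite \<Delta>'" "\<Delta>' \<subseteq> \<Gamma>" "\<Delta>' \<turnstile> p" by blast
  then show ?case
    by (intro exI[of _ "\<Delta> \<union> \<Delta>'"]) (auto intro: derives.impE derives_weaken)
next
  case (raa p \<Gamma>)
  then obtain \<Delta> where \<Delta>: "finite \<Delta>" "\<Delta> \<subseteq> insert (Imp p Fls) \<Gamma>" "\<Delta> \<turnstile> Fls" by blast
  have "insert (Imp p Fls) (\<Delta> - {Imp p Fls}) \<turnstile> Fls" using \<Delta>(3) by (rule derives_weaken) auto
  then have "\<Delta> - {Imp p Fls} \<turnstile> p" by (rule derives.raa)
  then show ?case using \<Delta> by (intro exI[of _ "\<Delta> - {Imp p Fls}"]) auto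
next
  case (allI \<Gamma> p)
  then obtain \<Delta> where \<Delta>: "finite \<Delta>" "\<Delta> \<subseteq> lift ` \<Gamma>" "\<Delta> \<turnstile> p" by blast
  then obtain \<Delta>' where "finite \<Delta>'" "\<Delta>' \<subseteq> \<Gamma>" "\<Delta> = lift ` \<Delta>'" by (meson finite_subset_image)
  then show ?case using \<Delta> by (blast intro: derives.allI)
next
  case (allE \<Gamma> p t) then show ?case by (blast intro: derives.allE)
next
  case (refl \<Gamma> t) show ?case by (intro exI[of _ "{}"]) (auto intro: derives.refl)
next
  case (subst \<Gamma> s t p)
  then obtain \<Delta> \<Delta>' where "finite \<Delta>" "\<Delta> \<subseteq> \<Gamma>" "\<Delta> \<turnstile> Eq s t" "finite \<Delta>'" "\<Delta>' \<subseteq> \<Gamma>" "\<Delta>' \<turnstile> inst s p" by blast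
  then show ?case
    by (intro exI[of _ "\<Delta> \<union> \<Delta>'"]) (auto intro: derives.subst derives_weaken)
qed

text \<open>Renaming the fresh variable \<open>t\<close> to 0 and shifting all others turns \<open>inst t p\<close> into \<open>p\<close>.\<close>

lemma derives_generalize:
  assumes "\<Gamma> \<turnstile> inst t p" and "\<And>q. q \<in> \<Gamma> \<Longrightarrow> t \<notin> fv q" and "t \<notin> fv (All p)"
  shows "\<Gamma> \<turnstile> All p"
proof -
  let ?r = "\<lambda>k. if k = t then 0 else Suc k"
  have "rename ?r q = lift q" if "q \<in> \<Gamma>" for q
    unfolding lift_def by (rule rename_cong) (use assms(2)[OF that] in auto)
  then have 1: "rename ?r ` \<Gamma> = lift ` \<Gamma>" by (auto simp: image_iff)
  have "rename ?r (inst t p) = rename (\<lambda>k. k) p"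
    unfolding inst_def rename_rename
    by (rule rename_cong) (use assms(3) in \<open>auto split: nat.split\<close>)
  then have "rename ?r (inst t p) = p" by (simp add: rename_id)
  then have "lift ` \<Gamma> \<turnstile> p" using derives_rename[OF assms(1), of ?r] 1 by simp
  then show ?thesis by (rule derives.allI)
qed

lemma derives_cut: "\<Gamma> \<turnstile> p \<Longrightarrow> insert p \<Gamma> \<turnstile> q \<Longrightarrow> \<Gamma> \<turnstile> q"
  by (meson derives.impE derives.impI)

section \<open>Henkin extension of a consistent set of formulas\<close>

instance fm :: countable
  by countable_datatype

definition fresh :: "fm set \<Rightarrow> nat" where
  "fresh \<Gamma> = (SOME t. \<forall>q\<in>\<Gamma>. t \<notin> fv q)"

text \<open>A refuted universal formula receives a counterexample. No constants are adjoined: only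
  finitely many variables are free at each stage, so a fresh variable of the language can name
  it.\<close>

definition witness :: "fm set \<Rightarrow> fm \<Rightarrow> fm" where
  "witness \<Gamma> p = (case p of Imp (All q) Fls \<Rightarrow> Imp (inst (fresh (insert p \<Gamma>)) q) Fls | _ \<Rightarrow> p)"

primrec henkin :: "fm set \<Rightarrow> nat \<Rightarrow> fm set" where
  "henkin \<Gamma> 0 = \<Gamma>"
| "henkin \<Gamma> (Suc n) =
    (let p = from_nat n in
     if insert p (henkin \<Gamma> n) \<turnstile> Fls then henkin \<Gamma> n
     else {witness (henkin \<Gamma> n) p, p} \<union> henkin \<Gamma> n)"

lemma fresh:
  assumes "finite (\<Union>(fv ` \<Gamma>))"
  shows "\<forall>q\<in>\<Gamma>. fresh \<Gamma> \<notin> fv q"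
proof -
  obtain t where "t \<notin> \<Union>(fv ` \<Gamma>)" using ex_new_if_finite[OF infinite_UNIV_nat assms] by blast
  then have "\<exists>t. \<forall>q\<in>\<Gamma>. t \<notin> fv q" by blast
  then show ?thesis unfolding fresh_def by (rule someI_ex)
qed

text \<open>If the witness were inconsistent with \<open>p\<close>, reductio would give
  \<open>inst t q\<close> for the fresh \<open>t\<close>, hence \<open>All q\<close> by
  generalization, against \<open>p\<close>.\<close>

lemma witness_consistent:
  assumes fin: "finite (\<Union>(fv ` \<Gamma>))" and con: "\<not> insert p \<Gamma> \<turnstile> Fls"
  shows "\<not> {witness \<Gamma> p, p} \<union> \<Gamma> \<turnstile> Fls"
proof (cases "\<exists>q. p = Imp (All q) Fls")
  case True
  then obtain q where p: "p = Imp (All q) Fls" by blast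
  let ?t = "fresh (insert p \<Gamma>)"
  have fr: "\<forall>q\<in>insert p \<Gamma>. ?t \<notin> fv q" by (rule fresh) (use fin finite_fv in simp)
  show ?thesis
  proof
    assume "{witness \<Gamma> p, p} \<union> \<Gamma> \<turnstile> Fls"
    then have "insert (Imp (inst ?t q) Fls) (insert p \<Gamma>) \<turnstile> Fls" by (simp add: witness_def p)
    then have "insert p \<Gamma> \<turnstile> inst ?t q" by (rule derives.raa)
    then have "insert p \<Gamma> \<turnstile> All q" by (rule derives_generalize) (use fr p in auto)
    then have "insert p \<Gamma> \<turnstile> Fls" using p by (metis derives.assm derives.impE insertI1)
    then show False using con by blast
  qed
next
  case False
  then have "witness \<Gamma> p = p" unfolding witness_def by (auto split: fm.split)
  then show ?thesis using con by simp
qed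

lemma finite_fv_henkin: "finite (\<Union>(fv ` \<Gamma>)) \<Longrightarrow> finite (\<Union>(fv ` henkin \<Gamma> n))"
  by (induction n) (auto simp: Let_def finite_fv)

lemma henkin_consistent:
  assumes "finite (\<Union>(fv ` \<Gamma>))" "\<not> \<Gamma> \<turnstile> Fls"
  shows "\<not> henkin \<Gamma> n \<turnstile> Fls"
proof (induction n)
  case (Suc n)
  then show ?case using witness_consistent[OF finite_fv_henkin[OF assms(1)], of "from_nat n" n]
    by (simp add: Let_def)
qed (use assms in simp)

lemma henkin_mono: "m \<le> n \<Longrightarrow> henkin \<Gamma> m \<subseteq> henkin \<Gamma> n"
proof (induction n)
  case (Suc n)
  have "henkin \<Gamma> n \<subseteq> henkin \<Gamma> (Suc n)" by (auto simp: Let_def)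
  then show ?case using Suc by (cases "m = Suc n") auto
qed simp

lemma henkin_set:
  assumes fin: "finite (\<Union>(fv ` \<Gamma>))" and con: "\<not> \<Gamma> \<turnstile> Fls"
  obtains H where "\<Gamma> \<subseteq> H" "\<And>p. H \<turnstile> p \<longleftrightarrow> p \<in> H" "Fls \<notin> H" "\<And>p. p \<in> H \<or> Imp p Fls \<in> H"
    "\<And>q. Imp (All q) Fls \<in> H \<Longrightarrow> \<exists>t. Imp (inst t q) Fls \<in> H"
proof -
  define H where "H = (\<Union>n. henkin \<Gamma> n)"
  have sub: "henkin \<Gamma> n \<subseteq> H" for n unfolding H_def by blast
  have conH: "\<not> H \<turnstile> Fls"
  proof
    assume "H \<turnstile> Fls"
    then obtain \<Delta> where \<Delta>: "finite \<Delta>" "\<Delta> \<subseteq> H" "\<Delta> \<turnstile> Fls" using derives_finite by blast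
    from \<Delta>(1,2) have "\<exists>n. \<Delta> \<subseteq> henkin \<Gamma> n"
    proof (induction \<Delta>)
      case (insert p F)
      then obtain n m where "F \<subseteq> henkin \<Gamma> n" "p \<in> henkin \<Gamma> m" unfolding H_def by auto
      then have "insert p F \<subseteq> henkin \<Gamma> (max n m)"
        using henkin_mono[of n "max n m" \<Gamma>] henkin_mono[of m "max n m" \<Gamma>] by auto
      then show ?case by blast
    qed simp
    then show False using \<Delta>(3) henkin_consistent[OF fin con] derives_weaken by blast
  qed
  \<comment> \<open>The formula \<open>p\<close> is treated at stage \<open>to_nat p\<close>. Being
    consistent with the limit, it is consistent with that stage and enters together with its
    witness.\<close>
  have step: "p \<in> H \<and> witness (henkin \<Gamma> (to_nat p)) p \<in> H" if "\<not> insert p H \<turnstile> Fls" for p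
  proof -
    have "\<not> insert p (henkin \<Gamma> (to_nat p)) \<turnstile> Fls"
      using that derives_weaken[of _ Fls "insert p H"] sub[of "to_nat p"] by blast
    then have "{witness (henkin \<Gamma> (to_nat p)) p, p} \<subseteq> henkin \<Gamma> (Suc (to_nat p))"
      by (simp add: Let_def)
    then show ?thesis using sub[of "Suc (to_nat p)"] by blast
  qed
  have ded: "H \<turnstile> p \<longleftrightarrow> p \<in> H" for p
  proof
    assume "H \<turnstile> p"
    then have "\<not> insert p H \<turnstile> Fls" using conH derives_cut by blast
    then show "p \<in> H" using step by blast
  qed (rule derives.assm)
  have neg: "p \<in> H \<or> Imp p Fls \<in> H" for p
    using step[of p] derives.impI[of p H Fls] ded by blast
  have wit: "\<exists>t. Imp (inst t q) Fls \<in> H" if "Imp (All q) Fls \<in> H" for q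
  proof -
    have "\<not> insert (Imp (All q) Fls) H \<turnstile> Fls" using that conH by (simp add: insert_absorb)
    from step[OF this] show ?thesis unfolding witness_def by auto
  qed
  show ?thesis using that[of H] sub[of 0] ded conH neg wit by simp
qed

section \<open>Satisfaction and the term model\<close>

primrec sat :: "('a \<Rightarrow> 'a \<Rightarrow> bool) \<Rightarrow> ('a \<Rightarrow> 'a \<Rightarrow> bool) \<Rightarrow> (nat \<Rightarrow> 'a) \<Rightarrow> fm \<Rightarrow> bool" where
  "sat E Q e Fls \<longleftrightarrow> False"
| "sat E Q e (Mem i j) \<longleftrightarrow> E (e i) (e j)"
| "sat E Q e (Eq i j) \<longleftrightarrow> Q (e i) (e j)"
| "sat E Q e (Imp p q) \<longleftrightarrow> (sat E Q e p \<longrightarrow> sat E Q e q)"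
| "sat E Q e (All p) \<longleftrightarrow> (\<forall>a. sat E Q (case_nat a e) p)"

lemma sat_rename: "sat E Q e (rename r p) \<longleftrightarrow> sat E Q (\<lambda>k. e (r k)) p"
proof (induction p arbitrary: e r)
  case (All p)
  have "(\<lambda>k. case_nat a e (case_nat 0 (\<lambda>k. Suc (r k)) k)) = case_nat a (\<lambda>k. e (r k))" for a
    by (auto simp: fun_eq_iff split: nat.split)
  then show ?case using All by simp
qed auto

lemma sat_cong: "(\<And>k. k \<in> fv p \<Longrightarrow> e k = e' k) \<Longrightarrow> sat E Q e p \<longleftrightarrow> sat E Q e' p"
proof (induction p arbitrary: e e')
  case (All p)
  have "case_nat a e k = case_nat a e' k" if "k \<in> fv p" for k a
    using All.prems that by (cases k) auto
  then have "sat E Q (case_nat a e) p = sat E Q (case_nat a e') p" for a by (rule All.IH)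
  then show ?case by simp
next
  case (Imp p q)
  then show ?case by (metis UnCI fv.simps(4) sat.simps(4))
qed auto

text \<open>The truth lemma inducts on size: \<open>inst t q\<close> is not a subformula of
  \<open>All q\<close>, but it is smaller.\<close>

lemma size_rename [simp]: "size (rename r p) = size p"
  by (induction p arbitrary: r) auto

text \<open>The universe consists of the variables, each denoting itself. Maximality settles
  implications, and the witnesses settle universal formulas.\<close>

lemma henkin_truth:
  assumes "\<And>p. H \<turnstile> p \<longleftrightarrow> p \<in> H" "Fls \<notin> H" "\<And>p. p \<in> H \<or> Imp p Fls \<in> H"
    "\<And>q. Imp (All q) Fls \<in> H \<Longrightarrow> \<exists>t. Imp (inst t q) Fls \<in> H"
  shows "sat (\<lambda>i j. Mem i j \<in> H) (\<lambda>i j. Eq i j \<in> H) (\<lambda>k. k) p \<longleftrightarrow> p \<in> H"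
proof (induction p rule: measure_induct_rule[of size])
  case (less p)
  have mp: "q \<in> H" if "Imp p q \<in> H" "p \<in> H" for p q
    using that assms(1) derives.impE by blast
  show ?case
  proof (cases p)
    case Fls then show ?thesis using assms(2) by simp
  next
    case (Imp q r)
    have "Imp q r \<in> H" if "r \<in> H"
      using that assms(1) derives.impI[of q H r] derives_weaken[of H r "insert q H"] by blast
    moreover have "Imp q r \<in> H" if "Imp q Fls \<in> H"
    proof -
      have "insert q H \<turnstile> Fls" using that derives.impE[of "insert q H" q Fls] by (simp add: derives.assm)
      then have "insert (Imp r Fls) (insert q H) \<turnstile> Fls" by (rule derives_weaken) blast
      then have "insert q H \<turnstile> r" by (rule derives.raa)
      then show ?thesis using assms(1) derives.impI by blast
    qed
    ultimately have "Imp q r \<in> H \<longleftrightarrow> (q \<in> H \<longrightarrow> r \<in> H)"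
      using mp[of q r] mp[of q Fls] assms(2,3) by blast
    then show ?thesis using less[of q] less[of r] Imp by simp
  next
    case (All q)
    have eq: "(\<lambda>k. case_nat t id k) = case_nat t (\<lambda>k. k)" for t :: nat
      by (auto simp: fun_eq_iff split: nat.split)
    have "sat (\<lambda>i j. Mem i j \<in> H) (\<lambda>i j. Eq i j \<in> H) (case_nat t (\<lambda>k. k)) q \<longleftrightarrow> inst t q \<in> H" for t
      using less[of "inst t q"] All unfolding inst_def sat_rename eq by simp
    moreover have "All q \<in> H \<longleftrightarrow> (\<forall>t. inst t q \<in> H)"
    proof
      assume "All q \<in> H"
      then show "\<forall>t. inst t q \<in> H" using assms(1) derives.allE by blast
    next
      assume *: "\<forall>t. inst t q \<in> H"
      show "All q \<in> H" using assms(3)[of "All q"] assms(4)[of q] * mp assms(2) by blast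
    qed
    ultimately show ?thesis using All by simp
  qed auto
qed

text \<open>Distinct variables may be provably equal, so equality is at this point only a congruence
  \<open>Q\<close>; \<open>ZF_complete\<close> passes to its classes.\<close>

lemma henkin_model:
  assumes "finite (\<Union>(fv ` \<Gamma>))" "\<not> \<Gamma> \<turnstile> p"
  obtains E Q :: "nat \<Rightarrow> nat \<Rightarrow> bool"
  where "equivp Q" "\<And>x x' y y'. Q x x' \<Longrightarrow> Q y y' \<Longrightarrow> E x y \<Longrightarrow> E x' y'"
    "\<And>q. q \<in> \<Gamma> \<Longrightarrow> sat E Q (\<lambda>k. k) q" "\<not> sat E Q (\<lambda>k. k) p"
proof -
  have con: "\<not> insert (Imp p Fls) \<Gamma> \<turnstile> Fls" using assms(2) derives.raa by blast
  have fin: "finite (\<Union>(fv ` insert (Imp p Fls) \<Gamma>))" using assms(1) finite_fv by simp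
  from henkin_set[OF fin con] obtain H where H: "insert (Imp p Fls) \<Gamma> \<subseteq> H"
    "\<And>p. H \<turnstile> p \<longleftrightarrow> p \<in> H" "Fls \<notin> H" "\<And>p. p \<in> H \<or> Imp p Fls \<in> H"
    "\<And>q. Imp (All q) Fls \<in> H \<Longrightarrow> \<exists>t. Imp (inst t q) Fls \<in> H" by metis
  define E where "E i j \<longleftrightarrow> Mem i j \<in> H" for i j
  define Q where "Q i j \<longleftrightarrow> Eq i j \<in> H" for i j
  have truth: "sat E Q (\<lambda>k. k) q \<longleftrightarrow> q \<in> H" for q
    using henkin_truth[OF H(2-5), of q] unfolding E_def[abs_def] Q_def[abs_def] .
  have subst: "inst t q \<in> H" if "Q s t" "inst s q \<in> H" for s t q
    using that H(2) derives.subst unfolding Q_def by blast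
  have refl: "Q x x" for x unfolding Q_def using H(2) derives.refl by blast
  \<comment> \<open>Symmetry and transitivity arise by substitution into an equation that has
    variable 0 on one side.\<close>
  have sym: "Q y x" if "Q x y" for x y
    using subst[OF that, of "Eq 0 (Suc x)"] refl[of x] by (simp add: inst_def Q_def)
  have trans: "Q x z" if "Q x y" "Q y z" for x y z
    using subst[OF that(2), of "Eq (Suc x) 0"] that(1) by (simp add: inst_def Q_def)
  have "E x' y'" if "Q x x'" "Q y y'" "E x y" for x x' y y'
  proof -
    have "E x' y" using subst[OF that(1), of "Mem 0 (Suc y)"] that(3) by (simp add: inst_def E_def)
    then show ?thesis using subst[OF that(2), of "Mem (Suc x') 0"] by (simp add: inst_def E_def)
  qed
  moreover have "equivp Q"
    by (rule equivpI) (auto simp: reflp_def symp_def transp_def refl intro: sym trans)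
  moreover have "\<not> sat E Q (\<lambda>k. k) p"
  proof
    assume "sat E Q (\<lambda>k. k) p"
    moreover have "sat E Q (\<lambda>k. k) (Imp p Fls)" using truth H(1) by blast
    ultimately show False by simp
  qed
  ultimately show ?thesis using that[of Q E] truth H(1) by blast
qed

text \<open>The function \<open>f\<close> meets every class of \<open>Q\<close> exactly once, so
  pulling the structure back along \<open>f\<close> realizes the quotient on the type of
  indices.\<close>

lemma sat_quotient:
  assumes "\<And>x. \<exists>i. Q (f i) x" "\<And>x x' y y'. Q x x' \<Longrightarrow> Q y y' \<Longrightarrow> E x y \<Longrightarrow> E x' y'"
    "equivp Q" "\<And>i j. Q (f i) (f j) \<longleftrightarrow> i = j"
  shows "(\<And>k. Q (f (e k)) (e' k)) \<Longrightarrow> sat (\<lambda>i j. E (f i) (f j)) (=) e p \<longleftrightarrow> sat E Q e' p"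
proof (induction p arbitrary: e e')
  case (Mem i j)
  have "Q (f (e i)) (e' i)" "Q (f (e j)) (e' j)" using Mem by blast+
  then show ?case using assms(2) equivp_symp[OF assms(3)] unfolding sat.simps by blast
next
  case (Eq i j)
  have "Q (f (e i)) (e' i)" "Q (f (e j)) (e' j)" using Eq by blast+
  then have "Q (e' i) (e' j) \<longleftrightarrow> Q (f (e i)) (f (e j))"
    using equivp_symp[OF assms(3)] equivp_transp[OF assms(3)] by blast
  then show ?case using assms(4) by simp
next
  case (Imp p q)
  show ?case using Imp.IH(1)[of e e', OF Imp.prems] Imp.IH(2)[of e e', OF Imp.prems] by simp
next
  case (All p)
  have ext: "sat (\<lambda>i j. E (f i) (f j)) (=) (case_nat i e) p \<longleftrightarrow> sat E Q (case_nat x e') p"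
    if "Q (f i) x" for i x
    by (rule All.IH) (use that All.prems in \<open>auto split: nat.split\<close>)
  have "sat E Q (case_nat x e') p" if "\<forall>i. sat (\<lambda>i j. E (f i) (f j)) (=) (case_nat i e) p" for x
    using assms(1)[of x] ext that by blast
  moreover have "sat (\<lambda>i j. E (f i) (f j)) (=) (case_nat i e) p" if "\<forall>x. sat E Q (case_nat x e') p" for i
    using ext[of i "f i"] equivp_reflp[OF assms(3)] that by blast
  ultimately show ?case unfolding sat.simps by blast
qed simp


section \<open>Evaluation of formulas in a model of ZF\<close>

text \<open>Translates indices back into levels: at depth \<open>n\<close>, index \<open>i\<close>
  below \<open>n\<close> is level \<open>n - Suc i\<close>, and the indices from \<open>n\<close> on
  are the parameters of an instance of a scheme.\<close>

definition sem ::
  "('a \<Rightarrow> 'a \<Rightarrow> bool) \<Rightarrow> ('a \<Rightarrow> 'a \<Rightarrow> bool) \<Rightarrow> (nat \<Rightarrow> 'a) \<Rightarrow> oform \<Rightarrow> nat \<Rightarrow> (nat \<Rightarrow> 'a) \<Rightarrow> bool" where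
  "sem E Q prm f n v = sat E Q (\<lambda>i. if i < n then v (n - Suc i) else prm (i - n)) (f n)"

lemma sem_connectives [simp]:
  "sem E Q prm (p \<^bold>\<longrightarrow> q) n v \<longleftrightarrow> (sem E Q prm p n v \<longrightarrow> sem E Q prm q n v)"
  "sem E Q prm (\<^bold>\<not> p) n v \<longleftrightarrow> \<not> sem E Q prm p n v"
  "sem E Q prm (p \<^bold>\<and> q) n v \<longleftrightarrow> sem E Q prm p n v \<and> sem E Q prm q n v"
  "sem E Q prm (p \<^bold>\<or> q) n v \<longleftrightarrow> sem E Q prm p n v \<or> sem E Q prm q n v"
  "sem E Q prm (p \<^bold>\<longleftrightarrow> q) n v \<longleftrightarrow> (sem E Q prm p n v \<longleftrightarrow> sem E Q prm q n v)"
  by (auto simp: sem_def fimp_def fnot_def fand_def f_or_def fiff_def)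

lemma sem_atoms [simp]:
  "x < n \<Longrightarrow> y < n \<Longrightarrow> sem E Q prm (x \<^bold>\<in> y) n v \<longleftrightarrow> E (v x) (v y)"
  "x < n \<Longrightarrow> y < n \<Longrightarrow> sem E Q prm (x \<^bold>= y) n v \<longleftrightarrow> Q (v x) (v y)"
  by (auto simp: sem_def fmem_def feq_def)

lemma sem_all [simp]: "sem E Q prm (fall p) n v \<longleftrightarrow> (\<forall>a. sem E Q prm (p n) (Suc n) (v(n := a)))"
proof -
  have "case_nat a (\<lambda>i. if i < n then v (n - Suc i) else prm (i - n)) =
      (\<lambda>i. if i < Suc n then (v(n := a)) (Suc n - Suc i) else prm (i - Suc n))" for a
    by (auto simp: fun_eq_iff split: nat.split)
  then show ?thesis by (simp add: sem_def fall_def)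
qed

lemma sem_ex [simp]: "sem E Q prm (fex p) n v \<longleftrightarrow> (\<exists>a. sem E Q prm (p n) (Suc n) (v(n := a)))"
  by (simp add: fex_def)

lemma sem_app1 [simp]: "x < n \<Longrightarrow> sem E Q prm (app p [x]) n v \<longleftrightarrow> sat E Q (case_nat (v x) prm) p"
  unfolding sem_def app_def sat_rename
  by (rule arg_cong[where f = "\<lambda>e. sat E Q e p"]) (auto simp: fun_eq_iff split: nat.split)

lemma sem_app2 [simp]:
  "x < n \<Longrightarrow> y < n \<Longrightarrow>
    sem E Q prm (app p [x, y]) n v \<longleftrightarrow> sat E Q (case_nat (v x) (case_nat (v y) prm)) p"
  unfolding sem_def app_def sat_rename
  by (rule arg_cong[where f = "\<lambda>e. sat E Q e p"]) (auto simp: fun_eq_iff nth_Cons split: nat.split)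

lemma bounded_closure: "bounded (n + m) q \<Longrightarrow> bounded n ((All ^^ m) q)"
  by (induction m arbitrary: n) auto

lemma sat_closure: "(\<And>e. sat E Q e ((All ^^ m) q)) \<Longrightarrow> sat E Q e q"
proof (induction m arbitrary: e)
  case (Suc m)
  have "sat E Q e ((All ^^ m) q)" for e
  proof -
    have "sat E Q (case_nat (e 0) (\<lambda>k. e (Suc k))) ((All ^^ m) q)"
      using Suc.prems[of "\<lambda>k. e (Suc k)"] by simp
    moreover have "case_nat (e 0) (\<lambda>k. e (Suc k)) = e" by (auto simp: fun_eq_iff split: nat.split)
    ultimately show ?thesis by simp
  qed
  then show ?case by (rule Suc.IH)
qed simp

text \<open>Sentences leave all variables fresh for the Henkin construction, and their truth does
  not depend on the assignment.\<close>

lemma ZF_closed: "p \<in> ZF \<Longrightarrow> fv p = {}"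
proof -
  assume "p \<in> ZF"
  then have "bounded 0 p"
    unfolding ZF_def
    by (auto intro: bounded_closure[where n = 0, simplified]
        simp: extensionality_ax_def foundation_ax_def pairing_ax_def
          union_ax_def power_set_ax_def infinity_ax_def fall_def fex_def fimp_def fnot_def fand_def
          f_or_def fiff_def fmem_def feq_def nonempty_def is_upair_def is_Union_def fsubset_def
          is_inductive_def is_empty_def is_succ_def)
  then show ?thesis by (auto simp: bounded_fv)
qed

lemma exists_bound: "\<exists>m. bounded m p"
  using finite_fv[of p] unfolding bounded_fv finite_nat_set_iff_bounded .

lemma ZF_schemes: "\<exists>m. (All ^^ m) (separation p 0) \<in> ZF" "\<exists>m. (All ^^ m) (replacement p 0) \<in> ZF"
  using exists_bound[of "separation p 0"] exists_bound[of "replacement p 0"]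
  unfolding ZF_def by fast+

locale zf =
  fixes E :: "'a \<Rightarrow> 'a \<Rightarrow> bool" (infix "\<epsilon>" 50)
  assumes ZF: "p \<in> ZF \<Longrightarrow> sat E (=) e p"

text \<open>The classes of the term model can be renumbered by all of \<open>nat\<close> because
  there are infinitely many of them. Fixing the universe in this way later allows quantifying over
  all models at once.\<close>

theorem ZF_complete:
  assumes valid: "\<And>(E :: nat \<Rightarrow> nat \<Rightarrow> bool) e. zf E \<Longrightarrow> sat E (=) e p"
  shows "ZF \<turnstile> p"
proof (rule ccontr)
  assume unprovable: "\<not> ZF \<turnstile> p"
  have fin: "finite (\<Union>(fv ` ZF))" using ZF_closed by simp
  obtain E Q :: "nat \<Rightarrow> nat \<Rightarrow> bool"
    where Q: "equivp Q" and E: "\<And>x x' y y'. Q x x' \<Longrightarrow> Q y y' \<Longrightarrow> E x y \<Longrightarrow> E x' y'"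
      and ZF: "\<And>q. q \<in> ZF \<Longrightarrow> sat E Q (\<lambda>k. k) q" and p: "\<not> sat E Q (\<lambda>k. k) p"
    by (rule henkin_model[OF fin unprovable], rule that, assumption+)
  have refl: "Q x x" for x using Q by (rule equivp_reflp)
  \<comment> \<open>Taking the least variable makes the representative depend on the class
    alone.\<close>
  define rep where "rep x = (LEAST y. Q x y)" for x
  have rep: "Q x (rep x)" for x unfolding rep_def by (rule LeastI[of "Q x"]) (rule refl)
  have rep_eq: "rep x = rep y \<longleftrightarrow> Q x y" for x y
  proof
    assume "rep x = rep y"
    then have "Q x (rep y)" using rep[of x] by simp
    then show "Q x y" using equivp_transp[OF Q] equivp_symp[OF Q rep[of y]] by blast
  next
    assume "Q x y"
    then have "Q x = Q y" using Q by (simp add: equivp_def)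
    then show "rep x = rep y" by (simp add: rep_def)
  qed
  have rep_rep: "rep (rep x) = rep x" for x using rep_eq[of x "rep x"] rep[of x] by simp
  have sem: "sem E Q prm f 0 v" if "f 0 \<in> ZF" for f prm v
  proof -
    have "sat E Q (\<lambda>i. if i < 0 then v (0 - Suc i) else prm (i - 0)) (f 0) \<longleftrightarrow> sat E Q (\<lambda>k. k) (f 0)"
      by (rule sat_cong) (use ZF_closed[OF that] in simp)
    then show ?thesis using ZF[OF that] by (simp add: sem_def)
  qed
  have "sem E Q (\<lambda>k. k) infinity_ax 0 (\<lambda>k. k)" by (rule sem) (simp add: ZF_def)
  then obtain z where z: "\<not> E x z" for x by (auto simp: infinity_ax_def is_inductive_def is_empty_def)
  have "sem E Q (\<lambda>k. k) pairing_ax 0 (\<lambda>k. k)" by (rule sem) (simp add: ZF_def)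
  then have "\<exists>s. \<forall>y. E y s \<longleftrightarrow> Q y x" for x by (simp add: pairing_ax_def is_upair_def) blast
  then obtain sg where sg: "E y (sg x) \<longleftrightarrow> Q y x" for x y by metis
  text \<open>Finitely many classes are impossible: the injection sending a class to its singleton would
    be onto, but the empty set is no singleton.\<close>
  have inf: "infinite (range rep)"
  proof
    assume fin: "finite (range rep)"
    have inj_sg: "inj_on (\<lambda>x. rep (sg x)) (range rep)"
    proof (rule inj_onI)
      fix x y assume x: "x \<in> range rep" and y: "y \<in> range rep" and "rep (sg x) = rep (sg y)"
      then have "Q (sg x) (sg y)" using rep_eq by blast
      then have "E x (sg y)" using E[of x x "sg x" "sg y"] sg refl by blast
      then have "Q x y" using sg by blast
      then have "rep x = rep y" using rep_eq by simp
      moreover have "rep x = x" "rep y = y" using x y rep_rep by auto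
      ultimately show "x = y" by simp
    qed
    have "(\<lambda>x. rep (sg x)) ` range rep = range rep"
      by (rule endo_inj_surj[OF fin _ inj_sg]) auto
    then have "rep z \<in> (\<lambda>x. rep (sg x)) ` range rep" by blast
    then obtain x where "rep (sg x) = rep z" by auto
    then have "Q (sg x) z" unfolding rep_eq .
    then show False using E[of x x "sg x" z] sg refl z by blast
  qed
  define f where "f = enumerate (range rep)"
  have f: "bij_betw f UNIV (range rep)" unfolding f_def using inf by (rule bij_enumerate)
  have f_rep: "rep (f i) = f i" for i
  proof -
    have "f i \<in> range rep" using bij_betwE[OF f] by blast
    then show ?thesis using rep_rep by auto
  qed
  have sur: "\<exists>i. Q (f i) x" for x
  proof -
    have "rep x \<in> range f" using bij_betw_imp_surj_on[OF f] by blast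
    then obtain i where "f i = rep x" by auto
    then show ?thesis using equivp_symp[OF Q rep[of x]] by (intro exI[of _ i]) simp
  qed
  have inj: "Q (f i) (f j) \<longleftrightarrow> i = j" for i j
    using rep_eq[of "f i" "f j"] bij_betw_imp_inj_on[OF f] by (simp add: f_rep inj_eq)
  define E' where "E' i j = E (f i) (f j)" for i j
  have sat': "sat E' (=) e q \<longleftrightarrow> sat E Q (\<lambda>k. f (e k)) q" for e q
    unfolding E'_def by (rule sat_quotient) (use sur E Q inj refl in blast)+
  have "zf E'"
  proof
    fix q e assume "q \<in> ZF"
    then show "sat E' (=) e q"
      using ZF[of q] sat_cong[of q "\<lambda>k. f (e k)" "\<lambda>k. k"] ZF_closed[of q] unfolding sat' by simp
  qed
  \<comment> \<open>An assignment that sends each variable to the index of its class reproduces the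
    valuation under which \<open>p\<close> fails.\<close>
  from valid[OF this] have "sat E' (=) (\<lambda>k. SOME i. Q (f i) k) p" .
  moreover have "sat E' (=) (\<lambda>k. SOME i. Q (f i) k) p \<longleftrightarrow> sat E Q (\<lambda>k. k) p"
    unfolding E'_def
    by (rule sat_quotient) (use sur E Q inj in \<open>blast intro: someI_ex[OF sur]\<close>)+
  ultimately show False using p by blast
qed

section \<open>Definable predicates and terms\<close>

context zf
begin

text \<open>
  \<open>D P\<close> says that the predicate \<open>P\<close> on assignments is definable by a formula with parameters, and
  \<open>T t\<close> that the graph of \<open>t\<close> is.  The variable 0 plays the role of the innermost bound one.
\<close>

definition base :: "((nat \<Rightarrow> 'a) \<Rightarrow> 'a) \<Rightarrow> bool" where
  "base t \<longleftrightarrow> (\<exists>i. t = (\<lambda>e. e i)) \<or> (\<exists>c. t = (\<lambda>e. c))"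

definition D :: "((nat \<Rightarrow> 'a) \<Rightarrow> bool) \<Rightarrow> bool" where
  "D P \<longleftrightarrow> (\<exists>p \<tau>. (\<forall>k. base (\<tau> k)) \<and> (\<forall>e. P e \<longleftrightarrow> sat E (=) (\<lambda>k. \<tau> k e) p))"

definition T :: "((nat \<Rightarrow> 'a) \<Rightarrow> 'a) \<Rightarrow> bool" where
  "T t \<longleftrightarrow> D (\<lambda>e. e 0 = t (\<lambda>n. e (Suc n)))"

text \<open>With the closure rules collected here, \<open>intro dfn\<close> proves definability by
  following the syntax of a predicate or term.\<close>

named_theorems dfn

lemma base_simps [simp, intro]: "base (\<lambda>e. e i)" "base (\<lambda>e. c)"
  by (auto simp: base_def)

lemma D_const [dfn]: "D (\<lambda>e. c)"
proof (cases c)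
  case True
  then show ?thesis
    unfolding D_def by (intro exI[of _ "Imp Fls Fls"] exI[of _ "\<lambda>k e. e k"]) simp
next
  case False
  then show ?thesis unfolding D_def by (intro exI[of _ Fls] exI[of _ "\<lambda>k e. e k"]) simp
qed

lemma D_imp [dfn]: "D P \<Longrightarrow> D Q \<Longrightarrow> D (\<lambda>e. P e \<longrightarrow> Q e)"
proof -
  assume "D P" "D Q"
  then obtain p q \<tau> \<sigma> where p: "\<And>k. base (\<tau> k)" "\<And>e. P e \<longleftrightarrow> sat E (=) (\<lambda>k. \<tau> k e) p"
    and q: "\<And>k. base (\<sigma> k)" "\<And>e. Q e \<longleftrightarrow> sat E (=) (\<lambda>k. \<sigma> k e) q" unfolding D_def by blast
  \<comment> \<open>The variables of \<open>p\<close> move to even places and those of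
    \<open>q\<close> to odd ones, so that one family of base terms serves both formulas.\<close>
  then show ?thesis unfolding D_def
    by (intro exI[of _ "Imp (rename (\<lambda>k. 2 * k) p) (rename (\<lambda>k. Suc (2 * k)) q)"]
        exI[of _ "\<lambda>k. if even k then \<tau> (k div 2) else \<sigma> (k div 2)"]) (simp add: sat_rename)
qed

lemma D_not [dfn]: "D P \<Longrightarrow> D (\<lambda>e. \<not> P e)"
  using D_imp[OF _ D_const[of False]] by simp

lemma D_and [dfn]: "D P \<Longrightarrow> D Q \<Longrightarrow> D (\<lambda>e. P e \<and> Q e)"
  using D_not[OF D_imp[OF _ D_not]] by simp

lemma D_or [dfn]: "D P \<Longrightarrow> D Q \<Longrightarrow> D (\<lambda>e. P e \<or> Q e)"
  using D_imp[OF D_not] by (simp add: disj_imp)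

lemma D_iff [dfn]: "D P \<Longrightarrow> D Q \<Longrightarrow> D (\<lambda>e. P e \<longleftrightarrow> Q e)"
  using D_and[OF D_imp[of P Q] D_imp[of Q P]] by (simp add: iff_conv_conj_imp)

lemma D_all [dfn]: "D (\<lambda>e. P (\<lambda>n. e (Suc n)) (e 0)) \<Longrightarrow> D (\<lambda>e. \<forall>x. P e x)"
proof -
  assume "D (\<lambda>e. P (\<lambda>n. e (Suc n)) (e 0))"
  then obtain p \<tau> where p: "\<And>k. base (\<tau> k)"
    "\<And>e. P (\<lambda>n. e (Suc n)) (e 0) \<longleftrightarrow> sat E (=) (\<lambda>k. \<tau> k e) p" unfolding D_def by blast
  \<comment> \<open>All occurrences of the quantified variable are collected at index 0;
    \<open>undefined\<close> merely fills places that are then no longer read.\<close>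
  define r where "r k = (if \<tau> k = (\<lambda>e. e 0) then 0 else Suc k)" for k
  define \<sigma> where "\<sigma> k e = \<tau> k (case_nat undefined e)" for k e
  have base: "base (\<sigma> k)" for k
  proof -
    consider "\<tau> k = (\<lambda>e. e 0)" | i where "\<tau> k = (\<lambda>e. e (Suc i))" | c where "\<tau> k = (\<lambda>e. c)"
      using p(1)[of k] unfolding base_def by (metis not0_implies_Suc)
    then show ?thesis by cases (simp_all add: \<sigma>_def[abs_def])
  qed
  have "case_nat x (\<lambda>k. \<sigma> k e) (r k) = \<tau> k (case_nat x e)" for x k e
    using p(1)[of k] unfolding base_def r_def \<sigma>_def by (auto split: nat.split)
  then have "P e x \<longleftrightarrow> sat E (=) (case_nat x (\<lambda>k. \<sigma> k e)) (rename r p)" for e x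
    unfolding sat_rename using p(2)[of "case_nat x e"] by simp
  then have "(\<forall>x. P e x) \<longleftrightarrow> sat E (=) (\<lambda>k. \<sigma> k e) (All (rename r p))" for e
    unfolding sat.simps by blast
  then show ?thesis unfolding D_def using base by blast
qed

lemma D_ex [dfn]: "D (\<lambda>e. P (\<lambda>n. e (Suc n)) (e 0)) \<Longrightarrow> D (\<lambda>e. \<exists>x. P e x)"
  using D_not[OF D_all[of "\<lambda>e x. \<not> P e x", OF D_not]] by simp

lemma D_reindex: "D P \<Longrightarrow> (\<And>k. base (\<sigma> k)) \<Longrightarrow> D (\<lambda>e. P (\<lambda>k. \<sigma> k e))"
proof -
  assume "D P" and s: "\<And>k. base (\<sigma> k)"
  then obtain p \<tau> where p: "\<And>k. base (\<tau> k)"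
    "\<And>e. P e \<longleftrightarrow> sat E (=) (\<lambda>k. \<tau> k e) p" unfolding D_def by blast
  have "base (\<lambda>e. \<tau> k (\<lambda>k. \<sigma> k e))" for k
  proof -
    consider i where "\<tau> k = (\<lambda>e. e i)" | c where "\<tau> k = (\<lambda>e. c)"
      using p(1)[of k] unfolding base_def by blast
    then show ?thesis by cases (simp_all add: s)
  qed
  then show ?thesis using p(2) unfolding D_def by (intro exI[of _ p] exI[of _ "\<lambda>k e. \<tau> k (\<lambda>k. \<sigma> k e)"]) simp
qed

lemma D_mem_base: "D (\<lambda>e. e i \<epsilon> e j)"
  unfolding D_def by (intro exI[of _ "Mem i j"] exI[of _ "\<lambda>k e. e k"]) simp

lemma D_eq_base: "D (\<lambda>e. e i = e j)"
  unfolding D_def by (intro exI[of _ "Eq i j"] exI[of _ "\<lambda>k e. e k"]) simp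

lemma T_var [dfn]: "T (\<lambda>e. e i)"
  unfolding T_def by (rule D_eq_base)

lemma T_const [dfn]: "T (\<lambda>e. c)"
  unfolding T_def using D_reindex[OF D_eq_base[of 0 1], of "\<lambda>k. if k = 0 then (\<lambda>e. e 0) else (\<lambda>e. c)"]
  by simp

lemma T_if [dfn]: "D P \<Longrightarrow> T s \<Longrightarrow> T t \<Longrightarrow> T (\<lambda>e. if P e then s e else t e)"
proof -
  assume *: "D P" "T s" "T t"
  have "D (\<lambda>e. P (\<lambda>n. e (Suc n)))" using D_reindex[OF *(1), of "\<lambda>k e. e (Suc k)"] by simp
  then have "D (\<lambda>e. (P (\<lambda>n. e (Suc n)) \<longrightarrow> e 0 = s (\<lambda>n. e (Suc n))) \<and>
      (\<not> P (\<lambda>n. e (Suc n)) \<longrightarrow> e 0 = t (\<lambda>n. e (Suc n))))"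
    using *(2,3) unfolding T_def by (intro D_and D_imp D_not)
  then show ?thesis unfolding T_def by (simp only: if_split[of "\<lambda>x. _ = x"])
qed

lemma T_weaken: "T t \<Longrightarrow> T (\<lambda>e. t (\<lambda>n. e (Suc n)))"
proof -
  assume "T t"
  from D_reindex[OF this[unfolded T_def], of "case_nat (\<lambda>e. e 0) (\<lambda>k e. e (Suc (Suc k)))"]
  show ?thesis unfolding T_def by (simp split: nat.split)
qed

text \<open>The language has no function symbols, so a term is substituted by quantifying over an
  element equal to its value.\<close>

lemma D_subst: "T t \<Longrightarrow> D (\<lambda>e. P (\<lambda>n. e (Suc n)) (e 0)) \<Longrightarrow> D (\<lambda>e. P e (t e))"
proof -
  assume "T t" "D (\<lambda>e. P (\<lambda>n. e (Suc n)) (e 0))"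
  then have "D (\<lambda>e. \<forall>x. x = t e \<longrightarrow> P e x)" by (intro D_all D_imp) (simp_all add: T_def)
  then show ?thesis by simp
qed

text \<open>This and the next rules pass from variables to definable terms. \<open>R\<close> itself
  does not depend on the assignment, which keeps the variables of the first premise separate from
  those of the terms.\<close>

lemma D1: "D (\<lambda>e. R (e 0)) \<Longrightarrow> T t \<Longrightarrow> D (\<lambda>e. R (t e))"
  by (rule D_subst[where P = "\<lambda>e. R"])

lemma D2: "D (\<lambda>e. R (e 0) (e (Suc 0))) \<Longrightarrow> T s \<Longrightarrow> T t \<Longrightarrow> D (\<lambda>e. R (s e) (t e))"
  by (rule D_subst[where P = "\<lambda>e. R (s e)"], assumption,
      rule D_subst[where P = "\<lambda>e x. R x (e 0)"], erule T_weaken)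

lemma D3:
  assumes "D (\<lambda>e. R (e 0) (e (Suc 0)) (e (Suc (Suc 0))))" "T s" "T t" "T u"
  shows "D (\<lambda>e. R (s e) (t e) (u e))"
  by (rule D_subst[where P = "\<lambda>e. R (s e) (t e)"], fact,
      rule D_subst[where P = "\<lambda>e x. R (s (\<lambda>n. e (Suc n))) x (e 0)"], rule T_weaken, fact,
      rule D_subst[where P = "\<lambda>e x. R x (e 0) (e (Suc 0))"], rule T_weaken, rule T_weaken, fact, fact)

lemma D4:
  assumes "D (\<lambda>e. R (e 0) (e (Suc 0)) (e (Suc (Suc 0))) (e (Suc (Suc (Suc 0)))))" "T s" "T t" "T u" "T v"
  shows "D (\<lambda>e. R (s e) (t e) (u e) (v e))"
  by (rule D_subst[where P = "\<lambda>e. R (s e) (t e) (u e)"], fact,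
      rule D_subst[where P = "\<lambda>e x. R (s (\<lambda>n. e (Suc n))) (t (\<lambda>n. e (Suc n))) x (e 0)"],
      rule T_weaken, fact,
      rule D_subst[where P = "\<lambda>e x. R (s (\<lambda>n. e (Suc (Suc n)))) x (e 0) (e (Suc 0))"],
      rule T_weaken, rule T_weaken, fact,
      rule D_subst[where P = "\<lambda>e x. R x (e 0) (e (Suc 0)) (e (Suc (Suc 0)))"],
      rule T_weaken, rule T_weaken, rule T_weaken, fact, fact)

lemma T1: "T (\<lambda>e. F (e 0)) \<Longrightarrow> T t \<Longrightarrow> T (\<lambda>e. F (t e))"
  unfolding T_def[of "\<lambda>e. F (t e)"]
  by (rule D2[where R = "\<lambda>x y. x = F y"]) (simp_all add: T_weaken T_var T_def[of "\<lambda>e. F (e 0)"])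

text \<open>Premises about operations speak of variable 0, but under further quantifiers the
  operation is applied to other variables.\<close>

lemma T_at: "T (\<lambda>e. F (e 0)) \<Longrightarrow> T (\<lambda>e. F (e i))"
  by (rule T1[where F = F]) (simp_all add: T_var)

lemma D_at: "D (\<lambda>e. P (e 0)) \<Longrightarrow> D (\<lambda>e. P (e i))"
  by (rule D1[where R = P]) (simp_all add: T_var)

lemma T2: "T (\<lambda>e. F (e 0) (e (Suc 0))) \<Longrightarrow> T s \<Longrightarrow> T t \<Longrightarrow> T (\<lambda>e. F (s e) (t e))"
  unfolding T_def[of "\<lambda>e. F (s e) (t e)"]
  by (rule D3[where R = "\<lambda>x y z. x = F y z"])
    (simp_all add: T_weaken T_var T_def[of "\<lambda>e. F (e 0) (e (Suc 0))"])

lemma T3: "T (\<lambda>e. F (e 0) (e (Suc 0)) (e (Suc (Suc 0)))) \<Longrightarrow> T s \<Longrightarrow> T t \<Longrightarrow> T u \<Longrightarrow>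
    T (\<lambda>e. F (s e) (t e) (u e))"
  unfolding T_def[of "\<lambda>e. F (s e) (t e) (u e)"]
  by (rule D4[where R = "\<lambda>x y z w. x = F y z w"])
    (simp_all add: T_weaken T_var T_def[of "\<lambda>e. F (e 0) (e (Suc 0)) (e (Suc (Suc 0)))"])

lemma D_mem [dfn]: "T s \<Longrightarrow> T t \<Longrightarrow> D (\<lambda>e. s e \<epsilon> t e)"
  by (rule D2[where R = E]) (rule D_mem_base)

lemma D_eq [dfn]: "T s \<Longrightarrow> T t \<Longrightarrow> D (\<lambda>e. s e = t e)"
  by (rule D2[where R = "(=)"]) (rule D_eq_base)

text \<open>All variables except 0 are frozen at \<open>c\<close> and become parameters, which
  separation and replacement admit.\<close>

lemma D_instance: "D (\<lambda>e. P (\<lambda>n. e (Suc n)) (e 0)) \<Longrightarrow> D (\<lambda>e. P c (e 0))"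
  using D_reindex[of "\<lambda>e. P (\<lambda>n. e (Suc n)) (e 0)" "case_nat (\<lambda>e. e 0) (\<lambda>k e. c k)"]
  by (simp split: nat.split)

lemma T_instance: "T (\<lambda>e. F (\<lambda>n. e (Suc n)) (e 0)) \<Longrightarrow> T (\<lambda>e. F c (e 0))"
proof -
  assume "T (\<lambda>e. F (\<lambda>n. e (Suc n)) (e 0))"
  from D_reindex[OF this[unfolded T_def],
      of "\<lambda>k. if k = 0 then (\<lambda>e. e 0) else if k = 1 then (\<lambda>e. e 1) else (\<lambda>e. c (k - 2))"]
  show ?thesis unfolding T_def by simp
qed

lemma D_binary:
  assumes "D (\<lambda>e. P (e 0) (e (Suc 0)))"
  obtains p prm where "\<And>x y. P x y \<longleftrightarrow> sat E (=) (case_nat x (case_nat y prm)) p"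
proof -
  from assms obtain p \<tau> where p: "\<And>k. base (\<tau> k)"
    "\<And>e. P (e 0) (e (Suc 0)) \<longleftrightarrow> sat E (=) (\<lambda>k. \<tau> k e) p" unfolding D_def by blast
  \<comment> \<open>Indices 0 and 1 are reserved for the two arguments; everything else in the
    defining formula is shifted behind them as a parameter.\<close>
  define r where "r k = (if \<tau> k = (\<lambda>e. e 0) then 0 else if \<tau> k = (\<lambda>e. e 1) then 1 else k + 2)" for k
  define \<sigma> where "\<sigma> k = \<tau> k (\<lambda>k. undefined)" for k
  have "case_nat x (case_nat y \<sigma>) (r k) = \<tau> k (case_nat x (case_nat y (\<lambda>k. undefined)))" for x y k
    using p(1)[of k] unfolding base_def r_def \<sigma>_def by (auto split: nat.split)
  then have "P x y \<longleftrightarrow> sat E (=) (case_nat x (case_nat y \<sigma>)) (rename r p)" for x y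
    unfolding sat_rename using p(2)[of "case_nat x (case_nat y (\<lambda>k. undefined))"] by simp
  then show ?thesis using that by blast
qed


section \<open>Elementary set theory in the model\<close>

lemma ax: "f 0 \<in> ZF \<Longrightarrow> sem E (=) (\<lambda>k. undefined) f 0 (\<lambda>k. undefined)"
  by (simp add: sem_def ZF)

lemma ext: "(\<And>z. z \<epsilon> x \<longleftrightarrow> z \<epsilon> y) \<Longrightarrow> x = y"
  using ax[of extensionality_ax] by (simp add: ZF_def extensionality_ax_def)

lemma foundation: "z \<epsilon> x \<Longrightarrow> \<exists>y. y \<epsilon> x \<and> (\<forall>z. z \<epsilon> x \<longrightarrow> \<not> z \<epsilon> y)"
  using ax[of foundation_ax] by (simp add: ZF_def foundation_ax_def nonempty_def) blast

lemma separation_ex: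
  assumes "D (\<lambda>e. P (e 0))"
  shows "\<exists>b. \<forall>x. x \<epsilon> b \<longleftrightarrow> x \<epsilon> a \<and> P x"
proof -
  \<comment> \<open>The second argument is a dummy; below it takes the value
    \<open>undefined\<close> and counts as one more parameter.\<close>
  obtain p prm where p: "\<And>x y. P x \<longleftrightarrow> sat E (=) (case_nat x (case_nat y prm)) p"
    using D_binary[of "\<lambda>x y. P x"] assms by metis
  obtain m where "(All ^^ m) (separation p 0) \<in> ZF" using ZF_schemes by blast
  then have "sem E (=) (case_nat undefined prm) (separation p) 0 (\<lambda>k. undefined)"
    using sat_closure[of E "(=)" m "separation p 0"] by (simp add: sem_def ZF)
  then show ?thesis using p by (simp add: separation_def)
qed

lemma replacement_ex:
  assumes "T (\<lambda>e. F (e 0))"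
  shows "\<exists>b. \<forall>y. y \<epsilon> b \<longleftrightarrow> (\<exists>x. x \<epsilon> a \<and> y = F x)"
proof -
  have "D (\<lambda>e. e (Suc 0) = F (e 0))" by (intro dfn assms)
  then obtain p prm where p: "\<And>x y. y = F x \<longleftrightarrow> sat E (=) (case_nat x (case_nat y prm)) p"
    using D_binary[of "\<lambda>x y. y = F x"] by metis
  obtain m where "(All ^^ m) (replacement p 0) \<in> ZF" using ZF_schemes by blast
  then have "sem E (=) prm (replacement p) 0 (\<lambda>k. undefined)"
    using sat_closure[of E "(=)" m "replacement p 0"] by (simp add: sem_def ZF)
  then show ?thesis by (simp add: replacement_def p[symmetric])
qed

definition mk :: "('a \<Rightarrow> bool) \<Rightarrow> 'a" where
  "mk P = (THE b. \<forall>z. z \<epsilon> b \<longleftrightarrow> P z)"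

lemma mk: "\<exists>b. \<forall>z. z \<epsilon> b \<longleftrightarrow> P z \<Longrightarrow> z \<epsilon> mk P \<longleftrightarrow> P z"
proof -
  assume "\<exists>b. \<forall>z. z \<epsilon> b \<longleftrightarrow> P z"
  then have "\<exists>!b. \<forall>z. z \<epsilon> b \<longleftrightarrow> P z" using ext by blast
  from theI'[OF this] show ?thesis unfolding mk_def by blast
qed

lemma mk_eq: "\<exists>b. \<forall>z. z \<epsilon> b \<longleftrightarrow> P z \<Longrightarrow> x = mk P \<longleftrightarrow> (\<forall>z. z \<epsilon> x \<longleftrightarrow> P z)"
  using mk[of P] ext by blast

text \<open>The set must exist for every assignment: only then is \<open>x = mk (P e)\<close>
  equivalent to a first-order condition on \<open>x\<close>.\<close>

lemma T_mk:
  assumes "\<And>e. \<exists>b. \<forall>z. z \<epsilon> b \<longleftrightarrow> P e z" and "D (\<lambda>e. P (\<lambda>n. e (Suc n)) (e 0))"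
  shows "T (\<lambda>e. mk (P e))"
proof -
  have "D (\<lambda>e. P (\<lambda>n. e (Suc (Suc n))) (e 0))"
    using D_reindex[OF assms(2), of "case_nat (\<lambda>e. e 0) (\<lambda>k e. e (Suc (Suc k)))"]
    by (simp split: nat.split)
  then show ?thesis unfolding T_def mk_eq[OF assms(1)] by (intro dfn)
qed

definition sep :: "'a \<Rightarrow> ('a \<Rightarrow> bool) \<Rightarrow> 'a" where
  "sep A P = mk (\<lambda>z. z \<epsilon> A \<and> P z)"

definition repl :: "'a \<Rightarrow> ('a \<Rightarrow> 'a) \<Rightarrow> 'a" where
  "repl A F = mk (\<lambda>y. \<exists>x. x \<epsilon> A \<and> y = F x)"

lemma sep: "D (\<lambda>e. P (e 0)) \<Longrightarrow> x \<epsilon> sep A P \<longleftrightarrow> x \<epsilon> A \<and> P x"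
  unfolding sep_def by (rule mk) (rule separation_ex)

lemma repl: "T (\<lambda>e. F (e 0)) \<Longrightarrow> y \<epsilon> repl A F \<longleftrightarrow> (\<exists>x. x \<epsilon> A \<and> y = F x)"
  unfolding repl_def by (rule mk) (rule replacement_ex)

lemma T_sep [dfn]: "T t \<Longrightarrow> D (\<lambda>e. P (\<lambda>n. e (Suc n)) (e 0)) \<Longrightarrow> T (\<lambda>e. sep (t e) (P e))"
  unfolding sep_def
  by (rule T_mk, rule separation_ex, erule D_instance) (intro dfn T_weaken)

lemma T_repl [dfn]: "T t \<Longrightarrow> T (\<lambda>e. F (\<lambda>n. e (Suc n)) (e 0)) \<Longrightarrow> T (\<lambda>e. repl (t e) (F e))"
  unfolding repl_def
proof (rule T_mk)
  fix e assume "T (\<lambda>e. F (\<lambda>n. e (Suc n)) (e 0))"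
  then show "\<exists>b. \<forall>z. z \<epsilon> b \<longleftrightarrow> (\<exists>x. x \<epsilon> t e \<and> z = F e x)"
    by (intro replacement_ex T_instance)
next
  assume t: "T t" and F: "T (\<lambda>e. F (\<lambda>n. e (Suc n)) (e 0))"
  have "T (\<lambda>e. F (\<lambda>n. e (Suc (Suc n))) (e 0))"
    using D_reindex[OF F[unfolded T_def], of "\<lambda>k. if k < 2 then (\<lambda>e. e k) else (\<lambda>e. e (Suc k))"]
    unfolding T_def by simp
  then show "D (\<lambda>e. \<exists>x. x \<epsilon> t (\<lambda>n. e (Suc n)) \<and> e 0 = F (\<lambda>n. e (Suc n)) x)"
    by (intro dfn T_weaken t)
qed

definition emp :: 'a where "emp = mk (\<lambda>z. False)"
definition upr :: "'a \<Rightarrow> 'a \<Rightarrow> 'a" where "upr x y = mk (\<lambda>z. z = x \<or> z = y)"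
definition uni :: "'a \<Rightarrow> 'a" where "uni F = mk (\<lambda>z. \<exists>A. A \<epsilon> F \<and> z \<epsilon> A)"
definition sub :: "'a \<Rightarrow> 'a \<Rightarrow> bool" where "sub x y \<longleftrightarrow> (\<forall>z. z \<epsilon> x \<longrightarrow> z \<epsilon> y)"
definition Pw :: "'a \<Rightarrow> 'a" where "Pw x = mk (\<lambda>z. sub z x)"

lemma in_emp [simp]: "\<not> z \<epsilon> emp"
proof -
  have "\<exists>e. \<forall>z. z \<epsilon> e \<longleftrightarrow> False"
    using ax[of infinity_ax] by (auto simp add: ZF_def infinity_ax_def is_inductive_def is_empty_def)
  then show ?thesis unfolding emp_def using mk[of "\<lambda>z. False"] by blast
qed

lemma upr_ex: "\<exists>p. \<forall>z. z \<epsilon> p \<longleftrightarrow> z = x \<or> z = y"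
  using ax[of pairing_ax] by (simp add: ZF_def pairing_ax_def is_upair_def)

lemma in_upr [simp]: "z \<epsilon> upr x y \<longleftrightarrow> z = x \<or> z = y"
  unfolding upr_def by (rule mk) (rule upr_ex)

lemma uni_ex: "\<exists>u. \<forall>z. z \<epsilon> u \<longleftrightarrow> (\<exists>A. A \<epsilon> F \<and> z \<epsilon> A)"
  using ax[of union_ax] by (simp add: ZF_def union_ax_def is_Union_def)

lemma in_uni [simp]: "z \<epsilon> uni F \<longleftrightarrow> (\<exists>A. A \<epsilon> F \<and> z \<epsilon> A)"
  unfolding uni_def by (rule mk) (rule uni_ex)

lemma Pw_ex: "\<exists>P. \<forall>z. z \<epsilon> P \<longleftrightarrow> sub z x"
  using ax[of power_set_ax] by (simp add: ZF_def power_set_ax_def fsubset_def sub_def)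

lemma in_Pw [simp]: "z \<epsilon> Pw x \<longleftrightarrow> sub z x"
  unfolding Pw_def by (rule mk) (rule Pw_ex)

lemma D_sub [dfn]: "T s \<Longrightarrow> T t \<Longrightarrow> D (\<lambda>e. sub (s e) (t e))"
  by (rule D2[of sub], unfold sub_def, intro dfn)

lemma T_upr [dfn]: "T s \<Longrightarrow> T t \<Longrightarrow> T (\<lambda>e. upr (s e) (t e))"
  by (rule T2[of upr], unfold upr_def, rule T_mk, rule upr_ex, intro dfn)

lemma T_uni [dfn]: "T t \<Longrightarrow> T (\<lambda>e. uni (t e))"
  by (rule T1[of uni], unfold uni_def, rule T_mk, rule uni_ex, intro dfn)

lemma T_Pw [dfn]: "T t \<Longrightarrow> T (\<lambda>e. Pw (t e))"
  by (rule T1[of Pw], unfold Pw_def, rule T_mk, rule Pw_ex, intro dfn)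

definition cup :: "'a \<Rightarrow> 'a \<Rightarrow> 'a" where "cup x y = uni (upr x y)"
definition diff :: "'a \<Rightarrow> 'a \<Rightarrow> 'a" where "diff x y = sep x (\<lambda>z. \<not> z \<epsilon> y)"
definition suc :: "'a \<Rightarrow> 'a" where "suc x = cup x (upr x x)"
definition pair :: "'a \<Rightarrow> 'a \<Rightarrow> 'a" where "pair x y = upr (upr x x) (upr x y)"
definition prd :: "'a \<Rightarrow> 'a \<Rightarrow> 'a" where
  "prd A B = sep (Pw (Pw (cup A B))) (\<lambda>p. \<exists>x y. x \<epsilon> A \<and> y \<epsilon> B \<and> p = pair x y)"

lemma T_cup [dfn]: "T s \<Longrightarrow> T t \<Longrightarrow> T (\<lambda>e. cup (s e) (t e))"
  unfolding cup_def by (intro dfn)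

lemma T_diff [dfn]: "T s \<Longrightarrow> T t \<Longrightarrow> T (\<lambda>e. diff (s e) (t e))"
  by (rule T2[of diff], unfold diff_def, intro dfn)

lemma T_suc [dfn]: "T t \<Longrightarrow> T (\<lambda>e. suc (t e))"
  unfolding suc_def by (intro dfn)

lemma T_pair [dfn]: "T s \<Longrightarrow> T t \<Longrightarrow> T (\<lambda>e. pair (s e) (t e))"
  unfolding pair_def by (intro dfn)

lemma T_prd [dfn]: "T s \<Longrightarrow> T t \<Longrightarrow> T (\<lambda>e. prd (s e) (t e))"
  by (rule T2[of prd], unfold prd_def, intro dfn)

lemma in_cup [simp]: "z \<epsilon> cup x y \<longleftrightarrow> z \<epsilon> x \<or> z \<epsilon> y"
  by (auto simp: cup_def)

lemma in_diff [simp]: "z \<epsilon> diff x y \<longleftrightarrow> z \<epsilon> x \<and> \<not> z \<epsilon> y"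
  unfolding diff_def by (rule sep) (intro dfn)

lemma in_suc [simp]: "z \<epsilon> suc x \<longleftrightarrow> z \<epsilon> x \<or> z = x"
  by (auto simp: suc_def)

lemma upr_eq: "upr x y = upr u v \<longleftrightarrow> (x = u \<and> y = v \<or> x = v \<and> y = u)"
proof
  assume *: "upr x y = upr u v"
  then have "x \<epsilon> upr u v" "y \<epsilon> upr u v" "u \<epsilon> upr x y" "v \<epsilon> upr x y"
    using in_upr[of x x y] in_upr[of y x y] in_upr[of u u v] in_upr[of v u v] by (simp_all only: *, simp_all)
  then show "x = u \<and> y = v \<or> x = v \<and> y = u" by auto
next
  assume "x = u \<and> y = v \<or> x = v \<and> y = u"
  then show "upr x y = upr u v" by (auto intro: ext)
qed

lemma pair_eq [simp]: "pair x y = pair u v \<longleftrightarrow> x = u \<and> y = v"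
  by (auto simp: pair_def upr_eq)

lemma in_prd: "p \<epsilon> prd A B \<longleftrightarrow> (\<exists>x y. x \<epsilon> A \<and> y \<epsilon> B \<and> p = pair x y)"
proof -
  have "p \<epsilon> prd A B \<longleftrightarrow> p \<epsilon> Pw (Pw (cup A B)) \<and> (\<exists>x y. x \<epsilon> A \<and> y \<epsilon> B \<and> p = pair x y)"
    unfolding prd_def by (rule sep) (intro dfn)
  then show ?thesis by (auto simp: pair_def sub_def)
qed

lemma pair_in_prd [simp]: "pair x y \<epsilon> prd A B \<longleftrightarrow> x \<epsilon> A \<and> y \<epsilon> B"
  by (auto simp: in_prd)

lemma not_mem_self: "\<not> x \<epsilon> x"
  using foundation[of x "upr x x"] by auto

lemma not_mem_cycle: "\<not> (x \<epsilon> y \<and> y \<epsilon> x)"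
  using foundation[of x "upr x y"] by auto

subsection \<open>The natural numbers of the model\<close>

definition ind :: "'a \<Rightarrow> bool" where
  "ind w \<longleftrightarrow> emp \<epsilon> w \<and> (\<forall>x. x \<epsilon> w \<longrightarrow> suc x \<epsilon> w)"

definition om :: 'a where "om = mk (\<lambda>z. \<forall>w. ind w \<longrightarrow> z \<epsilon> w)"

lemma D_ind [dfn]: "T t \<Longrightarrow> D (\<lambda>e. ind (t e))"
  by (rule D1[of ind], unfold ind_def, intro dfn)

lemma is_empty_iff: "(\<forall>z. \<not> z \<epsilon> x) \<longleftrightarrow> x = emp"
  using ext[of x emp] by auto

lemma is_suc_iff: "(\<forall>z. z \<epsilon> s \<longleftrightarrow> z \<epsilon> x \<or> z = x) \<longleftrightarrow> s = suc x"
  using ext[of s "suc x"] by auto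

lemma infinity: "\<exists>w. ind w"
  using ax[of infinity_ax]
  by (simp add: ZF_def infinity_ax_def is_inductive_def is_empty_def is_succ_def is_empty_iff is_suc_iff ind_def)

lemma in_om: "z \<epsilon> om \<longleftrightarrow> (\<forall>w. ind w \<longrightarrow> z \<epsilon> w)"
proof -
  obtain w where w: "ind w" using infinity by blast
  have "z \<epsilon> sep w (\<lambda>z. \<forall>w. ind w \<longrightarrow> z \<epsilon> w) \<longleftrightarrow> z \<epsilon> w \<and> (\<forall>w. ind w \<longrightarrow> z \<epsilon> w)" for z
    by (rule sep) (intro dfn)
  then have "\<exists>b. \<forall>z. z \<epsilon> b \<longleftrightarrow> (\<forall>w. ind w \<longrightarrow> z \<epsilon> w)" using w by blast
  then show ?thesis unfolding om_def by (rule mk)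
qed

lemma zero_om [simp]: "emp \<epsilon> om"
  by (simp add: in_om ind_def)

lemma suc_om [simp]: "n \<epsilon> om \<Longrightarrow> suc n \<epsilon> om"
  by (simp add: in_om ind_def)

text \<open>Members of \<open>om\<close> need not correspond to genuine natural numbers. Induction
  comes from separation and is therefore confined to definable predicates.\<close>

lemma om_induct [consumes 1, case_names definable zero suc]:
  assumes "n \<epsilon> om" "D (\<lambda>e. P (e 0))" "P emp" "\<And>n. n \<epsilon> om \<Longrightarrow> P n \<Longrightarrow> P (suc n)"
  shows "P n"
proof -
  have "ind (sep om P)" unfolding ind_def using assms by (simp add: sep)
  then have "n \<epsilon> sep om P" using assms(1) in_om by blast
  then show ?thesis using assms(2) by (simp add: sep)
qed

end

section \<open>Descriptions, functions and bijections in the model\<close>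

context zf
begin

text \<open>A definite description: the union of a singleton is its element. Searching inside a set
  \<open>B\<close> keeps the operation definable without any choice.\<close>

definition pick :: "'a \<Rightarrow> ('a \<Rightarrow> bool) \<Rightarrow> 'a" where
  "pick B P = uni (sep B P)"

lemma T_pick [dfn]: "T t \<Longrightarrow> D (\<lambda>e. P (\<lambda>n. e (Suc n)) (e 0)) \<Longrightarrow> T (\<lambda>e. pick (t e) (P e))"
  unfolding pick_def by (intro dfn)

lemma pick:
  assumes "D (\<lambda>e. P (e 0))" "y \<epsilon> B" "P y" "\<And>z. z \<epsilon> B \<Longrightarrow> P z \<Longrightarrow> z = y"
  shows "pick B P = y"
proof (rule ext)
  fix z
  show "z \<epsilon> pick B P \<longleftrightarrow> z \<epsilon> y"
    unfolding pick_def in_uni sep[of P, OF assms(1)] using assms(2-4) by blast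
qed

text \<open>The entries of a Kuratowski pair lie two levels below it, so \<open>uni (uni f)\<close>
  contains all values of \<open>f\<close>.\<close>

definition ap :: "'a \<Rightarrow> 'a \<Rightarrow> 'a" where
  "ap f x = pick (uni (uni f)) (\<lambda>y. pair x y \<epsilon> f)"

lemma T_ap [dfn]: "T s \<Longrightarrow> T t \<Longrightarrow> T (\<lambda>e. ap (s e) (t e))"
  by (rule T2[of ap], unfold ap_def, intro dfn)

lemma pair_field: "pair x y \<epsilon> f \<Longrightarrow> x \<epsilon> uni (uni f) \<and> y \<epsilon> uni (uni f)"
  unfolding in_uni by (metis in_upr pair_def)

lemma ap_eq: "pair x y \<epsilon> f \<Longrightarrow> (\<And>z. pair x z \<epsilon> f \<Longrightarrow> z = y) \<Longrightarrow> ap f x = y"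
  unfolding ap_def by (rule pick, intro dfn) (use pair_field[of x y f] in blast)+

definition fn :: "'a \<Rightarrow> 'a \<Rightarrow> 'a \<Rightarrow> bool" where
  "fn f A B \<longleftrightarrow> (\<forall>p. p \<epsilon> f \<longrightarrow> (\<exists>x y. x \<epsilon> A \<and> y \<epsilon> B \<and> p = pair x y)) \<and>
    (\<forall>x y z. pair x y \<epsilon> f \<and> pair x z \<epsilon> f \<longrightarrow> y = z) \<and> (\<forall>x. x \<epsilon> A \<longrightarrow> (\<exists>y. pair x y \<epsilon> f))"

lemma D_fn [dfn]: "T f \<Longrightarrow> T s \<Longrightarrow> T t \<Longrightarrow> D (\<lambda>e. fn (f e) (s e) (t e))"
  by (rule D3[of fn], unfold fn_def, intro dfn)

lemma fn_pair: "fn f A B \<Longrightarrow> pair x y \<epsilon> f \<longleftrightarrow> x \<epsilon> A \<and> y = ap f x"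
proof -
  assume f: "fn f A B"
  have 1: "ap f x = y \<and> x \<epsilon> A" if "pair x y \<epsilon> f" for x y
    using f that ap_eq[of x y f] unfolding fn_def by (metis pair_eq)
  show ?thesis using 1 f unfolding fn_def by metis
qed

lemma fn_ap: "fn f A B \<Longrightarrow> x \<epsilon> A \<Longrightarrow> ap f x \<epsilon> B"
proof -
  assume f: "fn f A B" and "x \<epsilon> A"
  then have "pair x (ap f x) \<epsilon> f" by (simp add: fn_pair)
  then obtain u v where "v \<epsilon> B" "pair x (ap f x) = pair u v" using f unfolding fn_def by blast
  then have "ap f x = v" unfolding pair_eq by blast
  then show ?thesis using \<open>v \<epsilon> B\<close> by simp
qed

definition lam :: "'a \<Rightarrow> ('a \<Rightarrow> 'a) \<Rightarrow> 'a" where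
  "lam A F = repl A (\<lambda>x. pair x (F x))"

lemma T_lam [dfn]: "T t \<Longrightarrow> T (\<lambda>e. F (\<lambda>n. e (Suc n)) (e 0)) \<Longrightarrow> T (\<lambda>e. lam (t e) (F e))"
  unfolding lam_def by (intro dfn)

lemma in_lam: "T (\<lambda>e. F (e 0)) \<Longrightarrow> p \<epsilon> lam A F \<longleftrightarrow> (\<exists>x. x \<epsilon> A \<and> p = pair x (F x))"
  unfolding lam_def by (rule repl) (intro dfn)

lemma fn_lam: "T (\<lambda>e. F (e 0)) \<Longrightarrow> (\<And>x. x \<epsilon> A \<Longrightarrow> F x \<epsilon> B) \<Longrightarrow> fn (lam A F) A B"
  unfolding fn_def by (auto simp: in_lam)

lemma ap_lam [simp]: "T (\<lambda>e. F (e 0)) \<Longrightarrow> x \<epsilon> A \<Longrightarrow> ap (lam A F) x = F x"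
  by (rule ap_eq) (auto simp: in_lam)

definition bij :: "'a \<Rightarrow> 'a \<Rightarrow> 'a \<Rightarrow> bool" where
  "bij f A B \<longleftrightarrow> fn f A B \<and> (\<forall>x y z. pair x z \<epsilon> f \<and> pair y z \<epsilon> f \<longrightarrow> x = y) \<and>
    (\<forall>y. y \<epsilon> B \<longrightarrow> (\<exists>x. pair x y \<epsilon> f))"

definition eqp :: "'a \<Rightarrow> 'a \<Rightarrow> bool" where
  "eqp A B \<longleftrightarrow> (\<exists>f. bij f A B)"

lemma D_bij [dfn]: "T f \<Longrightarrow> T s \<Longrightarrow> T t \<Longrightarrow> D (\<lambda>e. bij (f e) (s e) (t e))"
  by (rule D3[of bij], unfold bij_def, intro dfn)

lemma D_eqp [dfn]: "T s \<Longrightarrow> T t \<Longrightarrow> D (\<lambda>e. eqp (s e) (t e))"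
  by (rule D2[of eqp], unfold eqp_def, intro dfn)

lemma bij_iff: "bij f A B \<longleftrightarrow> fn f A B \<and> (\<forall>x y. x \<epsilon> A \<and> y \<epsilon> A \<and> ap f x = ap f y \<longrightarrow> x = y) \<and>
    (\<forall>y. y \<epsilon> B \<longrightarrow> (\<exists>x. x \<epsilon> A \<and> ap f x = y))"
proof (cases "fn f A B")
  case True
  show ?thesis unfolding bij_def fn_pair[OF True] using True by blast
next
  case False
  then show ?thesis by (simp add: bij_def)
qed

lemma eqpI:
  assumes "T (\<lambda>e. F (e 0))" "\<And>x. x \<epsilon> A \<Longrightarrow> F x \<epsilon> B"
    "\<And>x y. x \<epsilon> A \<Longrightarrow> y \<epsilon> A \<Longrightarrow> F x = F y \<Longrightarrow> x = y" "\<And>y. y \<epsilon> B \<Longrightarrow> \<exists>x. x \<epsilon> A \<and> F x = y"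
  shows "eqp A B"
proof -
  have "bij (lam A F) A B"
    unfolding bij_iff
  proof (intro conjI HOL.allI HOL.impI)
    show "fn (lam A F) A B" using assms(1,2) by (rule fn_lam)
    show "x = y" if "x \<epsilon> A \<and> y \<epsilon> A \<and> ap (lam A F) x = ap (lam A F) y" for x y
      using that assms(3)[of x y] by (metis ap_lam[OF assms(1)])
    show "\<exists>x. x \<epsilon> A \<and> ap (lam A F) x = y" if "y \<epsilon> B" for y
      using assms(4)[OF that] ap_lam[OF assms(1), of _ A] by auto
  qed
  then show ?thesis unfolding eqp_def by blast
qed

lemma om_cases: "n \<epsilon> om \<Longrightarrow> n = emp \<or> (\<exists>m. m \<epsilon> om \<and> n = suc m)"
  by (induction n rule: om_induct) (intro dfn, auto)

lemma om_trans: "n \<epsilon> om \<Longrightarrow> k \<epsilon> n \<Longrightarrow> k \<epsilon> om"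
proof -
  assume "n \<epsilon> om"
  then have "\<forall>k. k \<epsilon> n \<longrightarrow> k \<epsilon> om"
    by (induction n rule: om_induct) (intro dfn, auto)
  then show "k \<epsilon> n \<Longrightarrow> k \<epsilon> om" by blast
qed

lemma nat_trans: "n \<epsilon> om \<Longrightarrow> m \<epsilon> n \<Longrightarrow> k \<epsilon> m \<Longrightarrow> k \<epsilon> n"
proof -
  assume "n \<epsilon> om"
  then have "\<forall>m k. m \<epsilon> n \<longrightarrow> k \<epsilon> m \<longrightarrow> k \<epsilon> n"
    by (induction n rule: om_induct) (intro dfn, auto)
  then show "m \<epsilon> n \<Longrightarrow> k \<epsilon> m \<Longrightarrow> k \<epsilon> n" by blast
qed

lemma suc_inject [simp]: "suc m = suc n \<longleftrightarrow> m = n"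
  by (metis in_suc not_mem_cycle)

lemma suc_not_emp [simp]: "suc n \<noteq> emp" "emp \<noteq> suc n"
  by (metis in_emp in_suc)+

lemma emp_in_suc: "n \<epsilon> om \<Longrightarrow> emp \<epsilon> suc n"
  by (induction n rule: om_induct) (intro dfn, auto)

lemma suc_mono: "n \<epsilon> om \<Longrightarrow> m \<epsilon> n \<Longrightarrow> suc m \<epsilon> suc n"
proof -
  assume "n \<epsilon> om"
  then have "\<forall>m. m \<epsilon> n \<longrightarrow> suc m \<epsilon> suc n"
    by (induction n rule: om_induct) (intro dfn, auto)
  then show "m \<epsilon> n \<Longrightarrow> suc m \<epsilon> suc n" by blast
qed

lemma nat_linear: "m \<epsilon> om \<Longrightarrow> n \<epsilon> om \<Longrightarrow> m \<epsilon> n \<or> m = n \<or> n \<epsilon> m"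
proof -
  assume n: "n \<epsilon> om"
  assume "m \<epsilon> om"
  then show ?thesis
  proof (induction m rule: om_induct)
    case definable show ?case by (intro dfn)
  next
    case zero show ?case using om_cases[OF n] emp_in_suc by auto
  next
    case (suc m)
    have "suc m \<epsilon> n \<or> suc m = n" if "m \<epsilon> n"
      using om_cases[OF n] that suc_mono[of _ m] n by (metis in_emp in_suc om_trans)
    then show ?case using suc by auto
  qed
qed

text \<open>Membership is the strict order on \<open>om\<close>, so foundation provides a least
  element.\<close>

lemma nat_least:
  assumes "D (\<lambda>e. P (e 0))" "n \<epsilon> om" "P n"
  obtains m where "m \<epsilon> om" "P m" "\<And>k. k \<epsilon> m \<Longrightarrow> \<not> P k"
  using foundation[of n "sep om P"] assms om_trans by (auto simp: sep)

text \<open>The \<open>n\<close>-th iterate of the function \<open>g\<close> from \<open>a\<close>.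
  For \<open>g\<close> from a set to itself, every iterate lies in the domain of \<open>g\<close>
  and hence in \<open>uni (uni g)\<close>.\<close>

definition rc :: "'a \<Rightarrow> 'a \<Rightarrow> 'a \<Rightarrow> 'a" where
  "rc a g n = pick (uni (uni g)) (\<lambda>y. \<exists>f B. fn f om B \<and> ap f emp = a \<and>
    (\<forall>k. k \<epsilon> om \<longrightarrow> ap f (suc k) = ap g (ap f k)) \<and> ap f n = y)"

lemma T_rc [dfn]: "T s \<Longrightarrow> T t \<Longrightarrow> T u \<Longrightarrow> T (\<lambda>e. rc (s e) (t e) (u e))"
  by (rule T3[of rc], unfold rc_def, intro dfn)

lemma recursion_ex:
  assumes g: "fn g B B" and a: "a \<epsilon> B"
  obtains f where "fn f om B" "ap f emp = a" "\<And>n. n \<epsilon> om \<Longrightarrow> ap f (suc n) = ap g (ap f n)"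
proof -
  define closed where "closed r \<longleftrightarrow> pair emp a \<epsilon> r \<and>
    (\<forall>n x. pair n x \<epsilon> r \<longrightarrow> pair (suc n) (ap g x) \<epsilon> r)" for r
  define r where "r = sep (prd om B) (\<lambda>p. \<forall>s. closed s \<longrightarrow> p \<epsilon> s)"
  have in_r: "p \<epsilon> r \<longleftrightarrow> p \<epsilon> prd om B \<and> (\<forall>s. closed s \<longrightarrow> p \<epsilon> s)" for p
    unfolding r_def closed_def by (rule sep) (intro dfn)
  have cl: "closed r"
    using a fn_ap[OF g] unfolding closed_def[of r] by (auto simp: in_r) (simp_all add: closed_def)
  \<comment> \<open>As \<open>r\<close> is the least closed relation, a pair that is neither the
    initial one nor produced from another pair could be removed from it. This inversion yields
    single-valuedness.\<close>
  have drop: False if "q \<epsilon> r" "q \<noteq> pair emp a"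
    "\<And>n x. pair n x \<epsilon> r \<Longrightarrow> pair (suc n) (ap g x) \<noteq> q" for q
  proof -
    have s: "p \<epsilon> sep r (\<lambda>p. p \<noteq> q) \<longleftrightarrow> p \<epsilon> r \<and> p \<noteq> q" for p by (rule sep) (intro dfn)
    have "closed (sep r (\<lambda>p. p \<noteq> q))" using that cl unfolding closed_def s by blast
    then have "q \<epsilon> sep r (\<lambda>p. p \<noteq> q)" using that(1) in_r by blast
    then show False by (simp add: s)
  qed
  have uniq: "\<exists>y. pair n y \<epsilon> r \<and> (\<forall>z. pair n z \<epsilon> r \<longrightarrow> z = y)" if "n \<epsilon> om" for n
    using that
  proof (induction n rule: om_induct)
    case definable show ?case by (intro dfn)
  next
    case zero
    have "z = a" if "pair emp z \<epsilon> r" for z using drop[OF that] by auto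
    then show ?case using cl unfolding closed_def by blast
  next
    case (suc n)
    then obtain y where y: "pair n y \<epsilon> r" "\<And>z. pair n z \<epsilon> r \<Longrightarrow> z = y" by blast
    have "z = ap g y" if "pair (suc n) z \<epsilon> r" for z using drop[OF that] y(2) by auto
    then show ?case using y(1) cl unfolding closed_def by blast
  qed
  have f: "fn r om B"
    unfolding fn_def
  proof (intro conjI HOL.allI HOL.impI)
    fix p assume "p \<epsilon> r"
    then show "\<exists>x y. x \<epsilon> om \<and> y \<epsilon> B \<and> p = pair x y" by (simp add: in_r in_prd)
  next
    fix x y z assume *: "pair x y \<epsilon> r \<and> pair x z \<epsilon> r"
    then have "x \<epsilon> om" by (simp add: in_r)
    then show "y = z" using * uniq by blast
  next
    fix x assume "x \<epsilon> om"
    then show "\<exists>y. pair x y \<epsilon> r" using uniq by blast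
  qed
  show ?thesis
  proof (rule that[OF f])
    show "ap r emp = a" using cl fn_pair[OF f] unfolding closed_def by metis
    show "ap r (suc n) = ap g (ap r n)" if "n \<epsilon> om" for n
      using cl fn_pair[OF f] that unfolding closed_def by metis
  qed
qed

lemma rc_fn:
  assumes g: "fn g B B" and f: "fn f om B" "ap f emp = a" "\<And>n. n \<epsilon> om \<Longrightarrow> ap f (suc n) = ap g (ap f n)"
    and n: "n \<epsilon> om"
  shows "rc a g n = ap f n"
  unfolding rc_def
proof (rule pick)
  show "ap f n \<epsilon> uni (uni g)"
    using pair_field[of "ap f n" _ g] fn_pair[OF g] fn_ap[OF f(1) n] by blast
  fix y assume "\<exists>f B. fn f om B \<and> ap f emp = a \<and> (\<forall>k. k \<epsilon> om \<longrightarrow> ap f (suc k) = ap g (ap f k)) \<and> ap f n = y"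
  then obtain f' where f': "ap f' emp = a" "\<And>k. k \<epsilon> om \<Longrightarrow> ap f' (suc k) = ap g (ap f' k)" "ap f' n = y"
    by blast
  have "ap f' n = ap f n"
    using n by (induction n rule: om_induct) (intro dfn, auto simp: f f')
  then show "y = ap f n" using f' by simp
next
  show "\<exists>f' B. fn f' om B \<and> ap f' emp = a \<and>
      (\<forall>k. k \<epsilon> om \<longrightarrow> ap f' (suc k) = ap g (ap f' k)) \<and> ap f' n = ap f n"
    using f by blast
qed (intro dfn)

lemma
  assumes "fn g B B" "a \<epsilon> B"
  shows rc_zero: "rc a g emp = a"
    and rc_suc: "n \<epsilon> om \<Longrightarrow> rc a g (suc n) = ap g (rc a g n)"
    and rc_in: "n \<epsilon> om \<Longrightarrow> rc a g n \<epsilon> B"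
proof -
  obtain f where f: "fn f om B" "ap f emp = a" "\<And>n. n \<epsilon> om \<Longrightarrow> ap f (suc n) = ap g (ap f n)"
    using recursion_ex[OF assms] by blast
  have *: "rc a g n = ap f n" if "n \<epsilon> om" for n using assms(1) f that by (rule rc_fn)
  show "rc a g emp = a" using f * by simp
  show "rc a g (suc n) = ap g (rc a g n)" if "n \<epsilon> om" using f * that by simp
  show "rc a g n \<epsilon> B" if "n \<epsilon> om" using fn_ap[OF f(1) that] * that by simp
qed


subsection \<open>Finite sets\<close>

definition fin :: "'a \<Rightarrow> bool" where
  "fin A \<longleftrightarrow> (\<exists>n. n \<epsilon> om \<and> eqp A n)"

lemma D_fin [dfn]: "T t \<Longrightarrow> D (\<lambda>e. fin (t e))"
  by (rule D1[of fin], unfold fin_def, intro dfn)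

lemma eqp_refl: "eqp A A"
  by (rule eqpI[of "\<lambda>x. x"]) (auto intro: dfn)

lemma fin_nat: "n \<epsilon> om \<Longrightarrow> fin n"
  unfolding fin_def using eqp_refl by blast

lemma fin_emp [simp]: "fin emp"
  by (simp add: fin_nat)

lemma fin_insert: "fin A \<Longrightarrow> fin (cup A (upr x x))"
proof (cases "x \<epsilon> A")
  case True
  then have "cup A (upr x x) = A" by (auto intro: ext)
  then show "fin A \<Longrightarrow> ?thesis" by simp
next
  case False
  assume "fin A"
  then obtain n f where n: "n \<epsilon> om" and f: "bij f A n" unfolding fin_def eqp_def by blast
  have *: "y \<noteq> x" if "y \<epsilon> A" for y using that False by blast
  have "eqp (cup A (upr x x)) (suc n)"
  proof (rule eqpI[of "\<lambda>y. if y = x then n else ap f y"])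
    show "T (\<lambda>e. if e 0 = x then n else ap f (e 0))" by (intro dfn)
    show "(if y = x then n else ap f y) \<epsilon> suc n" if "y \<epsilon> cup A (upr x x)" for y
      using that fn_ap[of f A n y] f unfolding bij_iff by auto
    show "y = z" if "y \<epsilon> cup A (upr x x)" "z \<epsilon> cup A (upr x x)"
      "(if y = x then n else ap f y) = (if z = x then n else ap f z)" for y z
    proof -
      have ne: "ap f u \<noteq> n" if "u \<epsilon> A" for u
        using f fn_ap[of f A n u] that not_mem_self[of n] unfolding bij_iff by auto
      have inj: "y \<epsilon> A \<Longrightarrow> z \<epsilon> A \<Longrightarrow> ap f y = ap f z \<Longrightarrow> y = z"
        using f unfolding bij_iff by blast
      show ?thesis using that ne[of y] ne[of z] inj by (cases "y = x"; cases "z = x") auto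
    qed
    show "\<exists>y. y \<epsilon> cup A (upr x x) \<and> (if y = x then n else ap f y) = z" if "z \<epsilon> suc n" for z
    proof (cases "z = n")
      case True
      then show ?thesis by (intro exI[of _ x]) simp
    next
      case False
      then have "z \<epsilon> n" using that by simp
      then obtain y where "y \<epsilon> A" "ap f y = z" using f unfolding bij_iff by blast
      then show ?thesis using * by (intro exI[of _ y]) simp
    qed
  qed
  then show ?thesis unfolding fin_def using suc_om[OF n] by blast
qed

lemma fin_induct [consumes 1, case_names definable empty insert]:
  assumes "fin A" "D (\<lambda>e. P (e 0))" "P emp"
    "\<And>A x. fin A \<Longrightarrow> \<not> x \<epsilon> A \<Longrightarrow> P A \<Longrightarrow> P (cup A (upr x x))"
  shows "P A"
proof -
  obtain n where n: "n \<epsilon> om" "eqp A n" using assms(1) unfolding fin_def by blast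
  from n(1) have "\<forall>A. eqp A n \<longrightarrow> P A"
  proof (induction n rule: om_induct)
    case definable
    have "D (\<lambda>e. P (e i))" for i by (rule D_at[where P = P]) fact
    then show ?case by (intro dfn)
  next
    case zero
    have "A = emp" if "eqp A emp" for A
    proof (rule ext)
      obtain f where "fn f A emp" using \<open>eqp A emp\<close> unfolding eqp_def bij_iff by blast
      then show "x \<epsilon> A \<longleftrightarrow> x \<epsilon> emp" for x using fn_ap[of f A emp x] by auto
    qed
    show ?case
    proof (intro HOL.allI HOL.impI)
      fix A assume "eqp A emp"
      then have "A = emp" by fact
      then show "P A" using assms(3) by simp
    qed
  next
    case (suc n)
    show ?case
    proof (intro HOL.allI HOL.impI)
      fix A assume "eqp A (suc n)"
      then obtain f where f: "bij f A (suc n)" unfolding eqp_def by blast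
      then obtain x where x: "x \<epsilon> A" "ap f x = n" unfolding bij_iff by auto
      let ?B = "diff A (upr x x)"
      have "eqp ?B n"
      proof (rule eqpI[of "ap f"])
        show "T (\<lambda>e. ap f (e 0))" by (intro dfn)
        show "ap f y \<epsilon> n" if "y \<epsilon> ?B" for y
          using that f x fn_ap[of f A "suc n" y] unfolding bij_iff by auto
        show "y = z" if "y \<epsilon> ?B" "z \<epsilon> ?B" "ap f y = ap f z" for y z
          using that f unfolding bij_iff by auto
        show "\<exists>y. y \<epsilon> ?B \<and> ap f y = z" if "z \<epsilon> n" for z
        proof -
          have "z \<epsilon> suc n" using that by simp
          then obtain y where y: "y \<epsilon> A" "ap f y = z" using f unfolding bij_iff by blast
          then have "y \<noteq> x" using x that not_mem_self by blast
          then show ?thesis using y by auto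
        qed
      qed
      then have "fin ?B" "P ?B" using suc unfolding fin_def by blast+
      then have "P (cup ?B (upr x x))" using assms(4)[of ?B x] by simp
      moreover have "cup ?B (upr x x) = A" by (rule ext) (use x in auto)
      ultimately show "P A" by simp
    qed
  qed
  then show ?thesis using n(2) by blast
qed

lemma fin_subset: "fin A \<Longrightarrow> sub B A \<Longrightarrow> fin B"
proof -
  assume "fin A"
  then have "\<forall>B. sub B A \<longrightarrow> fin B"
  proof (induction A rule: fin_induct)
    case definable show ?case by (intro dfn)
  next
    case empty
    have "B = emp" if "sub B emp" for B using that by (auto simp: sub_def intro: ext)
    show ?case
    proof (intro HOL.allI HOL.impI)
      fix B assume "sub B emp"
      then have "B = emp" by fact
      then show "fin B" by simp
    qed
  next
    case (insert A x)
    show ?case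
    proof (intro HOL.allI HOL.impI)
      fix B assume B: "sub B (cup A (upr x x))"
      then have "sub (diff B (upr x x)) A" by (auto simp: sub_def)
      then have "fin (diff B (upr x x))" using insert.IH by blast
      then have 1: "fin (cup (diff B (upr x x)) (upr x x))" by (rule fin_insert)
      show "fin B"
      proof (cases "x \<epsilon> B")
        case True
        then have "cup (diff B (upr x x)) (upr x x) = B" by (auto intro: ext)
        then show ?thesis using 1 by simp
      next
        case False
        then have "sub B A" using B by (auto simp: sub_def)
        then show ?thesis using insert by blast
      qed
    qed
  qed
  then show "sub B A \<Longrightarrow> fin B" by blast
qed

lemma fin_cup: "fin A \<Longrightarrow> fin B \<Longrightarrow> fin (cup A B)"
proof (induction A rule: fin_induct)
  case definable then show ?case by (intro dfn)
next
  case empty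
  have "cup emp B = B" by (auto intro: ext)
  then show ?case using empty by simp
next
  case (insert A x)
  have "cup (cup A (upr x x)) B = cup (cup A B) (upr x x)" by (auto intro: ext)
  then show ?case using insert fin_insert by simp
qed

lemma fin_repl:
  assumes "fin A" and F: "T (\<lambda>e. F (e 0))"
  shows "fin (repl A F)"
  using assms(1)
proof (induction A rule: fin_induct)
  case definable
  have "T (\<lambda>e. F (e i))" for i by (rule T_at[where F = F]) fact
  then show ?case by (intro dfn)
next
  case empty
  have "repl emp F = emp" by (rule ext) (simp add: repl[OF F])
  then show ?case by simp
next
  case (insert A x)
  have "repl (cup A (upr x x)) F = cup (repl A F) (upr (F x) (F x))"
    by (rule ext) (auto simp: repl[OF F])
  then show ?case using insert fin_insert by simp
qed

text \<open>A finite set of numbers is contained in a number; if \<open>om\<close> were, that number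
  would be a member of itself.\<close>

lemma not_fin_om: "\<not> fin om"
proof
  assume fin: "fin om"
  have "\<exists>n. n \<epsilon> om \<and> sub A n" if "fin A" "sub A om" for A
    using that
  proof (induction A rule: fin_induct)
    case definable show ?case by (intro dfn)
  next
    case empty show ?case by (auto simp: sub_def intro: zero_om)
  next
    case (insert A x)
    then obtain n where n: "n \<epsilon> om" "sub A n" "x \<epsilon> om" by (auto simp: sub_def)
    show ?case
    proof (cases "x \<epsilon> n")
      case True
      then show ?thesis using n by (auto simp: sub_def)
    next
      case False
      then have "n = x \<or> n \<epsilon> x" using nat_linear n by blast
      then have "sub (cup A (upr x x)) (suc x)" using n nat_trans[OF n(3)] by (auto simp: sub_def)
      then show ?thesis using n by (intro exI[of _ "suc x"]) simp
    qed
  qed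
  from this[OF fin] show False by (auto simp: sub_def not_mem_self)
qed


subsection \<open>Countable sets\<close>

definition ctb :: "'a \<Rightarrow> bool" where
  "ctb A \<longleftrightarrow> (\<exists>s. sub s om \<and> eqp A s)"

lemma D_ctb [dfn]: "T t \<Longrightarrow> D (\<lambda>e. ctb (t e))"
  by (rule D1[of ctb], unfold ctb_def, intro dfn)

lemma ctbE:
  assumes "ctb A"
  obtains g where "\<And>x. x \<epsilon> A \<Longrightarrow> ap g x \<epsilon> om" "\<And>x y. x \<epsilon> A \<Longrightarrow> y \<epsilon> A \<Longrightarrow> ap g x = ap g y \<Longrightarrow> x = y"
proof -
  obtain s g where "sub s om" "bij g A s" using assms unfolding ctb_def eqp_def by blast
  then show ?thesis using that[of g] fn_ap unfolding bij_iff sub_def by blast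
qed

lemma ctb_injI:
  assumes "T (\<lambda>e. F (e 0))" "\<And>x. x \<epsilon> A \<Longrightarrow> F x \<epsilon> om" "\<And>x y. x \<epsilon> A \<Longrightarrow> y \<epsilon> A \<Longrightarrow> F x = F y \<Longrightarrow> x = y"
  shows "ctb A"
proof -
  have "eqp A (repl A F)"
    by (rule eqpI[of F]) (use assms in \<open>auto simp: repl\<close>)
  moreover have "sub (repl A F) om" using assms by (auto simp: sub_def repl)
  ultimately show ?thesis unfolding ctb_def by blast
qed

text \<open>Each \<open>n\<close> is related to at most one member of \<open>A\<close>, so sending a
  member to the least number related to it is injective, and no choice is made.\<close>

lemma ctbI:
  assumes R: "D (\<lambda>e. R (e 0) (e (Suc 0)))" and ex: "\<And>x. x \<epsilon> A \<Longrightarrow> \<exists>n. n \<epsilon> om \<and> R n x"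
    and inj: "\<And>n x y. n \<epsilon> om \<Longrightarrow> x \<epsilon> A \<Longrightarrow> y \<epsilon> A \<Longrightarrow> R n x \<Longrightarrow> R n y \<Longrightarrow> x = y"
  shows "ctb A"
proof -
  have D_R: "D (\<lambda>e. R (s e) (t e))" if "T s" "T t" for s t using D2[OF R that] .
  define F where "F x = pick om (\<lambda>n. R n x \<and> (\<forall>k. k \<epsilon> n \<longrightarrow> \<not> R k x))" for x
  have F: "F x \<epsilon> om \<and> R (F x) x" if x: "x \<epsilon> A" for x
  proof -
    obtain n where "n \<epsilon> om" "R n x" using ex[OF x] by blast
    moreover have "D (\<lambda>e. R (e 0) x)" by (intro dfn D_R)
    ultimately obtain m where m: "m \<epsilon> om" "R m x" "\<And>k. k \<epsilon> m \<Longrightarrow> \<not> R k x"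
      using nat_least[of "\<lambda>n. R n x"] by blast
    have "F x = m"
      unfolding F_def by (rule pick, intro dfn D_R) (use m nat_linear in blast)+
    then show ?thesis using m by simp
  qed
  show ?thesis
  proof (rule ctb_injI[of F])
    show "T (\<lambda>e. F (e 0))" unfolding F_def by (intro dfn D_R)
    show "F x \<epsilon> om" if "x \<epsilon> A" for x using F that by blast
    show "x = y" if "x \<epsilon> A" "y \<epsilon> A" "F x = F y" for x y
      using F[OF that(1)] F[OF that(2)] inj that by metis
  qed
qed

lemma ctb_subset: "ctb A \<Longrightarrow> sub B A \<Longrightarrow> ctb B"
proof -
  assume A: "ctb A" and B: "sub B A"
  obtain g where "\<And>x. x \<epsilon> A \<Longrightarrow> ap g x \<epsilon> om" "\<And>x y. x \<epsilon> A \<Longrightarrow> y \<epsilon> A \<Longrightarrow> ap g x = ap g y \<Longrightarrow> x = y"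
    by (rule ctbE[OF A], rule that, assumption+)
  then show ?thesis using B by (intro ctb_injI[of "ap g"]) (auto simp: sub_def intro: dfn)
qed

lemma ctb_om: "ctb om"
  by (rule ctb_injI[of "\<lambda>x. x"]) (auto intro: dfn)

lemma ctb_fin: "fin A \<Longrightarrow> ctb A"
  unfolding fin_def ctb_def using om_trans by (auto simp: sub_def)

lemma ctb_repl:
  assumes "ctb A" and F: "T (\<lambda>e. F (e 0))"
  shows "ctb (repl A F)"
proof -
  obtain g where g: "\<And>x. x \<epsilon> A \<Longrightarrow> ap g x \<epsilon> om" "\<And>x y. x \<epsilon> A \<Longrightarrow> y \<epsilon> A \<Longrightarrow> ap g x = ap g y \<Longrightarrow> x = y"
    by (rule ctbE[OF assms(1)], rule that, assumption+)
  have "T (\<lambda>e. F (e i))" for i by (rule T_at[where F = F]) fact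
  then have "D (\<lambda>e. \<exists>x. x \<epsilon> A \<and> ap g x = e 0 \<and> e (Suc 0) = F x)" by (intro dfn)
  then show ?thesis
    by (rule ctbI[where R = "\<lambda>n y. \<exists>x. x \<epsilon> A \<and> ap g x = n \<and> y = F x"])
      (use g(1) in \<open>auto simp: repl[OF F] dest: g(2)[rotated 2]\<close>)
qed

definition add :: "'a \<Rightarrow> 'a \<Rightarrow> 'a" where
  "add m n = rc m (lam om suc) n"

lemma T_add [dfn]: "T s \<Longrightarrow> T t \<Longrightarrow> T (\<lambda>e. add (s e) (t e))"
  unfolding add_def by (intro dfn)

lemma fn_suc: "fn (lam om suc) om om"
  by (rule fn_lam) (auto intro: dfn)

lemma add_in [simp]: "m \<epsilon> om \<Longrightarrow> n \<epsilon> om \<Longrightarrow> add m n \<epsilon> om"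
  unfolding add_def by (rule rc_in[OF fn_suc])

lemma add_zero [simp]: "m \<epsilon> om \<Longrightarrow> add m emp = m"
  unfolding add_def by (rule rc_zero[OF fn_suc])

lemma add_suc [simp]: "m \<epsilon> om \<Longrightarrow> n \<epsilon> om \<Longrightarrow> add m (suc n) = suc (add m n)"
  using add_in[of m n] unfolding add_def by (simp add: rc_suc[OF fn_suc] T_suc T_var)

lemma suc_add [simp]: "n \<epsilon> om \<Longrightarrow> m \<epsilon> om \<Longrightarrow> add (suc m) n = suc (add m n)"
  by (induction n rule: om_induct) (intro dfn, auto)

lemma zero_add [simp]: "n \<epsilon> om \<Longrightarrow> add emp n = n"
  by (induction n rule: om_induct) (intro dfn, auto)

text \<open>The walk along the antidiagonals visits every pair.\<close>

lemma ctb_square: "ctb (prd om om)"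
proof -
  define nxt where "nxt p = pick (prd om om) (\<lambda>q. (\<exists>x. p = pair x emp \<and> q = pair emp (suc x)) \<or>
     (\<exists>x y. p = pair x (suc y) \<and> q = pair (suc x) y))" for p
  have T_nxt: "T (\<lambda>e. nxt (e 0))" unfolding nxt_def by (intro dfn)
  have nxt0: "nxt (pair x emp) = pair emp (suc x)" if "x \<epsilon> om" for x
    unfolding nxt_def by (rule pick, intro dfn) (use that in auto)
  have nxt1: "nxt (pair x (suc y)) = pair (suc x) y" if "x \<epsilon> om" "y \<epsilon> om" for x y
    unfolding nxt_def by (rule pick, intro dfn) (use that in auto)
  have nxt_in: "nxt p \<epsilon> prd om om" if "p \<epsilon> prd om om" for p
    using that om_cases nxt0 nxt1 by (auto simp: in_prd) (metis pair_eq suc_om zero_om)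
  let ?g = "lam (prd om om) nxt"
  have g: "fn ?g (prd om om) (prd om om)" by (rule fn_lam[OF T_nxt nxt_in])
  have z: "pair emp emp \<epsilon> prd om om" by simp
  define w where "w n = rc (pair emp emp) ?g n" for n
  have T_w: "T (\<lambda>e. w (e i))" for i
  proof -
    have "T (\<lambda>e. rc (pair emp emp) g (e i))" for g by (intro dfn)
    then show ?thesis unfolding w_def .
  qed
  have w0: "w emp = pair emp emp" unfolding w_def by (rule rc_zero[OF g z])
  have w_in: "w n \<epsilon> prd om om" if "n \<epsilon> om" for n unfolding w_def by (rule rc_in[OF g z that])
  have w_suc: "w (suc n) = nxt (w n)" if "n \<epsilon> om" for n
    using w_in[OF that] unfolding w_def rc_suc[OF g z that] by (simp add: T_nxt)
  have next_hit: "\<exists>n. n \<epsilon> om \<and> w n = nxt p" if "\<exists>n. n \<epsilon> om \<and> w n = p" for p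
    using that w_suc suc_om by blast
  \<comment> \<open>Once the start \<open>(0, i + j)\<close> of an antidiagonal has been visited,
    \<open>i\<close> more steps lead to \<open>(i, j)\<close>.\<close>
  have diag: "\<forall>j. j \<epsilon> om \<longrightarrow> (\<exists>n. n \<epsilon> om \<and> w n = pair emp (add i j)) \<longrightarrow> (\<exists>n. n \<epsilon> om \<and> w n = pair i j)"
    if "i \<epsilon> om" for i
    using that
  proof (induction i rule: om_induct)
    case definable show ?case by (intro dfn T_w)
  next
    case zero show ?case by simp
  next
    case (suc i)
    show ?case
    proof (intro HOL.allI HOL.impI)
      fix j assume j: "j \<epsilon> om" and "\<exists>n. n \<epsilon> om \<and> w n = pair emp (add (suc i) j)"
      then have "\<exists>n. n \<epsilon> om \<and> w n = pair i (suc j)" using suc j by auto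
      then show "\<exists>n. n \<epsilon> om \<and> w n = pair (suc i) j" using next_hit nxt1 suc j by metis
    qed
  qed
  have "\<exists>n. n \<epsilon> om \<and> w n = pair emp k" if "k \<epsilon> om" for k
    using that
  proof (induction k rule: om_induct)
    case definable show ?case by (intro dfn T_w)
  next
    case zero show ?case using w0 zero_om by blast
  next
    case (suc k)
    then have "\<exists>n. n \<epsilon> om \<and> w n = pair k emp" using diag[of k] by auto
    then show ?case using next_hit nxt0 suc by metis
  qed
  then have "\<exists>n. n \<epsilon> om \<and> w n = p" if "p \<epsilon> prd om om" for p
    using that diag by (auto simp: in_prd)
  then have "sub (prd om om) (repl om w)" by (auto simp: sub_def repl[OF T_w] eq_commute)
  then show ?thesis using ctb_subset ctb_repl[OF ctb_om T_w] by blast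
qed

lemma ctb_pairI:
  assumes R: "D (\<lambda>e. R (e 0) (e (Suc 0)) (e (Suc (Suc 0))))"
    and ex: "\<And>x. x \<epsilon> A \<Longrightarrow> \<exists>m n. m \<epsilon> om \<and> n \<epsilon> om \<and> R m n x"
    and inj: "\<And>m n x y. m \<epsilon> om \<Longrightarrow> n \<epsilon> om \<Longrightarrow> x \<epsilon> A \<Longrightarrow> y \<epsilon> A \<Longrightarrow> R m n x \<Longrightarrow> R m n y \<Longrightarrow> x = y"
  shows "ctb A"
proof -
  obtain g where g: "\<And>x. x \<epsilon> prd om om \<Longrightarrow> ap g x \<epsilon> om"
    "\<And>x y. x \<epsilon> prd om om \<Longrightarrow> y \<epsilon> prd om om \<Longrightarrow> ap g x = ap g y \<Longrightarrow> x = y"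
    by (rule ctbE[OF ctb_square], rule that, assumption+)
  have D_R: "D (\<lambda>e. R (s e) (t e) (u e))" if "T s" "T t" "T u" for s t u using D3[OF R that] .
  show ?thesis
  proof (rule ctbI[where R = "\<lambda>k x. \<exists>m n. m \<epsilon> om \<and> n \<epsilon> om \<and> k = ap g (pair m n) \<and> R m n x"])
    show "D (\<lambda>e. \<exists>m n. m \<epsilon> om \<and> n \<epsilon> om \<and> e 0 = ap g (pair m n) \<and> R m n (e (Suc 0)))"
      by (intro dfn D_R)
    show "\<exists>k. k \<epsilon> om \<and> (\<exists>m n. m \<epsilon> om \<and> n \<epsilon> om \<and> k = ap g (pair m n) \<and> R m n x)" if "x \<epsilon> A" for x
      using ex[OF that] g(1) by (metis pair_in_prd)
    show "x = y" if "k \<epsilon> om" "x \<epsilon> A" "y \<epsilon> A" "\<exists>m n. m \<epsilon> om \<and> n \<epsilon> om \<and> k = ap g (pair m n) \<and> R m n x"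
      "\<exists>m n. m \<epsilon> om \<and> n \<epsilon> om \<and> k = ap g (pair m n) \<and> R m n y" for k x y
      using that g(2) inj by (metis pair_eq pair_in_prd)
  qed
qed

lemma ctb_cup: "ctb A \<Longrightarrow> ctb B \<Longrightarrow> ctb (cup A B)"
proof -
  assume "ctb A" "ctb B"
  obtain g where g: "\<And>x. x \<epsilon> A \<Longrightarrow> ap g x \<epsilon> om" "\<And>x y. x \<epsilon> A \<Longrightarrow> y \<epsilon> A \<Longrightarrow> ap g x = ap g y \<Longrightarrow> x = y"
    by (rule ctbE[OF \<open>ctb A\<close>], rule that, assumption+)
  obtain h where h: "\<And>x. x \<epsilon> B \<Longrightarrow> ap h x \<epsilon> om" "\<And>x y. x \<epsilon> B \<Longrightarrow> y \<epsilon> B \<Longrightarrow> ap h x = ap h y \<Longrightarrow> x = y"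
    by (rule ctbE[OF \<open>ctb B\<close>], rule that, assumption+)
  show ?thesis
  proof (rule ctb_pairI[where R = "\<lambda>m n x. m = emp \<and> x \<epsilon> A \<and> n = ap g x \<or> m = suc emp \<and> x \<epsilon> B \<and> n = ap h x"])
    show "D (\<lambda>e. e 0 = emp \<and> e (Suc (Suc 0)) \<epsilon> A \<and> e (Suc 0) = ap g (e (Suc (Suc 0))) \<or>
        e 0 = suc emp \<and> e (Suc (Suc 0)) \<epsilon> B \<and> e (Suc 0) = ap h (e (Suc (Suc 0))))" by (intro dfn)
    show "\<exists>m n. m \<epsilon> om \<and> n \<epsilon> om \<and> (m = emp \<and> x \<epsilon> A \<and> n = ap g x \<or> m = suc emp \<and> x \<epsilon> B \<and> n = ap h x)"
      if "x \<epsilon> cup A B" for x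
      using that g(1)[of x] h(1)[of x] zero_om suc_om[OF zero_om] unfolding in_cup by blast
  qed (use g h in \<open>auto\<close>)
qed

lemma ctb_enum:
  assumes "ctb A" "a \<epsilon> A"
  obtains s where "fn s om A" "\<And>x. x \<epsilon> A \<Longrightarrow> \<exists>n. n \<epsilon> om \<and> ap s n = x"
proof -
  obtain g where g: "\<And>x. x \<epsilon> A \<Longrightarrow> ap g x \<epsilon> om" "\<And>x y. x \<epsilon> A \<Longrightarrow> y \<epsilon> A \<Longrightarrow> ap g x = ap g y \<Longrightarrow> x = y"
    by (rule ctbE[OF assms(1)], rule that, assumption+)
  \<comment> \<open>Numbers that index no member get the default value \<open>a\<close>, so finite
    sets are enumerated as well, with repetitions.\<close>
  define F where "F n = (if \<exists>x. x \<epsilon> A \<and> ap g x = n then pick A (\<lambda>x. ap g x = n) else a)" for n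
  have T_F: "T (\<lambda>e. F (e 0))" unfolding F_def by (intro dfn)
  have F: "F (ap g x) = x" if "x \<epsilon> A" for x
  proof -
    have "pick A (\<lambda>y. ap g y = ap g x) = x" by (rule pick, intro dfn) (use that g(2) in auto)
    then show ?thesis unfolding F_def using that by auto
  qed
  have "F n \<epsilon> A" for n
  proof (cases "\<exists>x. x \<epsilon> A \<and> ap g x = n")
    case True
    then show ?thesis using F by auto
  next
    case False
    then have "F n = a" unfolding F_def by (rule if_not_P)
    then show ?thesis using assms(2) by simp
  qed
  then show ?thesis using that[of "lam om F"] fn_lam[OF T_F] F g(1) ap_lam[OF T_F] by metis
qed

end


section \<open>Meaning of the formulas in a model\<close>

context zf
begin

lemma pair_iff: "(\<exists>a b. (\<forall>z. z \<epsilon> a \<longleftrightarrow> z = x) \<and> (\<forall>z. z \<epsilon> b \<longleftrightarrow> z = x \<or> z = y) \<and>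
    (\<forall>z. z \<epsilon> p \<longleftrightarrow> z = a \<or> z = b)) \<longleftrightarrow> p = pair x y"
proof -
  have "(\<forall>z. z \<epsilon> c \<longleftrightarrow> z = a \<or> z = b) \<longleftrightarrow> c = upr a b" for a b c using ext[of c "upr a b"] by auto
  moreover have "(\<forall>z. z \<epsilon> c \<longleftrightarrow> z = a) \<longleftrightarrow> c = upr a a" for a c using ext[of c "upr a a"] by auto
  ultimately show ?thesis by (simp add: pair_def)
qed

abbreviation ev :: "(nat \<Rightarrow> 'a) \<Rightarrow> oform \<Rightarrow> nat \<Rightarrow> (nat \<Rightarrow> 'a) \<Rightarrow> bool" where
  "ev \<equiv> sem E (=)"

text \<open>The premises say that the levels are bound. Simplification settles them, since a
  quantifier at depth \<open>n\<close> binds level \<open>n\<close> and its body is evaluated at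
  depth \<open>Suc n\<close>.\<close>

lemma ev_basic [simp]:
  "x < n \<Longrightarrow> ev prm (is_empty x) n v \<longleftrightarrow> v x = emp"
  "x < n \<Longrightarrow> ev prm (nonempty x) n v \<longleftrightarrow> (\<exists>z. z \<epsilon> v x)"
  "x < n \<Longrightarrow> y < n \<Longrightarrow> ev prm (x \<^bold>\<subseteq> y) n v \<longleftrightarrow> sub (v x) (v y)"
  "s < n \<Longrightarrow> x < n \<Longrightarrow> ev prm (is_succ s x) n v \<longleftrightarrow> v s = suc (v x)"
  "F < n \<Longrightarrow> x < n \<Longrightarrow> ev prm (is_Union x F) n v \<longleftrightarrow> v x = uni (v F)"
  "F < n \<Longrightarrow> x < n \<Longrightarrow> ev prm (is_Inter x F) n v \<longleftrightarrow> (\<forall>z. z \<epsilon> v x \<longleftrightarrow> (\<forall>A. A \<epsilon> v F \<longrightarrow> z \<epsilon> A))"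
  "d < n \<Longrightarrow> x < n \<Longrightarrow> y < n \<Longrightarrow> ev prm (is_inter d x y) n v \<longleftrightarrow> (\<forall>z. z \<epsilon> v d \<longleftrightarrow> z \<epsilon> v x \<and> z \<epsilon> v y)"
  "d < n \<Longrightarrow> x < n \<Longrightarrow> y < n \<Longrightarrow> ev prm (is_diff d x y) n v \<longleftrightarrow> v d = diff (v x) (v y)"
  "p < n \<Longrightarrow> x < n \<Longrightarrow> y < n \<Longrightarrow> ev prm (is_pair p x y) n v \<longleftrightarrow> v p = pair (v x) (v y)"
proof -
  have 1: "(\<forall>w. w \<epsilon> a \<longleftrightarrow> (\<exists>A. A \<epsilon> b \<and> w \<epsilon> A)) \<longleftrightarrow> a = uni b" for a b using ext[of a "uni b"] by auto
  have 2: "(\<forall>w. w \<epsilon> a \<longleftrightarrow> w \<epsilon> b \<and> \<not> w \<epsilon> c) \<longleftrightarrow> a = diff b c" for a b c using ext[of a "diff b c"] by auto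
  note [simp] = is_empty_def nonempty_def fsubset_def is_succ_def is_Union_def is_Inter_def
      is_inter_def is_diff_def is_pair_def is_upair_def is_empty_iff is_suc_iff sub_def
  show "x < n \<Longrightarrow> ev prm (is_empty x) n v \<longleftrightarrow> v x = emp"
    "x < n \<Longrightarrow> ev prm (nonempty x) n v \<longleftrightarrow> (\<exists>z. z \<epsilon> v x)"
    "x < n \<Longrightarrow> y < n \<Longrightarrow> ev prm (x \<^bold>\<subseteq> y) n v \<longleftrightarrow> sub (v x) (v y)"
    "s < n \<Longrightarrow> x < n \<Longrightarrow> ev prm (is_succ s x) n v \<longleftrightarrow> v s = suc (v x)"
    "F < n \<Longrightarrow> x < n \<Longrightarrow> ev prm (is_Union x F) n v \<longleftrightarrow> v x = uni (v F)"
    "F < n \<Longrightarrow> x < n \<Longrightarrow> ev prm (is_Inter x F) n v \<longleftrightarrow> (\<forall>z. z \<epsilon> v x \<longleftrightarrow> (\<forall>A. A \<epsilon> v F \<longrightarrow> z \<epsilon> A))"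
    "d < n \<Longrightarrow> x < n \<Longrightarrow> y < n \<Longrightarrow> ev prm (is_inter d x y) n v \<longleftrightarrow> (\<forall>z. z \<epsilon> v d \<longleftrightarrow> z \<epsilon> v x \<and> z \<epsilon> v y)"
    "d < n \<Longrightarrow> x < n \<Longrightarrow> y < n \<Longrightarrow> ev prm (is_diff d x y) n v \<longleftrightarrow> v d = diff (v x) (v y)"
    "p < n \<Longrightarrow> x < n \<Longrightarrow> y < n \<Longrightarrow> ev prm (is_pair p x y) n v \<longleftrightarrow> v p = pair (v x) (v y)"
    by (simp_all add: 1 2 flip: pair_iff)
qed

lemma prd_iff: "(\<forall>p. p \<epsilon> P \<longleftrightarrow> (\<exists>x y. x \<epsilon> A \<and> y \<epsilon> B \<and> p = pair x y)) \<longleftrightarrow> P = prd A B"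
  using ext[of P "prd A B"] by (auto simp: in_prd)

lemma omega_iff: "ind w \<and> (\<forall>v. ind v \<longrightarrow> sub w v) \<longleftrightarrow> w = om"
proof
  assume w: "ind w \<and> (\<forall>v. ind v \<longrightarrow> sub w v)"
  then show "w = om" by (intro ext) (auto simp: in_om sub_def)
next
  assume "w = om"
  moreover have "ind om" by (simp add: ind_def)
  moreover have "sub om v" if "ind v" for v using that by (simp add: sub_def in_om)
  ultimately show "ind w \<and> (\<forall>v. ind v \<longrightarrow> sub w v)" by blast
qed

lemma ev_prod [simp]:
  "P < n \<Longrightarrow> A < n \<Longrightarrow> B < n \<Longrightarrow> ev prm (is_prod P A B) n v \<longleftrightarrow> v P = prd (v A) (v B)"
  by (simp add: is_prod_def flip: prd_iff)

lemma ev_pair_in [simp]: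
  "x < n \<Longrightarrow> y < n \<Longrightarrow> r < n \<Longrightarrow> ev prm (pair_in x y r) n v \<longleftrightarrow> pair (v x) (v y) \<epsilon> v r"
  by (simp add: pair_in_def)

lemma ev_rel [simp]:
  "r < n \<Longrightarrow> A < n \<Longrightarrow> B < n \<Longrightarrow> ev prm (is_rel r A B) n v \<longleftrightarrow> sub (v r) (prd (v A) (v B))"
  by (simp add: is_rel_def sub_def in_prd)

lemma ev_fun [simp]:
  "f < n \<Longrightarrow> A < n \<Longrightarrow> B < n \<Longrightarrow> ev prm (is_fun f A B) n v \<longleftrightarrow> fn (v f) (v A) (v B)"
  by (simp add: is_fun_def single_valued_def fn_def sub_def in_prd)

lemma ev_bij [simp]:
  "f < n \<Longrightarrow> A < n \<Longrightarrow> B < n \<Longrightarrow> ev prm (is_bij f A B) n v \<longleftrightarrow> bij (v f) (v A) (v B)"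
  by (simp add: is_bij_def bij_def)

lemma ev_eqp [simp]: "A < n \<Longrightarrow> B < n \<Longrightarrow> ev prm (equipotent A B) n v \<longleftrightarrow> eqp (v A) (v B)"
  by (simp add: equipotent_def eqp_def)

lemma ev_ind [simp]: "w < n \<Longrightarrow> ev prm (is_inductive w) n v \<longleftrightarrow> ind (v w)"
  by (simp add: is_inductive_def ind_def)

lemma ev_omega [simp]: "w < n \<Longrightarrow> ev prm (is_omega w) n v \<longleftrightarrow> v w = om"
  by (simp add: is_omega_def omega_iff)

lemma ev_card [simp]:
  "A < n \<Longrightarrow> ev prm (finite_set A) n v \<longleftrightarrow> fin (v A)"
  "A < n \<Longrightarrow> ev prm (countable_set A) n v \<longleftrightarrow> ctb (v A)"
  by (simp_all add: finite_set_def fin_def countable_set_def ctb_def)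

lemma ev_denumerable [simp]: "A < n \<Longrightarrow> ev prm (denumerable_set A) n v \<longleftrightarrow> \<not> fin (v A) \<and> ctb (v A)"
  by (simp add: denumerable_set_def)

definition cu :: "('a \<Rightarrow> bool) \<Rightarrow> 'a \<Rightarrow> bool" where
  "cu K X \<longleftrightarrow> (\<exists>F. ctb F \<and> (\<forall>B. B \<epsilon> F \<longrightarrow> K B) \<and> X = uni F)"

lemma ev_cu [simp]:
  "A < n \<Longrightarrow> ev prm (cuf_set A) n v \<longleftrightarrow> cu fin (v A)"
  "A < n \<Longrightarrow> ev prm (cuc_set A) n v \<longleftrightarrow> cu ctb (v A)"
  by (simp_all add: cuf_set_def cuc_set_def countable_union_of_def cu_def)

definition ut :: "('a \<Rightarrow> bool) \<Rightarrow> bool" where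
  "ut K \<longleftrightarrow> (\<forall>F. ctb F \<and> (\<forall>A. A \<epsilon> F \<longrightarrow> K A) \<longrightarrow> K (uni F))"

lemma ev_ut [simp]:
  "ev prm UT_cuc_cuc n v \<longleftrightarrow> ut (cu ctb)"
  "ev prm UT_cuf_cuf n v \<longleftrightarrow> ut (cu fin)"
  by (auto simp: UT_cuc_cuc_def UT_cuf_cuf_def UT_countable_def ut_def)

definition cmc :: bool where
  "cmc \<longleftrightarrow> (\<forall>F. \<not> fin F \<and> ctb F \<and> (\<forall>A. A \<epsilon> F \<longrightarrow> (\<exists>z. z \<epsilon> A)) \<longrightarrow>
    (\<exists>f K. fn f F K \<and> (\<forall>A B. pair A B \<epsilon> f \<longrightarrow> (\<exists>z. z \<epsilon> B) \<and> fin B \<and> sub B A)))"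

lemma ev_cmc [simp]: "ev prm CMC n v \<longleftrightarrow> cmc"
  by (simp add: CMC_def cmc_def)

definition opn :: "'a \<Rightarrow> 'a \<Rightarrow> bool" where "opn A R \<longleftrightarrow> fn A (prd R R) R"
definition opv :: "'a \<Rightarrow> 'a \<Rightarrow> 'a \<Rightarrow> 'a \<Rightarrow> bool" where "opv A x y z \<longleftrightarrow> pair (pair x y) z \<epsilon> A"

lemma ev_op [simp]:
  "A < n \<Longrightarrow> R < n \<Longrightarrow> ev prm (is_op A R) n v \<longleftrightarrow> opn (v A) (v R)"
  "A < n \<Longrightarrow> x < n \<Longrightarrow> y < n \<Longrightarrow> z < n \<Longrightarrow> ev prm (op_val A x y z) n v \<longleftrightarrow> opv (v A) (v x) (v y) (v z)"
  by (simp_all add: is_op_def opn_def op_val_def opv_def)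

definition cmon :: "'a \<Rightarrow> 'a \<Rightarrow> 'a \<Rightarrow> bool" where
  "cmon R e A \<longleftrightarrow> opn A R \<and> e \<epsilon> R \<and>
    (\<forall>x y z. opv A x y z \<longrightarrow> opv A y x z) \<and>
    (\<forall>x y z u v t. opv A x y u \<and> opv A u z t \<and> opv A y z v \<longrightarrow> opv A x v t) \<and>
    (\<forall>x. x \<epsilon> R \<longrightarrow> opv A e x x)"

lemma ev_cmon [simp]:
  "R < n \<Longrightarrow> e < n \<Longrightarrow> A < n \<Longrightarrow> ev prm (comm_monoid R e A) n v \<longleftrightarrow> cmon (v R) (v e) (v A)"
  by (simp add: comm_monoid_def cmon_def)

definition fld :: "'a \<Rightarrow> 'a \<Rightarrow> 'a \<Rightarrow> 'a \<Rightarrow> 'a \<Rightarrow> bool" where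
  "fld R zero one A M \<longleftrightarrow> cmon R zero A \<and> cmon R one M \<and> zero \<noteq> one \<and>
     (\<forall>x. x \<epsilon> R \<longrightarrow> (\<exists>y. opv A x y zero)) \<and>
     (\<forall>x. x \<epsilon> R \<and> x \<noteq> zero \<longrightarrow> (\<exists>y. opv M x y one)) \<and>
     (\<forall>x y z s t u v. opv A y z s \<and> opv M x s t \<and> opv M x y u \<and> opv M x z v \<longrightarrow> opv A u v t)"

lemma ev_fld [simp]:
  "R < n \<Longrightarrow> zero < n \<Longrightarrow> one < n \<Longrightarrow> A < n \<Longrightarrow> M < n \<Longrightarrow>
    ev prm (is_field R zero one A M) n v \<longleftrightarrow> fld (v R) (v zero) (v one) (v A) (v M)"
  by (simp add: is_field_def fld_def)

definition lin :: "'a \<Rightarrow> 'a \<Rightarrow> bool" where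
  "lin R L \<longleftrightarrow> sub L (prd R R) \<and>
     (\<forall>x y. x \<epsilon> R \<and> y \<epsilon> R \<longrightarrow> pair x y \<epsilon> L \<or> pair y x \<epsilon> L) \<and>
     (\<forall>x y. pair x y \<epsilon> L \<and> pair y x \<epsilon> L \<longrightarrow> x = y) \<and>
     (\<forall>x y z. pair x y \<epsilon> L \<and> pair y z \<epsilon> L \<longrightarrow> pair x z \<epsilon> L)"

definition ub :: "'a \<Rightarrow> 'a \<Rightarrow> 'a \<Rightarrow> 'a \<Rightarrow> bool" where
  "ub R L S b \<longleftrightarrow> b \<epsilon> R \<and> (\<forall>x. x \<epsilon> S \<longrightarrow> pair x b \<epsilon> L)"

definition cpl :: "'a \<Rightarrow> 'a \<Rightarrow> bool" where
  "cpl R L \<longleftrightarrow> (\<forall>S. sub S R \<and> (\<exists>z. z \<epsilon> S) \<and> (\<exists>b. ub R L S b) \<longrightarrow>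
       (\<exists>s. ub R L S s \<and> (\<forall>b. ub R L S b \<longrightarrow> pair s b \<epsilon> L)))"

lemma ev_order [simp]:
  "R < n \<Longrightarrow> L < n \<Longrightarrow> ev prm (is_linear_order R L) n v \<longleftrightarrow> lin (v R) (v L)"
  "R < n \<Longrightarrow> L < n \<Longrightarrow> S < n \<Longrightarrow> b < n \<Longrightarrow> ev prm (upper_bound R L S b) n v \<longleftrightarrow> ub (v R) (v L) (v S) (v b)"
  by (simp_all add: is_linear_order_def lin_def upper_bound_def ub_def)

lemma ev_cpl [simp]: "R < n \<Longrightarrow> L < n \<Longrightarrow> ev prm (complete_order R L) n v \<longleftrightarrow> cpl (v R) (v L)"
  by (simp add: complete_order_def cpl_def)

definition reals :: "'a \<Rightarrow> 'a \<Rightarrow> 'a \<Rightarrow> 'a \<Rightarrow> 'a \<Rightarrow> 'a \<Rightarrow> bool" where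
  "reals R zero one A M L \<longleftrightarrow> fld R zero one A M \<and> lin R L \<and>
     (\<forall>x y z u v. pair x y \<epsilon> L \<and> opv A x z u \<and> opv A y z v \<longrightarrow> pair u v \<epsilon> L) \<and>
     (\<forall>x y z. pair zero x \<epsilon> L \<and> pair zero y \<epsilon> L \<and> opv M x y z \<longrightarrow> pair zero z \<epsilon> L) \<and> cpl R L"

lemma ev_reals [simp]:
  "R < n \<Longrightarrow> zero < n \<Longrightarrow> one < n \<Longrightarrow> A < n \<Longrightarrow> M < n \<Longrightarrow> L < n \<Longrightarrow>
    ev prm (is_reals R zero one A M L) n v \<longleftrightarrow> reals (v R) (v zero) (v one) (v A) (v M) (v L)"
  by (simp add: is_reals_def reals_def)

definition opr :: "'a \<Rightarrow> 'a \<Rightarrow> 'a \<Rightarrow> bool" where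
  "opr R L V \<longleftrightarrow> sub V R \<and> (\<forall>x. x \<epsilon> V \<longrightarrow>
     (\<exists>a b. (pair a x \<epsilon> L \<and> a \<noteq> x) \<and> (pair x b \<epsilon> L \<and> x \<noteq> b) \<and>
        (\<forall>y. (pair a y \<epsilon> L \<and> a \<noteq> y) \<and> (pair y b \<epsilon> L \<and> y \<noteq> b) \<longrightarrow> y \<epsilon> V)))"

definition top :: "'a \<Rightarrow> 'a \<Rightarrow> bool" where
  "top X W \<longleftrightarrow> (\<forall>U. U \<epsilon> W \<longrightarrow> sub U X) \<and> X \<epsilon> W \<and>
     (\<forall>U V Y. U \<epsilon> W \<and> V \<epsilon> W \<and> (\<forall>z. z \<epsilon> Y \<longleftrightarrow> z \<epsilon> U \<and> z \<epsilon> V) \<longrightarrow> Y \<epsilon> W) \<and>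
     (\<forall>S. sub S W \<longrightarrow> uni S \<epsilon> W)"

definition cont :: "'a \<Rightarrow> 'a \<Rightarrow> 'a \<Rightarrow> 'a \<Rightarrow> 'a \<Rightarrow> bool" where
  "cont R L X W f \<longleftrightarrow> fn f X R \<and>
     (\<forall>V P. opr R L V \<and> (\<forall>x. x \<epsilon> P \<longleftrightarrow> (\<exists>y. y \<epsilon> V \<and> pair x y \<epsilon> f)) \<longrightarrow> P \<epsilon> W)"

definition zset :: "'a \<Rightarrow> 'a \<Rightarrow> 'a \<Rightarrow> 'a \<Rightarrow> 'a \<Rightarrow> 'a \<Rightarrow> bool" where
  "zset R zero L X W Z \<longleftrightarrow> (\<exists>f. cont R L X W f \<and> (\<forall>x. x \<epsilon> Z \<longleftrightarrow> pair x zero \<epsilon> f))"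

definition gdelta :: "'a \<Rightarrow> 'a \<Rightarrow> bool" where
  "gdelta W Y \<longleftrightarrow> (\<exists>U. (\<exists>z. z \<epsilon> U) \<and> ctb U \<and> sub U W \<and> (\<forall>z. z \<epsilon> Y \<longleftrightarrow> (\<forall>A. A \<epsilon> U \<longrightarrow> z \<epsilon> A)))"

lemma ev_opr [simp]:
  "R < n \<Longrightarrow> L < n \<Longrightarrow> V < n \<Longrightarrow> ev prm (open_real R L V) n v \<longleftrightarrow> opr (v R) (v L) (v V)"
  by (simp add: open_real_def lt_def opr_def)

lemma ev_top [simp]:
  "X < n \<Longrightarrow> W < n \<Longrightarrow> ev prm (topological_space X W) n v \<longleftrightarrow> top (v X) (v W)"
  by (simp add: topological_space_def top_def)

lemma ev_cont [simp]:
  "R < n \<Longrightarrow> L < n \<Longrightarrow> X < n \<Longrightarrow> W < n \<Longrightarrow> f < n \<Longrightarrow>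
    ev prm (continuous_real R L X W f) n v \<longleftrightarrow> cont (v R) (v L) (v X) (v W) (v f)"
  by (simp add: continuous_real_def cont_def)

lemma ev_zset [simp]:
  "R < n \<Longrightarrow> zero < n \<Longrightarrow> L < n \<Longrightarrow> X < n \<Longrightarrow> W < n \<Longrightarrow> Z < n \<Longrightarrow>
    ev prm (zero_set R zero L X W Z) n v \<longleftrightarrow> zset (v R) (v zero) (v L) (v X) (v W) (v Z)"
  by (simp add: zero_set_def zset_def)

lemma ev_gdelta [simp]: "W < n \<Longrightarrow> Y < n \<Longrightarrow> ev prm (G_delta W Y) n v \<longleftrightarrow> gdelta (v W) (v Y)"
  by (simp add: G_delta_def gdelta_def)

definition creg :: "'a \<Rightarrow> 'a \<Rightarrow> 'a \<Rightarrow> 'a \<Rightarrow> 'a \<Rightarrow> bool" where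
  "creg R zero L X W \<longleftrightarrow> top X W \<and>
     (\<forall>U. (\<exists>Z. zset R zero L X W Z \<and> U = diff X Z) \<longrightarrow> U \<epsilon> W) \<and>
     (\<forall>U x. U \<epsilon> W \<and> x \<epsilon> U \<longrightarrow>
        (\<exists>V. (\<exists>Z. zset R zero L X W Z \<and> V = diff X Z) \<and> x \<epsilon> V \<and> sub V U))"

lemma ev_creg [simp]:
  "R < n \<Longrightarrow> zero < n \<Longrightarrow> L < n \<Longrightarrow> X < n \<Longrightarrow> W < n \<Longrightarrow>
    ev prm (completely_regular R zero L X W) n v \<longleftrightarrow> creg (v R) (v zero) (v L) (v X) (v W)"
  by (simp add: completely_regular_def is_base_def creg_def)

definition t1 :: "'a \<Rightarrow> 'a \<Rightarrow> bool" where
  "t1 X W \<longleftrightarrow> top X W \<and> (\<forall>x y. x \<epsilon> X \<and> y \<epsilon> X \<and> x \<noteq> y \<longrightarrow> (\<exists>U. U \<epsilon> W \<and> x \<epsilon> U \<and> \<not> y \<epsilon> U))"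

lemma ev_t1 [simp]: "X < n \<Longrightarrow> W < n \<Longrightarrow> ev prm (T1_space X W) n v \<longleftrightarrow> t1 (v X) (v W)"
  by (simp add: T1_space_def t1_def)

definition stab :: "('a \<Rightarrow> bool) \<Rightarrow> bool" where
  "stab K \<longleftrightarrow> (\<forall>U Y. (\<exists>z. z \<epsilon> U) \<and> ctb U \<and> (\<forall>A. A \<epsilon> U \<longrightarrow> K A) \<and>
    (\<forall>z. z \<epsilon> Y \<longleftrightarrow> (\<forall>A. A \<epsilon> U \<longrightarrow> z \<epsilon> A)) \<longrightarrow> K Y)"

lemma ev_G [simp]: "ev prm G_T3half_Gdd_Gd n v \<longleftrightarrow>
    (\<forall>R zero one A M L. reals R zero one A M L \<longrightarrow>
      (\<forall>X W. creg R zero L X W \<and> t1 X W \<longrightarrow> stab (gdelta W)))"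
  by (simp add: G_T3half_Gdd_Gd_def T3_half_space_def stable_under_countable_intersections_def stab_def)

lemma ev_Z [simp]: "ev prm Z_CR_Zd_Z n v \<longleftrightarrow>
    (\<forall>R zero one A M L. reals R zero one A M L \<longrightarrow>
      (\<forall>X W. creg R zero L X W \<longrightarrow> stab (zset R zero L X W)))"
  by (simp add: Z_CR_Zd_Z_def stable_under_countable_intersections_def stab_def)

end


section \<open>The reals in a model\<close>

locale model_reals = zf +
  fixes R z u A M L :: 'a
  assumes reals: "reals R z u A M L"
begin

definition le :: "'a \<Rightarrow> 'a \<Rightarrow> bool" where "le x y \<longleftrightarrow> pair x y \<epsilon> L"
definition ls :: "'a \<Rightarrow> 'a \<Rightarrow> bool" where "ls x y \<longleftrightarrow> le x y \<and> x \<noteq> y"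
definition pl :: "'a \<Rightarrow> 'a \<Rightarrow> 'a" where "pl x y = ap A (pair x y)"
definition tm :: "'a \<Rightarrow> 'a \<Rightarrow> 'a" where "tm x y = ap M (pair x y)"

lemma D_le [dfn]: "T s \<Longrightarrow> T t \<Longrightarrow> D (\<lambda>e. le (s e) (t e))"
  unfolding le_def by (intro dfn)

lemma D_ls [dfn]: "T s \<Longrightarrow> T t \<Longrightarrow> D (\<lambda>e. ls (s e) (t e))"
  unfolding ls_def by (intro dfn)

lemma T_pl [dfn]: "T s \<Longrightarrow> T t \<Longrightarrow> T (\<lambda>e. pl (s e) (t e))"
  unfolding pl_def by (intro dfn)

lemma linear: "lin R L" and field: "fld R z u A M" and complete: "cpl R L"
  using reals by (auto simp: reals_def)

lemma
  shows le_in: "le x y \<Longrightarrow> x \<epsilon> R \<and> y \<epsilon> R"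
    and le_total: "x \<epsilon> R \<Longrightarrow> y \<epsilon> R \<Longrightarrow> le x y \<or> le y x"
    and le_antisym: "le x y \<Longrightarrow> le y x \<Longrightarrow> x = y"
    and le_trans: "le x y \<Longrightarrow> le y w \<Longrightarrow> le x w"
  using linear unfolding lin_def le_def sub_def by (metis pair_in_prd, metis+)

lemma le_refl: "x \<epsilon> R \<Longrightarrow> le x x"
  using le_total by blast

lemma ls_in: "ls x y \<Longrightarrow> x \<epsilon> R \<and> y \<epsilon> R"
  using le_in unfolding ls_def by blast

lemma ls_irrefl [simp]: "\<not> ls x x"
  by (simp add: ls_def)

lemma ls_le: "ls x y \<Longrightarrow> le x y"
  by (simp add: ls_def)

lemma not_ls: "x \<epsilon> R \<Longrightarrow> y \<epsilon> R \<Longrightarrow> \<not> ls x y \<longleftrightarrow> le y x"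
  using le_total le_antisym le_refl unfolding ls_def by blast

lemma not_le: "x \<epsilon> R \<Longrightarrow> y \<epsilon> R \<Longrightarrow> \<not> le x y \<longleftrightarrow> ls y x"
  using not_ls by blast

lemma ls_le_trans: "ls x y \<Longrightarrow> le y w \<Longrightarrow> ls x w"
  using le_trans le_antisym unfolding ls_def by blast

lemma le_ls_trans: "le x y \<Longrightarrow> ls y w \<Longrightarrow> ls x w"
  using le_trans le_antisym unfolding ls_def by blast

lemma ls_trans: "ls x y \<Longrightarrow> ls y w \<Longrightarrow> ls x w"
  using ls_le_trans ls_le by blast

lemma fn_pl: "fn A (prd R R) R" and fn_tm: "fn M (prd R R) R"
  using field by (auto simp: fld_def cmon_def opn_def)

lemma opv_pl: "opv A x y w \<longleftrightarrow> x \<epsilon> R \<and> y \<epsilon> R \<and> w = pl x y"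
  unfolding opv_def pl_def fn_pair[OF fn_pl] by simp

lemma opv_tm: "opv M x y w \<longleftrightarrow> x \<epsilon> R \<and> y \<epsilon> R \<and> w = tm x y"
  unfolding opv_def tm_def fn_pair[OF fn_tm] by simp

lemma pl_in [simp]: "x \<epsilon> R \<Longrightarrow> y \<epsilon> R \<Longrightarrow> pl x y \<epsilon> R"
  unfolding pl_def by (rule fn_ap[OF fn_pl]) simp

lemma tm_in [simp]: "x \<epsilon> R \<Longrightarrow> y \<epsilon> R \<Longrightarrow> tm x y \<epsilon> R"
  unfolding tm_def by (rule fn_ap[OF fn_tm]) simp

lemma z_in [simp]: "z \<epsilon> R" and u_in [simp]: "u \<epsilon> R" and z_u: "z \<noteq> u"
  using field by (auto simp: fld_def cmon_def)

lemma
  shows pl_comm: "x \<epsilon> R \<Longrightarrow> y \<epsilon> R \<Longrightarrow> pl x y = pl y x"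
    and pl_assoc: "x \<epsilon> R \<Longrightarrow> y \<epsilon> R \<Longrightarrow> w \<epsilon> R \<Longrightarrow> pl (pl x y) w = pl x (pl y w)"
    and z_pl: "x \<epsilon> R \<Longrightarrow> pl z x = x"
    and tm_comm: "x \<epsilon> R \<Longrightarrow> y \<epsilon> R \<Longrightarrow> tm x y = tm y x"
    and u_tm: "x \<epsilon> R \<Longrightarrow> tm u x = x"
    and neg_ex: "x \<epsilon> R \<Longrightarrow> \<exists>y. y \<epsilon> R \<and> pl x y = z"
    and inv_ex: "x \<epsilon> R \<Longrightarrow> x \<noteq> z \<Longrightarrow> \<exists>y. y \<epsilon> R \<and> tm x y = u"
    and distrib: "x \<epsilon> R \<Longrightarrow> y \<epsilon> R \<Longrightarrow> w \<epsilon> R \<Longrightarrow> tm x (pl y w) = pl (tm x y) (tm x w)"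
proof -
  have A: "cmon R z A" and M: "cmon R u M" and
    neg: "\<And>x. x \<epsilon> R \<Longrightarrow> \<exists>y. opv A x y z" and inv: "\<And>x. x \<epsilon> R \<Longrightarrow> x \<noteq> z \<Longrightarrow> \<exists>y. opv M x y u" and
    dist: "\<And>x y w s t p q. opv A y w s \<Longrightarrow> opv M x s t \<Longrightarrow> opv M x y p \<Longrightarrow> opv M x w q \<Longrightarrow> opv A p q t"
    using field unfolding fld_def by blast+
  have comm: "\<And>x y w. opv A x y w \<Longrightarrow> opv A y x w" "\<And>x y w. opv M x y w \<Longrightarrow> opv M y x w"
    and assoc: "\<And>x y w s t q. opv A x y s \<Longrightarrow> opv A s w t \<Longrightarrow> opv A y w q \<Longrightarrow> opv A x q t"
    and unit: "\<And>x. x \<epsilon> R \<Longrightarrow> opv A z x x" "\<And>x. x \<epsilon> R \<Longrightarrow> opv M u x x"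
    using A M unfolding cmon_def by blast+
  show "x \<epsilon> R \<Longrightarrow> y \<epsilon> R \<Longrightarrow> pl x y = pl y x" using comm(1)[of x y "pl x y"] by (simp add: opv_pl)
  show "x \<epsilon> R \<Longrightarrow> y \<epsilon> R \<Longrightarrow> tm x y = tm y x" using comm(2)[of x y "tm x y"] by (simp add: opv_tm)
  show "x \<epsilon> R \<Longrightarrow> y \<epsilon> R \<Longrightarrow> w \<epsilon> R \<Longrightarrow> pl (pl x y) w = pl x (pl y w)"
    using assoc[of x y "pl x y" w "pl (pl x y) w" "pl y w"] by (simp add: opv_pl)
  show "x \<epsilon> R \<Longrightarrow> pl z x = x" "x \<epsilon> R \<Longrightarrow> tm u x = x"
    using unit[of x] by (simp_all add: opv_pl opv_tm)
  show "x \<epsilon> R \<Longrightarrow> \<exists>y. y \<epsilon> R \<and> pl x y = z" using neg[of x] by (auto simp: opv_pl)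
  show "x \<epsilon> R \<Longrightarrow> x \<noteq> z \<Longrightarrow> \<exists>y. y \<epsilon> R \<and> tm x y = u" using inv[of x] by (auto simp: opv_tm)
  show "x \<epsilon> R \<Longrightarrow> y \<epsilon> R \<Longrightarrow> w \<epsilon> R \<Longrightarrow> tm x (pl y w) = pl (tm x y) (tm x w)"
    using dist[of y w "pl y w" x "tm x (pl y w)" "tm x y" "tm x w"] by (simp add: opv_pl opv_tm)
qed

lemma pl_mono: "le x y \<Longrightarrow> w \<epsilon> R \<Longrightarrow> le (pl x w) (pl y w)"
  using reals le_in[of x y] unfolding reals_def opv_pl le_def by blast

lemma pl_cancel: "x \<epsilon> R \<Longrightarrow> y \<epsilon> R \<Longrightarrow> w \<epsilon> R \<Longrightarrow> pl x w = pl y w \<Longrightarrow> x = y"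
proof -
  assume *: "x \<epsilon> R" "y \<epsilon> R" "w \<epsilon> R" "pl x w = pl y w"
  then obtain v where v: "v \<epsilon> R" "pl w v = z" using neg_ex by blast
  have "pl x z = x" "pl y z = y" using * pl_comm[of x z] pl_comm[of y z] z_pl by simp_all
  then have "pl (pl x w) v = x" "pl (pl y w) v = y" using *(1-3) v by (simp_all add: pl_assoc)
  then show ?thesis unfolding *(4) by (rule trans[OF sym])
qed

lemma pl_strict: "ls x y \<Longrightarrow> w \<epsilon> R \<Longrightarrow> ls (pl x w) (pl y w)"
  using pl_mono[of x y w] pl_cancel[of x y w] le_in[of x y] unfolding ls_def by blast

lemma pl_strict2: "ls x y \<Longrightarrow> ls x' y' \<Longrightarrow> ls (pl x x') (pl y y')"
  using ls_in[of x y] ls_in[of x' y'] pl_strict[of x y x'] pl_strict[of x' y' y]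
  by (simp add: pl_comm[of y] ls_trans)

definition ng :: "'a \<Rightarrow> 'a" where "ng x = pick R (\<lambda>y. pl x y = z)"

lemma T_ng [dfn]: "T t \<Longrightarrow> T (\<lambda>e. ng (t e))"
  by (rule T1[of ng], unfold ng_def, intro dfn)

lemma ng: "x \<epsilon> R \<Longrightarrow> ng x \<epsilon> R \<and> pl x (ng x) = z"
proof -
  assume x: "x \<epsilon> R"
  then obtain y where y: "y \<epsilon> R" "pl x y = z" using neg_ex by blast
  have "ng x = y"
    unfolding ng_def
    by (rule pick, intro dfn) (use x y in \<open>auto intro: pl_cancel[of _ _ x] simp: pl_comm[of _ x]\<close>)
  then show ?thesis using y by simp
qed

lemma ng_in [simp]: "x \<epsilon> R \<Longrightarrow> ng x \<epsilon> R"
  using ng by blast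

lemma ng_ng: "x \<epsilon> R \<Longrightarrow> ng (ng x) = x"
  using pl_cancel[of "ng (ng x)" x "ng x"] ng[of x] ng[of "ng x"] pl_comm[of "ng (ng x)" "ng x"] by simp

lemma ng_z: "ng z = z"
  using ng[of z] z_pl[of "ng z"] by simp

lemma ng_mono: "le x y \<Longrightarrow> le (ng y) (ng x)"
proof -
  assume *: "le x y"
  then have x: "x \<epsilon> R" "y \<epsilon> R" using le_in by auto
  have "le (pl x (pl (ng x) (ng y))) (pl y (pl (ng x) (ng y)))" by (rule pl_mono[OF *]) (simp add: x)
  moreover have "pl x (pl (ng x) (ng y)) = ng y" using x ng[of x] z_pl[of "ng y"] by (simp flip: pl_assoc)
  moreover have "pl y (pl (ng x) (ng y)) = ng x"
    using x ng[of y] z_pl[of "ng x"] pl_comm[of "ng x" "ng y"] by (simp flip: pl_assoc)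
  ultimately show ?thesis by simp
qed

lemma ng_strict: "ls x y \<Longrightarrow> ls (ng y) (ng x)"
  using ng_mono[of x y] ng_ng[of x] ng_ng[of y] le_in[of x y] unfolding ls_def by auto

text \<open>Either the unit or its negative is positive, and any positive element will do; so 0 < 1
  need not be derived.\<close>

lemma pos_ex: "\<exists>p. ls z p"
proof (cases "le z u")
  case True
  then show ?thesis using z_u unfolding ls_def by blast
next
  case False
  then have "ls u z" using not_le by simp
  then have "ls z (ng u)" using ng_strict ng_z by metis
  then show ?thesis by blast
qed

text \<open>Choosing one element of the model is harmless, as it only serves as a parameter; the
  model itself gains no choice principle.\<close>

definition pz :: 'a where "pz = (SOME p. ls z p)"

lemma pz: "ls z pz"
  unfolding pz_def by (rule someI_ex[OF pos_ex])

lemma pz_in [simp]: "pz \<epsilon> R"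
  using pz ls_in by blast

lemma no_max: "x \<epsilon> R \<Longrightarrow> \<exists>y. ls x y"
  using pl_strict[OF pz, of x] z_pl[of x] by auto

lemma no_min: "x \<epsilon> R \<Longrightarrow> \<exists>y. ls y x"
  using no_max[of "ng x"] ng_strict[of "ng x"] ng_ng[of x] by auto

text \<open>The order excludes 1 + 1 = 0, so 1 + 1 has an inverse.\<close>

lemma half_ex: "x \<epsilon> R \<Longrightarrow> \<exists>y. y \<epsilon> R \<and> pl y y = x"
proof -
  assume x: "x \<epsilon> R"
  have "pl u u \<noteq> z"
  proof
    assume *: "pl u u = z"
    consider "ls z u" | "ls u z" using z_u le_total[of z u] unfolding ls_def by auto
    then show False
      using pl_strict2[of z u z u] pl_strict2[of u z u z] * z_pl[of z] by cases auto
  qed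
  then obtain i where i: "i \<epsilon> R" "tm (pl u u) i = u" using inv_ex[of "pl u u"] by auto
  have "pl i i = u" using i distrib[of i u u] tm_comm[of i u] tm_comm[of i "pl u u"] u_tm[of i] by simp
  then have "pl (tm x i) (tm x i) = x" using distrib[of x i i] x i tm_comm[of x u] u_tm[of x] by simp
  then show ?thesis using x i tm_in by blast
qed

lemma double_inj: "x \<epsilon> R \<Longrightarrow> y \<epsilon> R \<Longrightarrow> pl x x = pl y y \<Longrightarrow> x = y"
  using pl_strict2[of x y x y] pl_strict2[of y x y x] not_ls[of x y] not_ls[of y x] le_antisym[of x y]
  by auto

definition hf :: "'a \<Rightarrow> 'a" where "hf x = pick R (\<lambda>y. pl y y = x)"

lemma T_hf [dfn]: "T t \<Longrightarrow> T (\<lambda>e. hf (t e))"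
  by (rule T1[of hf], unfold hf_def, intro dfn)

lemma hf: "x \<epsilon> R \<Longrightarrow> hf x \<epsilon> R \<and> pl (hf x) (hf x) = x"
proof -
  assume x: "x \<epsilon> R"
  then obtain y where y: "y \<epsilon> R" "pl y y = x" using half_ex by blast
  have "hf x = y"
    unfolding hf_def by (rule pick, intro dfn) (use y double_inj in auto)
  then show ?thesis using y by simp
qed

lemma hf_pos: "ls z x \<Longrightarrow> ls z (hf x) \<and> ls (hf x) x"
proof -
  assume x: "ls z x"
  then have h: "hf x \<epsilon> R" "pl (hf x) (hf x) = x" using hf ls_in by auto
  have "ls z (hf x)"
  proof (rule ccontr)
    assume "\<not> ls z (hf x)"
    then have "le (hf x) z" using h not_ls by simp
    then have "le (pl (hf x) (hf x)) (hf x)" using pl_mono[of "hf x" z "hf x"] h z_pl by simp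
    then have "le x z" using \<open>le (hf x) z\<close> h le_trans by metis
    then show False using x le_ls_trans ls_irrefl by blast
  qed
  moreover have "ls (hf x) x" using pl_strict[OF calculation h(1)] h z_pl by simp
  ultimately show ?thesis by blast
qed

lemma dense: "ls x y \<Longrightarrow> \<exists>m. ls x m \<and> ls m y"
proof -
  assume xy: "ls x y"
  then have x: "x \<epsilon> R" "y \<epsilon> R" using ls_in by auto
  let ?d = "pl y (ng x)"
  have "ls z ?d" using pl_strict[OF xy, of "ng x"] x ng by simp
  then have d: "ls z (hf ?d)" "ls (hf ?d) ?d" using hf_pos by auto
  have "ls (pl z x) (pl (hf ?d) x)" "ls (pl (hf ?d) x) (pl ?d x)" using pl_strict d x by blast+
  moreover have "pl ?d x = y" using x ng[of x] pl_comm[of "ng x" x] pl_comm[of y z] z_pl[of y] by (simp add: pl_assoc)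
  ultimately show ?thesis using z_pl x by auto
qed

text \<open>The null sequence \<open>pz\<close>, \<open>pz\<close>/2, \<open>pz\<close>/4, and so
  on. Obtained by halving, it needs no embedding of \<open>om\<close> into the field.\<close>

definition sq :: "'a \<Rightarrow> 'a" where "sq n = rc pz (lam R hf) n"

lemma T_sq [dfn]: "T t \<Longrightarrow> T (\<lambda>e. sq (t e))"
  unfolding sq_def by (intro dfn)

lemma fn_hf: "fn (lam R hf) R R"
  by (rule fn_lam) (auto intro: dfn simp: hf)

lemma sq_in [simp]: "n \<epsilon> om \<Longrightarrow> sq n \<epsilon> R"
  unfolding sq_def by (rule rc_in[OF fn_hf]) simp_all

lemma sq_suc: "n \<epsilon> om \<Longrightarrow> sq (suc n) = hf (sq n)"
  using rc_suc[OF fn_hf pz_in, of n] sq_in[of n] by (simp add: sq_def T_hf T_var)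

lemma sq_pos: "n \<epsilon> om \<Longrightarrow> ls z (sq n)"
proof (induction n rule: om_induct)
  case definable show ?case by (intro dfn)
next
  case zero show ?case using rc_zero[OF fn_hf pz_in] pz by (simp add: sq_def)
next
  case (suc n) then show ?case using sq_suc hf_pos by simp
qed

lemma sq_mono: "n \<epsilon> om \<Longrightarrow> m \<epsilon> n \<Longrightarrow> ls (sq n) (sq m)"
proof -
  assume "n \<epsilon> om"
  then have "\<forall>m. m \<epsilon> n \<longrightarrow> ls (sq n) (sq m)"
  proof (induction n rule: om_induct)
    case definable show ?case by (intro dfn)
  next
    case zero show ?case by simp
  next
    case (suc n)
    have "ls (sq (suc n)) (sq n)" using suc sq_suc hf_pos sq_pos by simp
    then show ?case using suc.IH ls_trans unfolding in_suc by blast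
  qed
  then show "m \<epsilon> n \<Longrightarrow> ls (sq n) (sq m)" by blast
qed

lemma sup_ex:
  assumes "D (\<lambda>e. P (e 0))" "x \<epsilon> R" "P x" "b \<epsilon> R" "\<And>y. y \<epsilon> R \<Longrightarrow> P y \<Longrightarrow> le y b"
  shows "\<exists>s. s \<epsilon> R \<and> (\<forall>y. y \<epsilon> R \<and> P y \<longrightarrow> le y s) \<and>
    (\<forall>b. b \<epsilon> R \<and> (\<forall>y. y \<epsilon> R \<and> P y \<longrightarrow> le y b) \<longrightarrow> le s b)"
proof -
  have s: "y \<epsilon> sep R P \<longleftrightarrow> y \<epsilon> R \<and> P y" for y using assms(1) by (rule sep)
  have ub: "ub R L (sep R P) c \<longleftrightarrow> c \<epsilon> R \<and> (\<forall>y. y \<epsilon> R \<and> P y \<longrightarrow> le y c)" for c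
    unfolding ub_def s le_def by simp
  have "sub (sep R P) R" "\<exists>y. y \<epsilon> sep R P" "\<exists>b. ub R L (sep R P) b"
    using assms unfolding ub by (auto simp: sub_def s)
  then have "\<exists>t. ub R L (sep R P) t \<and> (\<forall>b. ub R L (sep R P) b \<longrightarrow> pair t b \<epsilon> L)"
    using complete unfolding cpl_def by blast
  then show ?thesis unfolding ub le_def[symmetric] by blast
qed

text \<open>Otherwise the lower bounds of the sequence have a positive supremum \<open>s\<close>.
  From \<open>s\<close> being below every half \<open>hf (sq n)\<close>, also \<open>s + s\<close>
  is a lower bound, although it exceeds \<open>s\<close>.\<close>

lemma sq_lim: "ls z b \<Longrightarrow> \<exists>n. n \<epsilon> om \<and> ls (sq n) b"
proof (rule ccontr)
  assume b: "ls z b" and no: "\<not> (\<exists>n. n \<epsilon> om \<and> ls (sq n) b)"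
  define P where "P x \<longleftrightarrow> (\<forall>n. n \<epsilon> om \<longrightarrow> le x (sq n))" for x
  have bR: "b \<epsilon> R" using b ls_in by blast
  have Pb: "P b" unfolding P_def using no not_ls bR sq_in by blast
  have "D (\<lambda>e. P (e 0))" unfolding P_def by (intro dfn)
  from sup_ex[of P, OF this bR Pb sq_in[OF zero_om]] obtain s where
    s: "s \<epsilon> R" "\<And>y. y \<epsilon> R \<Longrightarrow> P y \<Longrightarrow> le y s"
      "\<And>c. c \<epsilon> R \<Longrightarrow> (\<And>y. y \<epsilon> R \<Longrightarrow> P y \<Longrightarrow> le y c) \<Longrightarrow> le s c"
    unfolding P_def using zero_om by metis
  have sn: "le s (sq n)" if "n \<epsilon> om" for n
    by (rule s(3)) (use that in \<open>auto simp: P_def\<close>)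
  have "P (pl s s)"
    unfolding P_def
  proof (intro HOL.allI HOL.impI)
    fix n assume n: "n \<epsilon> om"
    have "le s (hf (sq n))" using sn[of "suc n"] sq_suc n by simp
    then have "le (pl s s) (pl (hf (sq n)) (hf (sq n)))"
      using pl_mono[of s "hf (sq n)" s] pl_mono[of s "hf (sq n)" "hf (sq n)"] pl_comm[of s "hf (sq n)"]
        le_trans le_in[of s "hf (sq n)"] by auto
    then show "le (pl s s) (sq n)" using hf n by simp
  qed
  then have "le (pl s s) s" using s by simp
  moreover have "ls z s" using b s(2)[OF bR Pb] ls_le_trans by blast
  then have "ls s (pl s s)" using pl_strict[of z s s] z_pl s(1) by simp
  ultimately show False using ls_le_trans ls_irrefl by blast
qed

end


section \<open>Consequences of multiple choice\<close>

context zf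
begin

lemma pair_mem: "upr x y \<epsilon> pair x y"
  by (simp add: pair_def)

text \<open>Multiple choice applies to an infinite set of sets, whereas the \<open>F n\<close> may
  coincide. Tagging the members of \<open>F n\<close> with \<open>n\<close> makes the sets distinct
  and their family infinite; afterwards the tags are projected away.\<close>

lemma cmc_om:
  assumes cmc and F: "T (\<lambda>e. F (e 0))" and ne: "\<And>n. n \<epsilon> om \<Longrightarrow> \<exists>x. x \<epsilon> F n"
  obtains h where "\<And>n. n \<epsilon> om \<Longrightarrow> fin (ap h n)" "\<And>n. n \<epsilon> om \<Longrightarrow> \<exists>x. x \<epsilon> ap h n"
    "\<And>n x. n \<epsilon> om \<Longrightarrow> x \<epsilon> ap h n \<Longrightarrow> x \<epsilon> F n"
proof -
  have F_i: "T (\<lambda>e. F (e i))" for i by (rule T_at[where F = F]) fact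
  define G where "G n = prd (upr n n) (F n)" for n
  have T_G: "T (\<lambda>e. G (e i))" for i unfolding G_def by (intro dfn F_i)
  define Fam where "Fam = repl om G"
  have in_Fam: "B \<epsilon> Fam \<longleftrightarrow> (\<exists>n. n \<epsilon> om \<and> B = G n)" for B
    unfolding Fam_def by (rule repl) (rule T_G)
  define idx where "idx p = pick om (\<lambda>n. \<exists>y. pair n y \<epsilon> p)" for p
  have T_idx: "T (\<lambda>e. idx (e 0))" unfolding idx_def by (intro dfn)
  have idx: "idx (G n) = n" if "n \<epsilon> om" for n
    unfolding idx_def by (rule pick, intro dfn) (use that ne in \<open>auto simp: G_def\<close>)
  have "\<not> fin Fam"
  proof
    assume "fin Fam"
    then have "fin (repl Fam idx)" using T_idx by (rule fin_repl)
    moreover have "sub om (repl Fam idx)"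
      unfolding sub_def repl[OF T_idx] in_Fam using idx by metis
    ultimately show False using fin_subset not_fin_om by blast
  qed
  moreover have "ctb Fam" unfolding Fam_def using ctb_om T_G by (rule ctb_repl)
  moreover have "\<exists>z. z \<epsilon> B" if "B \<epsilon> Fam" for B
    using that ne unfolding in_Fam G_def by (metis in_upr pair_in_prd)
  ultimately obtain f K where f: "fn f Fam K"
    "\<And>A B. pair A B \<epsilon> f \<Longrightarrow> (\<exists>z. z \<epsilon> B) \<and> fin B \<and> sub B A"
    using assms(1) unfolding cmc_def by blast
  have f_G: "(\<exists>z. z \<epsilon> ap f (G n)) \<and> fin (ap f (G n)) \<and> sub (ap f (G n)) (G n)" if "n \<epsilon> om" for n
    by (rule f(2)) (use that in_Fam in \<open>auto simp: fn_pair[OF f(1)]\<close>)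
  define second where "second p = pick (uni p) (\<lambda>y. \<exists>x. p = pair x y)" for p
  have T_second: "T (\<lambda>e. second (e i))" for i unfolding second_def by (intro dfn)
  have second: "second (pair x y) = y" for x y
    unfolding second_def by (rule pick, intro dfn) (auto intro: exI[of _ "upr x y"] simp: pair_mem)
  define h where "h = lam om (\<lambda>n. repl (ap f (G n)) second)"
  have h: "ap h n = repl (ap f (G n)) second" if "n \<epsilon> om" for n
    unfolding h_def by (rule ap_lam[OF _ that]) (intro dfn T_G T_second)
  have in_h: "x \<epsilon> ap h n \<longleftrightarrow> (\<exists>p. p \<epsilon> ap f (G n) \<and> x = second p)" if "n \<epsilon> om" for n x
    unfolding h[OF that] by (rule repl) (rule T_second)
  show ?thesis
  proof (rule that[of h])
    fix n assume n: "n \<epsilon> om"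
    show "fin (ap h n)" unfolding h[OF n] using f_G[OF n] T_second by (intro fin_repl) auto
    show "\<exists>x. x \<epsilon> ap h n" unfolding in_h[OF n] using f_G[OF n] by blast
    fix x assume "x \<epsilon> ap h n"
    then obtain p where "p \<epsilon> ap f (G n)" "x = second p" using in_h[OF n] by blast
    moreover have "p \<epsilon> G n" using f_G[OF n] calculation(1) unfolding sub_def by blast
    ultimately show "x \<epsilon> F n" unfolding G_def by (auto simp: in_prd second)
  qed
qed

text \<open>The set is the union of all open sets inside it, so no neighbourhoods have to be
  chosen.\<close>

lemma top_local:
  assumes "top X W" "\<And>x. x \<epsilon> P \<Longrightarrow> \<exists>U. U \<epsilon> W \<and> x \<epsilon> U \<and> sub U P"
  shows "P \<epsilon> W"
proof -
  have s: "U \<epsilon> sep W (\<lambda>U. sub U P) \<longleftrightarrow> U \<epsilon> W \<and> sub U P" for U by (rule sep) (intro dfn)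
  have "sub (sep W (\<lambda>U. sub U P)) W" by (simp add: sub_def[of _ W] s)
  then have "uni (sep W (\<lambda>U. sub U P)) \<epsilon> W" using assms(1) unfolding top_def by blast
  moreover have "uni (sep W (\<lambda>U. sub U P)) = P"
  proof (rule ext)
    fix x
    show "x \<epsilon> uni (sep W (\<lambda>U. sub U P)) \<longleftrightarrow> x \<epsilon> P"
      unfolding in_uni s using assms(2)[of x] by (auto simp: sub_def)
  qed
  ultimately show ?thesis by simp
qed

lemma top_X: "top X W \<Longrightarrow> X \<epsilon> W"
  unfolding top_def by blast

lemma top_sub: "top X W \<Longrightarrow> U \<epsilon> W \<Longrightarrow> x \<epsilon> U \<Longrightarrow> x \<epsilon> X"
  unfolding top_def sub_def by blast

lemma top_inter: "top X W \<Longrightarrow> U \<epsilon> W \<Longrightarrow> V \<epsilon> W \<Longrightarrow> (\<And>x. x \<epsilon> Y \<longleftrightarrow> x \<epsilon> U \<and> x \<epsilon> V) \<Longrightarrow> Y \<epsilon> W"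
  unfolding top_def by blast

lemma top_fin_inter:
  assumes top: "top X W" and G: "T (\<lambda>e. G (e 0))" and "fin F" "\<And>i. i \<epsilon> F \<Longrightarrow> G i \<epsilon> W"
  shows "sep X (\<lambda>x. \<forall>i. i \<epsilon> F \<longrightarrow> x \<epsilon> G i) \<epsilon> W"
proof -
  have G_i: "T (\<lambda>e. G (e i))" for i by (rule T_at[where F = G]) fact
  have s: "x \<epsilon> sep X (\<lambda>x. \<forall>i. i \<epsilon> F \<longrightarrow> x \<epsilon> G i) \<longleftrightarrow> x \<epsilon> X \<and> (\<forall>i. i \<epsilon> F \<longrightarrow> x \<epsilon> G i)" for x F
    by (rule sep) (intro dfn G_i)
  from assms(3) have "(\<forall>i. i \<epsilon> F \<longrightarrow> G i \<epsilon> W) \<longrightarrow> sep X (\<lambda>x. \<forall>i. i \<epsilon> F \<longrightarrow> x \<epsilon> G i) \<epsilon> W"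
  proof (induction F rule: fin_induct)
    case definable show ?case by (intro dfn G_i)
  next
    case empty
    have "sep X (\<lambda>x. \<forall>i. i \<epsilon> emp \<longrightarrow> x \<epsilon> G i) = X" by (rule ext) (simp only: s, simp)
    then show ?case using top_X[OF top] by simp
  next
    case (insert F a)
    show ?case
    proof
      assume *: "\<forall>i. i \<epsilon> cup F (upr a a) \<longrightarrow> G i \<epsilon> W"
      then have "sep X (\<lambda>x. \<forall>i. i \<epsilon> F \<longrightarrow> x \<epsilon> G i) \<epsilon> W" "G a \<epsilon> W" using insert by simp_all
      then show "sep X (\<lambda>x. \<forall>i. i \<epsilon> cup F (upr a a) \<longrightarrow> x \<epsilon> G i) \<epsilon> W"
        by (rule top_inter[OF top]) (simp only: s, auto)
    qed
  qed
  then show ?thesis using assms(4) by blast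
qed

lemma fn_enlarge: "fn f X Y \<Longrightarrow> sub Y Y' \<Longrightarrow> fn f X Y'"
  unfolding fn_def sub_def by blast

lemma fn_in_Pw: "fn f X Y \<Longrightarrow> f \<epsilon> Pw (prd X Y)"
  unfolding fn_def by (auto simp: sub_def in_prd)

theorem gdelta_stable:
  assumes cmc and top: "top X W"
  shows "stab (gdelta W)"
  unfolding stab_def
proof (intro HOL.allI HOL.impI, elim conjE)
  fix U Y
  assume "\<exists>z. z \<epsilon> U" and U: "ctb U" "\<forall>B. B \<epsilon> U \<longrightarrow> gdelta W B"
    and Y: "\<forall>z. z \<epsilon> Y \<longleftrightarrow> (\<forall>B. B \<epsilon> U \<longrightarrow> z \<epsilon> B)"
  then obtain u where "u \<epsilon> U" by blast
  obtain s where s: "fn s om U" "\<And>B. B \<epsilon> U \<Longrightarrow> \<exists>n. n \<epsilon> om \<and> ap s n = B"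
    by (rule ctb_enum[OF U(1) \<open>u \<epsilon> U\<close>], rule that, assumption+)
  \<comment> \<open>All sequences of open sets with intersection \<open>ap s n\<close>. Sequences,
    unlike countable families, can be merged term by term.\<close>
  define F where "F n = sep (Pw (prd om W)) (\<lambda>f. fn f om W \<and>
    (\<forall>x. x \<epsilon> ap s n \<longleftrightarrow> (\<forall>k. k \<epsilon> om \<longrightarrow> x \<epsilon> ap f k)))" for n
  have T_F: "T (\<lambda>e. F (e 0))" unfolding F_def by (intro dfn)
  have "f \<epsilon> F n \<longleftrightarrow> f \<epsilon> Pw (prd om W) \<and> fn f om W \<and>
    (\<forall>x. x \<epsilon> ap s n \<longleftrightarrow> (\<forall>k. k \<epsilon> om \<longrightarrow> x \<epsilon> ap f k))" for f n
    unfolding F_def by (rule sep) (intro dfn)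
  then have in_F: "f \<epsilon> F n \<longleftrightarrow> fn f om W \<and>
    (\<forall>x. x \<epsilon> ap s n \<longleftrightarrow> (\<forall>k. k \<epsilon> om \<longrightarrow> x \<epsilon> ap f k))" for f n
    using fn_in_Pw by blast
  have ne: "\<exists>f. f \<epsilon> F n" if "n \<epsilon> om" for n
  proof -
    have "gdelta W (ap s n)" using U(2) fn_ap[OF s(1) that] by blast
    then obtain V v where V: "v \<epsilon> V" "ctb V" "sub V W" "\<forall>z. z \<epsilon> ap s n \<longleftrightarrow> (\<forall>B. B \<epsilon> V \<longrightarrow> z \<epsilon> B)"
      unfolding gdelta_def by blast
    obtain t where t: "fn t om V" "\<And>B. B \<epsilon> V \<Longrightarrow> \<exists>n. n \<epsilon> om \<and> ap t n = B"
      by (rule ctb_enum[OF V(2) V(1)], rule that, assumption+)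
    have "x \<epsilon> ap s n \<longleftrightarrow> (\<forall>k. k \<epsilon> om \<longrightarrow> x \<epsilon> ap t k)" for x
      using V(4) t(2) fn_ap[OF t(1)] by metis
    then have "t \<epsilon> F n" using fn_enlarge[OF t(1) V(3)] unfolding in_F by blast
    then show ?thesis by blast
  qed
  obtain h where h: "\<And>n. n \<epsilon> om \<Longrightarrow> fin (ap h n)" "\<And>n. n \<epsilon> om \<Longrightarrow> \<exists>x. x \<epsilon> ap h n"
    "\<And>n x. n \<epsilon> om \<Longrightarrow> x \<epsilon> ap h n \<Longrightarrow> x \<epsilon> F n"
    by (rule cmc_om[OF assms(1) T_F ne], assumption, rule that, assumption+)
  \<comment> \<open>The \<open>k\<close>-th terms of the finitely many chosen sequences are
    intersected. For fixed \<open>n\<close>, the intersection of the sets \<open>t n k\<close> over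
    all \<open>k\<close> is still \<open>ap s n\<close>.\<close>
  define t where "t n k = sep X (\<lambda>x. \<forall>f. f \<epsilon> ap h n \<longrightarrow> x \<epsilon> ap f k)" for n k
  have T_t: "T (\<lambda>e. t (e i) (e j))" for i j unfolding t_def by (intro dfn)
  have in_t: "x \<epsilon> t n k \<longleftrightarrow> x \<epsilon> X \<and> (\<forall>f. f \<epsilon> ap h n \<longrightarrow> x \<epsilon> ap f k)" for x n k
    unfolding t_def by (rule sep) (intro dfn)
  have t_W: "t n k \<epsilon> W" if "n \<epsilon> om" "k \<epsilon> om" for n k
    unfolding t_def
  proof (rule top_fin_inter[OF top])
    show "T (\<lambda>e. ap (e 0) k)" by (intro dfn)
    show "fin (ap h n)" using h(1) that by blast
    fix f assume "f \<epsilon> ap h n"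
    then have "fn f om W" using h(3) that in_F by blast
    then show "ap f k \<epsilon> W" using fn_ap that by blast
  qed
  define V where "V = sep W (\<lambda>Q. \<exists>n k. n \<epsilon> om \<and> k \<epsilon> om \<and> Q = t n k)"
  have in_V: "Q \<epsilon> V \<longleftrightarrow> Q \<epsilon> W \<and> (\<exists>n k. n \<epsilon> om \<and> k \<epsilon> om \<and> Q = t n k)" for Q
    unfolding V_def by (rule sep) (intro dfn T_t)
  have "ctb V"
  proof (rule ctb_pairI)
    show "D (\<lambda>e. e (Suc (Suc 0)) = t (e 0) (e (Suc 0)))" by (intro dfn T_t)
  qed (auto simp: in_V)
  moreover have "t emp emp \<epsilon> V" unfolding in_V using t_W zero_om by blast
  moreover have "sub V W" by (simp add: sub_def in_V)
  moreover have "x \<epsilon> Y \<longleftrightarrow> (\<forall>B. B \<epsilon> V \<longrightarrow> x \<epsilon> B)" for x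
  proof
    assume x: "x \<epsilon> Y"
    have x_f: "x \<epsilon> ap f k \<and> fn f om W" if "n \<epsilon> om" "k \<epsilon> om" "f \<epsilon> ap h n" for n k f
    proof -
      have "x \<epsilon> ap s n" using x Y fn_ap[OF s(1) that(1)] by blast
      then show ?thesis using h(3)[OF that(1,3)] that(2) unfolding in_F by blast
    qed
    show "\<forall>B. B \<epsilon> V \<longrightarrow> x \<epsilon> B"
    proof (intro HOL.allI HOL.impI)
      fix B assume "B \<epsilon> V"
      then obtain n k where n: "n \<epsilon> om" "k \<epsilon> om" "B = t n k" using in_V by blast
      obtain f where f: "f \<epsilon> ap h n" using h(2) n by blast
      have "x \<epsilon> X" using x_f[OF n(1,2) f] top_sub[OF top fn_ap[of f om W k]] n(2) by blast
      then show "x \<epsilon> B" using n x_f in_t by blast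
    qed
  next
    assume x: "\<forall>B. B \<epsilon> V \<longrightarrow> x \<epsilon> B"
    have "x \<epsilon> ap s n" if n: "n \<epsilon> om" for n
    proof -
      obtain f where f: "f \<epsilon> ap h n" using h(2) n by blast
      have "x \<epsilon> ap f k" if "k \<epsilon> om" for k
        using x in_V t_W[OF n that] n that in_t f by blast
      then show ?thesis using h(3)[OF n f] unfolding in_F by blast
    qed
    then show "x \<epsilon> Y" using Y s(2) by metis
  qed
  ultimately show "gdelta W Y" unfolding gdelta_def by blast
qed

end

section \<open>Continuous functions and countable intersections of zero-sets\<close>

context model_reals
begin

text \<open>\<open>inn v r\<close> expresses |r| < v and, for nonnegative v, \<open>out v r\<close>
  expresses |r| > v; absolute values need not be defined.\<close>

definition inn :: "'a \<Rightarrow> 'a \<Rightarrow> bool" where "inn v r \<longleftrightarrow> ls (ng v) r \<and> ls r v"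
definition out :: "'a \<Rightarrow> 'a \<Rightarrow> bool" where "out v r \<longleftrightarrow> ls r (ng v) \<or> ls v r"

lemma D_inn [dfn]: "T s \<Longrightarrow> T t \<Longrightarrow> D (\<lambda>e. inn (s e) (t e))"
  by (rule D2[of inn], unfold inn_def, intro dfn)

lemma D_out [dfn]: "T s \<Longrightarrow> T t \<Longrightarrow> D (\<lambda>e. out (s e) (t e))"
  by (rule D2[of out], unfold out_def, intro dfn)

lemma opr_iff: "opr R L V \<longleftrightarrow> sub V R \<and> (\<forall>x. x \<epsilon> V \<longrightarrow>
     (\<exists>a b. ls a x \<and> ls x b \<and> (\<forall>y. ls a y \<and> ls y b \<longrightarrow> y \<epsilon> V)))"
  unfolding opr_def ls_def le_def by blast

lemma preimage_open:
  assumes f: "cont R L X W f" and P: "D (\<lambda>e. P (e 0))"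
    and nb: "\<And>r. r \<epsilon> R \<Longrightarrow> P r \<Longrightarrow> \<exists>a b. ls a r \<and> ls r b \<and> (\<forall>y. ls a y \<and> ls y b \<longrightarrow> P y)"
  shows "sep X (\<lambda>x. P (ap f x)) \<epsilon> W"
proof -
  have P_i: "D (\<lambda>e. P (t e))" if "T t" for t by (rule D1[where R = P]) fact+
  have s: "r \<epsilon> sep R P \<longleftrightarrow> r \<epsilon> R \<and> P r" for r using P by (rule sep)
  have fn: "fn f X R" using f by (simp add: cont_def)
  have t: "x \<epsilon> sep X (\<lambda>x. P (ap f x)) \<longleftrightarrow> x \<epsilon> X \<and> P (ap f x)" for x
    by (rule sep) (intro dfn P_i)
  have "opr R L (sep R P)"
    unfolding opr_iff s using nb ls_in by (auto simp: sub_def s) blast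
  moreover have "x \<epsilon> sep X (\<lambda>x. P (ap f x)) \<longleftrightarrow> (\<exists>y. y \<epsilon> sep R P \<and> pair x y \<epsilon> f)" for x
    unfolding s t fn_pair[OF fn] using fn_ap[OF fn] by blast
  ultimately show ?thesis using f unfolding cont_def by blast
qed

lemma out_open: "cont R L X W f \<Longrightarrow> v \<epsilon> R \<Longrightarrow> sep X (\<lambda>x. out v (ap f x)) \<epsilon> W"
proof (rule preimage_open)
  show "D (\<lambda>e. out v (e 0))" by (intro dfn)
  show "\<exists>a b. ls a r \<and> ls r b \<and> (\<forall>y. ls a y \<and> ls y b \<longrightarrow> out v y)" if "out v r" "r \<epsilon> R" for r
    using that no_max[of r] no_min[of r] unfolding out_def by blast
qed

lemma inn_open: "cont R L X W f \<Longrightarrow> sep X (\<lambda>x. inn v (ap f x)) \<epsilon> W"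
proof (rule preimage_open)
  show "D (\<lambda>e. inn v (e 0))" by (intro dfn)
  show "\<exists>a b. ls a r \<and> ls r b \<and> (\<forall>y. ls a y \<and> ls y b \<longrightarrow> inn v y)" if "inn v r" for r
    using that unfolding inn_def by blast
qed

text \<open>Take for \<open>w\<close> the smaller of \<open>v\<close> and whichever of
  \<open>r\<close> and \<open>ng r\<close> exceeds \<open>a\<close>.\<close>

lemma out_not_inn:
  assumes "out a r" "ls a v" "r \<epsilon> R"
  shows "\<exists>w. ls a w \<and> le w v \<and> \<not> inn w r"
proof -
  have v: "v \<epsilon> R" "a \<epsilon> R" using assms(2) ls_in by auto
  have *: "\<exists>w. ls a w \<and> le w v \<and> le w q" if "ls a q" for q
    using that assms(2) le_total[of q v] le_refl ls_in v by blast
  consider "ls a r" | "ls a (ng r)" using assms(1) ng_strict ng_ng v unfolding out_def by metis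
  then show ?thesis
  proof cases
    case 1
    then obtain w where "ls a w" "le w v" "le w r" using * by blast
    then show ?thesis using ls_le_trans ls_irrefl unfolding inn_def by blast
  next
    case 2
    then obtain w where w: "ls a w" "le w v" "le w (ng r)" using * by blast
    then have "le r (ng w)" using ng_mono ng_ng[OF assms(3)] by metis
    then show ?thesis using w ls_le_trans ls_irrefl unfolding inn_def by blast
  qed
qed

lemma inn_mono: "inn v r \<Longrightarrow> le v w \<Longrightarrow> inn w r"
  using ng_mono le_ls_trans ls_le_trans unfolding inn_def by blast

lemma inn_z: "inn v z \<longleftrightarrow> ls z v"
proof -
  have "ls (ng v) z" if "ls z v" using ng_strict[OF that] ng_z by simp
  then show ?thesis unfolding inn_def by blast
qed

lemma out_z: "r \<epsilon> R \<Longrightarrow> out z r \<longleftrightarrow> r \<noteq> z"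
  using le_total[of r z] unfolding out_def ng_z by (auto simp: ls_def)

text \<open>
  The finitely many functions chosen for the \<open>n\<close>-th zero-set are merged into
  \<open>g(x) = sup\<^sub>n min(max\<^sub>f |f(x)|, c\<^sub>n)\<close> with a null sequence \<open>c\<^sub>n\<close>, so that no series are needed.
\<close>

theorem zset_stable:
  assumes cmc and top: "top X W"
  shows "stab (zset R z L X W)"
  unfolding stab_def
proof (intro HOL.allI HOL.impI, elim conjE)
  fix U Y
  assume "\<exists>z. z \<epsilon> U" and U: "ctb U" "\<forall>B. B \<epsilon> U \<longrightarrow> zset R z L X W B"
    and Y: "\<forall>x. x \<epsilon> Y \<longleftrightarrow> (\<forall>B. B \<epsilon> U \<longrightarrow> x \<epsilon> B)"
  then obtain u0 where u0: "u0 \<epsilon> U" by blast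
  obtain s where s: "fn s om U" "\<And>B. B \<epsilon> U \<Longrightarrow> \<exists>n. n \<epsilon> om \<and> ap s n = B"
    by (rule ctb_enum[OF U(1) u0], rule that, assumption+)
  define F where "F n = sep (Pw (prd X R)) (\<lambda>f. cont R L X W f \<and> (\<forall>x. x \<epsilon> ap s n \<longleftrightarrow> pair x z \<epsilon> f))" for n
  have D_cont: "D (\<lambda>e. cont R L X W (e i))" for i unfolding cont_def opr_iff by (intro dfn)
  have T_F: "T (\<lambda>e. F (e 0))" unfolding F_def by (intro dfn D_cont)
  have "f \<epsilon> F n \<longleftrightarrow> f \<epsilon> Pw (prd X R) \<and> cont R L X W f \<and> (\<forall>x. x \<epsilon> ap s n \<longleftrightarrow> pair x z \<epsilon> f)" for f n
    unfolding F_def by (rule sep) (intro dfn D_cont)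
  moreover have "f \<epsilon> Pw (prd X R)" if "cont R L X W f" for f using that fn_in_Pw by (simp add: cont_def)
  ultimately have in_F: "f \<epsilon> F n \<longleftrightarrow> cont R L X W f \<and> (\<forall>x. x \<epsilon> ap s n \<longleftrightarrow> pair x z \<epsilon> f)" for f n
    by blast
  have ne: "\<exists>f. f \<epsilon> F n" if "n \<epsilon> om" for n
    using U(2) fn_ap[OF s(1) that] unfolding zset_def in_F by blast
  obtain h where h: "\<And>n. n \<epsilon> om \<Longrightarrow> fin (ap h n)" "\<And>n. n \<epsilon> om \<Longrightarrow> \<exists>x. x \<epsilon> ap h n"
    "\<And>n x. n \<epsilon> om \<Longrightarrow> x \<epsilon> ap h n \<Longrightarrow> x \<epsilon> F n"
    by (rule cmc_om[OF assms(1) T_F ne], assumption, rule that, assumption+)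
  have cont: "cont R L X W f" if "n \<epsilon> om" "f \<epsilon> ap h n" for n f using h(3)[OF that] in_F by blast
  then have fn: "fn f X R" if "n \<epsilon> om" "f \<epsilon> ap h n" for n f using that unfolding cont_def by blast
  have f_in: "ap f x \<epsilon> R" if "n \<epsilon> om" "f \<epsilon> ap h n" "x \<epsilon> X" for n f x using fn_ap[OF fn] that by blast
  \<comment> \<open>Besides zero, \<open>S x\<close> contains the positive \<open>v\<close> with
    \<open>v\<close> at most |f(x)| and at most \<open>sq n\<close> for some \<open>n\<close> and
    some chosen \<open>f\<close>. Its supremum \<open>g x\<close> is thus the function announced
    above, without forming maxima. Zero is included to make \<open>S x\<close> nonempty.\<close>
  define S where "S x v \<longleftrightarrow> v \<epsilon> R \<and>
    (v = z \<or> ls z v \<and> (\<exists>n f. n \<epsilon> om \<and> f \<epsilon> ap h n \<and> \<not> inn v (ap f x) \<and> le v (sq n)))" for x v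
  have D_S: "D (\<lambda>e. S (t e) (t' e))" if "T t" "T t'" for t t'
    by (rule D2[of S]) (use that in \<open>unfold S_def, intro dfn\<close>)
  have S_z: "S x z" for x unfolding S_def by simp
  have S_le: "le v (sq emp)" if "S x v" for x v
  proof -
    have "le (sq n) (sq emp)" if "n \<epsilon> om" for n
      using om_cases[OF that] emp_in_suc sq_mono[OF that, of emp] le_refl ls_le by auto
    then show ?thesis using that sq_pos[OF zero_om] le_trans ls_le unfolding S_def by blast
  qed
  define g where "g x = pick R (\<lambda>t. (\<forall>y. y \<epsilon> R \<and> S x y \<longrightarrow> le y t) \<and>
    (\<forall>b. b \<epsilon> R \<and> (\<forall>y. y \<epsilon> R \<and> S x y \<longrightarrow> le y b) \<longrightarrow> le t b))" for x
  have T_g: "T (\<lambda>e. g (e 0))" unfolding g_def by (intro dfn D_S)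
  have "g x \<epsilon> R \<and> (\<forall>y. y \<epsilon> R \<and> S x y \<longrightarrow> le y (g x)) \<and>
    (\<forall>b. b \<epsilon> R \<and> (\<forall>y. y \<epsilon> R \<and> S x y \<longrightarrow> le y b) \<longrightarrow> le (g x) b)" for x
  proof -
    have "D (\<lambda>e. S x (e 0))" by (intro D_S dfn)
    from sup_ex[of "S x", OF this z_in S_z sq_in[OF zero_om] S_le]
    obtain t where t: "t \<epsilon> R \<and> (\<forall>y. y \<epsilon> R \<and> S x y \<longrightarrow> le y t) \<and>
      (\<forall>b. b \<epsilon> R \<and> (\<forall>y. y \<epsilon> R \<and> S x y \<longrightarrow> le y b) \<longrightarrow> le t b)" by (rule exE)
    have "g x = t" unfolding g_def
    proof (rule pick, intro dfn D_S)
      show "t \<epsilon> R" using t by (rule conjunct1)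
      show t': "(\<forall>y. y \<epsilon> R \<and> S x y \<longrightarrow> le y t) \<and>
        (\<forall>b. b \<epsilon> R \<and> (\<forall>y. y \<epsilon> R \<and> S x y \<longrightarrow> le y b) \<longrightarrow> le t b)" using t by (rule conjunct2)
      fix t' assume "t' \<epsilon> R" "(\<forall>y. y \<epsilon> R \<and> S x y \<longrightarrow> le y t') \<and>
        (\<forall>b. b \<epsilon> R \<and> (\<forall>y. y \<epsilon> R \<and> S x y \<longrightarrow> le y b) \<longrightarrow> le t' b)"
      then have "le t t'" "le t' t" using t by blast+
      then show "t' = t" using le_antisym by blast
    qed
    then show ?thesis using t by simp
  qed
  note g = this
  have S_R: "y \<epsilon> R" if "S x y" for x y using that unfolding S_def by (rule conjunct1)
  have g_in: "g x \<epsilon> R" for x using g by (rule conjunct1)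
  have g_ub: "le y (g x)" if "S x y" for x y using g[of x] S_R[OF that] that by blast
  have g_lub: "le (g x) b" if "b \<epsilon> R" "\<And>y. S x y \<Longrightarrow> le y b" for x b using g[of x] that by blast
  have g_z: "le z (g x)" for x using g_ub[OF S_z] .
  have lower: "\<exists>Q. Q \<epsilon> W \<and> x \<epsilon> Q \<and> (\<forall>y. y \<epsilon> Q \<longrightarrow> ls a (g y))" if x: "x \<epsilon> X" and a: "ls a (g x)" for x a
  proof (cases "ls a z")
    case True
    then have "ls a (g y)" for y using g_z ls_le_trans by blast
    then show ?thesis using top_X[OF top] x by blast
  next
    case False
    then have za: "le z a" using a ls_in not_ls z_in by blast
    have "\<exists>v. S x v \<and> \<not> le v a"
      using g_lub[of a x] a ls_in ls_le_trans ls_irrefl by blast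
    then obtain v where v: "S x v" "ls a v" using not_le a ls_in unfolding S_def by blast
    then have "v \<noteq> z" using za ls_le_trans ls_irrefl by blast
    then obtain n f where n: "n \<epsilon> om" "f \<epsilon> ap h n" "\<not> inn v (ap f x)" "le v (sq n)"
      using v(1) unfolding S_def by blast
    let ?Q = "sep X (\<lambda>y. out a (ap f y))"
    have in_O: "y \<epsilon> ?Q \<longleftrightarrow> y \<epsilon> X \<and> out a (ap f y)" for y by (rule sep) (intro dfn)
    have "?Q \<epsilon> W" using out_open cont[OF n(1,2)] a ls_in by blast
    moreover have "x \<epsilon> ?Q"
    proof -
      have fx: "ap f x \<epsilon> R" "v \<epsilon> R" using f_in[OF n(1,2) x] v(2) ls_in by auto
      then have "le (ap f x) (ng v) \<or> le v (ap f x)" using n(3) not_ls unfolding inn_def by auto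
      then have "out a (ap f x)"
        using v(2) ng_strict[OF v(2)] ls_le_trans le_ls_trans unfolding out_def by blast
      then show ?thesis using x in_O by blast
    qed
    moreover have "ls a (g y)" if "y \<epsilon> ?Q" for y
    proof -
      have y: "y \<epsilon> X" "out a (ap f y)" using that in_O by auto
      \<comment> \<open>The value \<open>v\<close> found at \<open>x\<close> may be too large for
        \<open>S y\<close>. Cutting it down to |f(y)| gives a member of \<open>S y\<close> that
        still exceeds \<open>a\<close>.\<close>
      obtain w where w: "ls a w" "le w v" "\<not> inn w (ap f y)"
        using out_not_inn[OF y(2) v(2) f_in[OF n(1,2) y(1)]] by blast
      have "le w (sq n)" "ls z w" using w(1,2) n(4) za le_trans le_ls_trans by blast+
      then have "S y w" unfolding S_def using w n ls_in by blast
      then show ?thesis using g_ub w(1) ls_le_trans by blast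
    qed
    ultimately show ?thesis by blast
  qed
  have upper: "\<exists>Q. Q \<epsilon> W \<and> x \<epsilon> Q \<and> (\<forall>y. y \<epsilon> Q \<longrightarrow> ls (g y) b)" if x: "x \<epsilon> X" and b: "ls (g x) b" for x b
  proof -
    \<comment> \<open>A supremum of values at most \<open>b'\<close> is only known to be at most
      \<open>b'\<close>; the gap to \<open>b\<close> restores strictness.\<close>
    obtain b' where b': "ls (g x) b'" "ls b' b" using dense[OF b] by blast
    have zb: "ls z b'" using g_z le_ls_trans b' by blast
    have b'R: "b' \<epsilon> R" using b' ls_in by blast
    \<comment> \<open>From \<open>N\<close> on the bounds \<open>sq n\<close> are below
      \<open>b'\<close>, so only finitely many indices restrict the neighbourhood.\<close>
    obtain N where N: "N \<epsilon> om" "ls (sq N) b'" using sq_lim[OF zb] by blast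
    define G where "G n = (if le b' (sq n) then
      sep X (\<lambda>y. \<forall>f. f \<epsilon> ap h n \<longrightarrow> y \<epsilon> sep X (\<lambda>x. inn b' (ap f x))) else X)" for n
    have T_G: "T (\<lambda>e. G (e i))" for i unfolding G_def by (intro dfn)
    have "y \<epsilon> sep X (\<lambda>x. inn b' (ap f x)) \<longleftrightarrow> y \<epsilon> X \<and> inn b' (ap f y)" for y f
      by (rule sep) (intro dfn)
    moreover have "y \<epsilon> sep X (\<lambda>y. \<forall>f. f \<epsilon> ap h n \<longrightarrow> y \<epsilon> sep X (\<lambda>x. inn b' (ap f x))) \<longleftrightarrow> y \<epsilon> X \<and>
        (\<forall>f. f \<epsilon> ap h n \<longrightarrow> y \<epsilon> sep X (\<lambda>x. inn b' (ap f x)))" for y n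
      by (rule sep) (intro dfn)
    ultimately have in_G: "y \<epsilon> G n \<longleftrightarrow> y \<epsilon> X \<and> (le b' (sq n) \<longrightarrow> (\<forall>f. f \<epsilon> ap h n \<longrightarrow> inn b' (ap f y)))" for y n
      unfolding G_def by auto
    have "G n \<epsilon> W" if "n \<epsilon> N" for n
    proof -
      have n: "n \<epsilon> om" using that N om_trans by blast
      have "sep X (\<lambda>y. \<forall>f. f \<epsilon> ap h n \<longrightarrow> y \<epsilon> sep X (\<lambda>x. inn b' (ap f x))) \<epsilon> W"
      proof (rule top_fin_inter[OF top])
        show "T (\<lambda>e. sep X (\<lambda>x. inn b' (ap (e 0) x)))" by (intro dfn)
      qed (use h(1)[OF n] inn_open cont[OF n] in auto)
      then show ?thesis unfolding G_def using top_X[OF top] by simp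
    qed
    then have O_W: "sep X (\<lambda>y. \<forall>n. n \<epsilon> N \<longrightarrow> y \<epsilon> G n) \<epsilon> W" (is "?Q \<epsilon> W")
      using top_fin_inter[OF top T_G fin_nat[OF N(1)]] by blast
    have in_O: "y \<epsilon> ?Q \<longleftrightarrow> y \<epsilon> X \<and> (\<forall>n. n \<epsilon> N \<longrightarrow> y \<epsilon> G n)" for y
      by (rule sep) (intro dfn T_G)
    have x_G: "\<forall>n. n \<epsilon> N \<longrightarrow> x \<epsilon> G n"
      unfolding in_G
    proof (intro conjI HOL.allI HOL.impI x)
      fix n f assume n: "n \<epsilon> N" "le b' (sq n)" "f \<epsilon> ap h n"
      show "inn b' (ap f x)"
      proof (rule ccontr)
        assume "\<not> inn b' (ap f x)"
        then have "S x b'" unfolding S_def using n b'R zb om_trans[OF N(1) n(1)] by blast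
        then show False using g_ub b'(1) ls_le_trans ls_irrefl by blast
      qed
    qed
    have "x \<epsilon> ?Q" using x_G x in_O by blast
    moreover have "ls (g y) b" if "y \<epsilon> ?Q" for y
    proof -
      have "le (g y) b'"
      proof (rule g_lub[OF b'R])
        fix v assume v: "S y v"
        show "le v b'"
        proof (cases "v = z")
          case True then show ?thesis using zb ls_le by blast
        next
          case False
          then obtain n f where n: "n \<epsilon> om" "f \<epsilon> ap h n" "\<not> inn v (ap f y)" "le v (sq n)"
            using v unfolding S_def by blast
          show ?thesis
          proof (cases "le b' (sq n)")
            case True
            have "n \<epsilon> N"
            proof (rule ccontr)
              assume "\<not> n \<epsilon> N"
              then have "n = N \<or> N \<epsilon> n" using nat_linear n(1) N(1) by blast
              then have "le (sq n) (sq N)" using sq_mono[OF n(1)] ls_le le_refl[OF sq_in[OF N(1)]] by blast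
              then show False using True N(2) le_trans le_ls_trans ls_irrefl by blast
            qed
            then have "y \<epsilon> G n" using that in_O by blast
            then have "inn b' (ap f y)" using True n(2) in_G by blast
            then have "\<not> le b' v" using n(3) inn_mono by blast
            then show ?thesis using not_le b'R v ls_le unfolding S_def by blast
          next
            case False
            then have "ls (sq n) b'" using not_le b'R n(1) by simp
            then show ?thesis using n(4) le_trans ls_le by blast
          qed
        qed
      qed
      then show ?thesis using b'(2) le_ls_trans by blast
    qed
    ultimately show ?thesis using O_W by blast
  qed
  have fn_g: "fn (lam X g) X R" using T_g g_in by (rule fn_lam)
  have g_iff: "pair x r \<epsilon> lam X g \<longleftrightarrow> x \<epsilon> X \<and> r = g x" for x r
    by (auto simp: in_lam[OF T_g])
  have "cont R L X W (lam X g)"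
    unfolding cont_def
  proof (intro conjI HOL.allI HOL.impI fn_g, elim conjE)
    fix V P assume V: "opr R L V" and P: "\<forall>x. x \<epsilon> P \<longleftrightarrow> (\<exists>y. y \<epsilon> V \<and> pair x y \<epsilon> lam X g)"
    show "P \<epsilon> W"
    proof (rule top_local[OF top])
      fix x assume "x \<epsilon> P"
      then have x: "x \<epsilon> X" "g x \<epsilon> V" using P g_iff by auto
      then obtain a b where ab: "ls a (g x)" "ls (g x) b" "\<forall>y. ls a y \<and> ls y b \<longrightarrow> y \<epsilon> V"
        using V unfolding opr_iff by blast
      obtain O1 where O1: "O1 \<epsilon> W" "x \<epsilon> O1" "\<forall>y. y \<epsilon> O1 \<longrightarrow> ls a (g y)" using lower[OF x(1) ab(1)] by blast
      obtain O2 where O2: "O2 \<epsilon> W" "x \<epsilon> O2" "\<forall>y. y \<epsilon> O2 \<longrightarrow> ls (g y) b" using upper[OF x(1) ab(2)] by blast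
      have Q: "y \<epsilon> sep O1 (\<lambda>y. y \<epsilon> O2) \<longleftrightarrow> y \<epsilon> O1 \<and> y \<epsilon> O2" for y by (rule sep) (intro dfn)
      have "sep O1 (\<lambda>y. y \<epsilon> O2) \<epsilon> W" by (rule top_inter[OF top O1(1) O2(1) Q])
      moreover have "sub (sep O1 (\<lambda>y. y \<epsilon> O2)) P"
        unfolding sub_def Q using P g_iff O1 O2 ab(3) top_sub[OF top O1(1)] by blast
      ultimately show "\<exists>Q. Q \<epsilon> W \<and> x \<epsilon> Q \<and> sub Q P" using Q O1 O2 by blast
    qed
  qed
  moreover have "x \<epsilon> Y \<longleftrightarrow> pair x z \<epsilon> lam X g" for x
  proof -
    have s_iff: "x \<epsilon> ap s n \<longleftrightarrow> x \<epsilon> X \<and> z = ap f x" if "n \<epsilon> om" "f \<epsilon> ap h n" for n f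
      using h(3)[OF that] fn_pair[OF fn[OF that]] unfolding in_F by blast
    have "x \<epsilon> Y \<longleftrightarrow> (\<forall>n. n \<epsilon> om \<longrightarrow> x \<epsilon> ap s n)" using Y s(2) fn_ap[OF s(1)] by metis
    also have "\<dots> \<longleftrightarrow> x \<epsilon> X \<and> (\<forall>n f. n \<epsilon> om \<and> f \<epsilon> ap h n \<longrightarrow> ap f x = z)"
      using s_iff h(2) zero_om by metis
    also have "\<dots> \<longleftrightarrow> x \<epsilon> X \<and> z = g x"
    proof (intro conj_cong iffI HOL.allI HOL.impI)
      assume all: "\<forall>n f. n \<epsilon> om \<and> f \<epsilon> ap h n \<longrightarrow> ap f x = z"
      have "le (g x) z"
      proof (rule g_lub[OF z_in])
        fix v assume v: "S x v"
        have "v = z"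
          using v all inn_z unfolding S_def by metis
        then show "le v z" using le_refl by simp
      qed
      then show "z = g x" using g_z le_antisym by blast
    next
      fix n f assume x: "x \<epsilon> X" and gz: "z = g x" and n: "n \<epsilon> om \<and> f \<epsilon> ap h n"
      show "ap f x = z"
      proof (rule ccontr)
        have fx: "ap f x \<epsilon> R" using f_in n x by blast
        assume "ap f x \<noteq> z"
        then obtain w where w: "ls z w" "le w (sq n)" "\<not> inn w (ap f x)"
          using out_not_inn[of z "ap f x" "sq n"] out_z[OF fx] fx sq_pos n by blast
        then have "S x w" unfolding S_def using n ls_in by blast
        then show False using g_ub w(1) gz ls_le_trans ls_irrefl by metis
      qed
    qed simp
    finally show ?thesis unfolding g_iff .
  qed
  ultimately show "zset R z L X W Y" unfolding zset_def by blast
qed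

end


section \<open>From stability to unions of countable families\<close>

context model_reals
begin

text \<open>The zero-set of \<open>f\<close> is the intersection of the open sets where |f| is less
  than \<open>sq n\<close>.\<close>

lemma zset_gdelta:
  assumes top: "top X W" and "zset R z L X W Y"
  shows "gdelta W Y"
proof -
  obtain f where f: "cont R L X W f" "\<And>x. x \<epsilon> Y \<longleftrightarrow> pair x z \<epsilon> f" using assms(2) unfolding zset_def by blast
  then have fn: "fn f X R" unfolding cont_def by blast
  define G where "G n = sep X (\<lambda>x. inn (sq n) (ap f x))" for n
  have T_G: "T (\<lambda>e. G (e 0))" unfolding G_def by (intro dfn)
  have in_G: "x \<epsilon> G n \<longleftrightarrow> x \<epsilon> X \<and> inn (sq n) (ap f x)" for x n
    unfolding G_def by (rule sep) (intro dfn)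
  have r: "B \<epsilon> repl om G \<longleftrightarrow> (\<exists>n. n \<epsilon> om \<and> B = G n)" for B using T_G by (rule repl)
  have "ctb (repl om G)" using ctb_om T_G by (rule ctb_repl)
  moreover have "G emp \<epsilon> repl om G" unfolding r using zero_om by blast
  moreover have "sub (repl om G) W"
    unfolding sub_def r using inn_open[OF f(1)] unfolding G_def by blast
  moreover have "x \<epsilon> Y \<longleftrightarrow> (\<forall>B. B \<epsilon> repl om G \<longrightarrow> x \<epsilon> B)" for x
  proof -
    have "ap f x = z" if x: "x \<epsilon> X" and i: "\<And>n. n \<epsilon> om \<Longrightarrow> inn (sq n) (ap f x)"
    proof (rule ccontr)
      assume "ap f x \<noteq> z"
      then have "ls z (ap f x) \<or> ls (ap f x) z"
        using fn_ap[OF fn x] le_total[of z "ap f x"] unfolding ls_def by auto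
      then show False
      proof
        assume "ls z (ap f x)"
        then obtain n where "n \<epsilon> om" "ls (sq n) (ap f x)" using sq_lim by blast
        then show False using i ls_trans ls_irrefl unfolding inn_def by blast
      next
        assume "ls (ap f x) z"
        then have "ls z (ng (ap f x))" using ng_strict[of "ap f x" z] ng_z by simp
        then obtain n where n: "n \<epsilon> om" "ls (sq n) (ng (ap f x))" using sq_lim by blast
        then have "ls (ap f x) (ng (sq n))" using ng_strict[OF n(2)] ng_ng[OF fn_ap[OF fn x]] by simp
        then show False using i[OF n(1)] ls_trans ls_irrefl unfolding inn_def by blast
      qed
    qed
    moreover have "inn (sq n) z" if "n \<epsilon> om" for n using inn_z sq_pos that by blast
    ultimately have "x \<epsilon> X \<and> z = ap f x \<longleftrightarrow> (\<forall>n. n \<epsilon> om \<longrightarrow> x \<epsilon> G n)"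
      unfolding in_G using zero_om by metis
    then show ?thesis unfolding f(2) fn_pair[OF fn] r by blast
  qed
  ultimately show ?thesis unfolding gdelta_def by blast
qed

text \<open>The function with value 0 on \<open>U\<close> and 1 outside is continuous.\<close>

lemma zset_clopen:
  assumes top: "top X W" and U: "U \<epsilon> W" "diff X U \<epsilon> W"
  shows "zset R z L X W U"
proof -
  define F where "F x = (if x \<epsilon> U then z else u)" for x
  have T_F: "T (\<lambda>e. F (e 0))" unfolding F_def by (intro dfn)
  have fn: "fn (lam X F) X R" using T_F by (rule fn_lam) (simp add: F_def)
  have F_iff: "pair x r \<epsilon> lam X F \<longleftrightarrow> x \<epsilon> X \<and> r = F x" for x r by (auto simp: in_lam[OF T_F])
  have UX: "x \<epsilon> X" if "x \<epsilon> U" for x using top_sub[OF top U(1) that] .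
  have emp: "emp \<epsilon> W" by (rule top_local[OF top]) simp
  have "cont R L X W (lam X F)"
    unfolding cont_def
  proof (intro conjI fn HOL.allI HOL.impI, elim conjE)
    fix V P assume P: "\<forall>x. x \<epsilon> P \<longleftrightarrow> (\<exists>y. y \<epsilon> V \<and> pair x y \<epsilon> lam X F)"
    then have P: "x \<epsilon> P \<longleftrightarrow> x \<epsilon> X \<and> F x \<epsilon> V" for x unfolding F_iff by blast
    \<comment> \<open>Which of the two values belong to \<open>V\<close> determines the preimage,
      leaving four cases.\<close>
    have "P = (if z \<epsilon> V then if u \<epsilon> V then X else U else if u \<epsilon> V then diff X U else emp)"
      by (rule ext) (use UX P in \<open>auto simp: F_def\<close>)
    then show "P \<epsilon> W" using emp U top_X[OF top] by presburger
  qed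
  moreover have "x \<epsilon> U \<longleftrightarrow> pair x z \<epsilon> lam X F" for x
    unfolding F_iff using UX z_u by (auto simp: F_def)
  ultimately show ?thesis unfolding zset_def by blast
qed

lemma cozero_open:
  assumes top: "top X W" and "zset R z L X W Y"
  shows "diff X Y \<epsilon> W"
proof -
  obtain f where f: "cont R L X W f" "\<And>x. x \<epsilon> Y \<longleftrightarrow> pair x z \<epsilon> f" using assms(2) unfolding zset_def by blast
  then have fn: "fn f X R" unfolding cont_def by blast
  have "sep X (\<lambda>x. out z (ap f x)) \<epsilon> W" by (rule out_open[OF f(1) z_in])
  moreover have s: "x \<epsilon> sep X (\<lambda>x. out z (ap f x)) \<longleftrightarrow> x \<epsilon> X \<and> out z (ap f x)" for x
    by (rule sep) (intro dfn)
  have "sep X (\<lambda>x. out z (ap f x)) = diff X Y"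
    by (rule ext) (use out_z fn_ap[OF fn] in \<open>auto simp: s f(2) fn_pair[OF fn]\<close>)
  ultimately show ?thesis by simp
qed

text \<open>A clopen set is the complement of a clopen set, and the latter is a zero-set.\<close>

lemma clopen_base_creg:
  assumes top: "top X W"
    and base: "\<And>U x. U \<epsilon> W \<Longrightarrow> x \<epsilon> U \<Longrightarrow> \<exists>V. V \<epsilon> W \<and> diff X V \<epsilon> W \<and> x \<epsilon> V \<and> sub V U"
  shows "creg R z L X W"
  unfolding creg_def
proof (intro conjI HOL.allI HOL.impI top)
  fix U assume "\<exists>Z. zset R z L X W Z \<and> U = diff X Z"
  then show "U \<epsilon> W" using cozero_open[OF top] by blast
next
  fix U x assume "U \<epsilon> W \<and> x \<epsilon> U"
  then obtain V where V: "V \<epsilon> W" "diff X V \<epsilon> W" "x \<epsilon> V" "sub V U" using base by blast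
  have eq: "diff X (diff X V) = V" by (rule ext) (use top_sub[OF top V(1)] in auto)
  then have "zset R z L X W (diff X V)" using zset_clopen[OF top V(2)] V(1) by simp
  then show "\<exists>V. (\<exists>Z. zset R z L X W Z \<and> V = diff X Z) \<and> x \<epsilon> V \<and> sub V U"
    using eq V by metis
qed

text \<open>
  The space is \<open>X\<close> with one more point, again named \<open>X\<close>.  The points of \<open>X\<close> are isolated and the
  neighbourhoods of the new one are the complements of members of the ideal \<open>P\<close>; hence the new
  point is a \<open>G\<^sub>\<delta>\<close> iff \<open>X\<close> is a countable union of members of \<open>P\<close>.
\<close>

theorem union_of_stable:
  assumes P: "D (\<lambda>e. P (e 0))" "P emp" "\<And>x. P (upr x x)" "\<And>B C. P B \<Longrightarrow> P C \<Longrightarrow> P (cup B C)"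
      "\<And>B C. P B \<Longrightarrow> sub C B \<Longrightarrow> P C"
    and stable: "\<And>X W. creg R z L X W \<Longrightarrow> t1 X W \<Longrightarrow>
      \<exists>K. stab K \<and> (\<forall>U. U \<epsilon> W \<and> diff X U \<epsilon> W \<longrightarrow> K U) \<and> (\<forall>U. K U \<longrightarrow> gdelta W U)"
  shows "ut (cu P)"
  unfolding ut_def
proof (intro HOL.allI HOL.impI, elim conjE)
  fix F assume F: "ctb F" "\<forall>B. B \<epsilon> F \<longrightarrow> cu P B"
  have P_t: "D (\<lambda>e. P (t e))" if "T t" for t by (rule D1[where R = P]) fact+
  define X where "X = uni F"
  \<comment> \<open>By foundation \<open>X\<close> is not a member of itself, so \<open>X\<close>
    can serve as the added point.\<close>
  define Y where "Y = suc X"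
  define W where "W = sep (Pw Y) (\<lambda>U. X \<epsilon> U \<longrightarrow> P (diff X U))"
  have "U \<epsilon> W \<longleftrightarrow> U \<epsilon> Pw Y \<and> (X \<epsilon> U \<longrightarrow> P (diff X U))" for U
    unfolding W_def by (rule sep) (intro dfn P_t)
  then have in_W: "U \<epsilon> W \<longleftrightarrow> sub U Y \<and> (X \<epsilon> U \<longrightarrow> P (diff X U))" for U by simp
  have X [simp]: "\<not> X \<epsilon> X" by (rule not_mem_self)
  have in_Y [simp]: "x \<epsilon> Y \<longleftrightarrow> x \<epsilon> X \<or> x = X" for x by (simp add: Y_def)
  have small: "B \<epsilon> W" if "sub B X" for B
    using that X unfolding in_W by (metis in_Y sub_def)
  have big: "diff Y B \<epsilon> W" if "sub B X" "P B" for B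
  proof -
    have "diff X (diff Y B) = B" by (rule ext) (use that in \<open>auto simp: sub_def\<close>)
    then show ?thesis using that by (simp add: in_W sub_def)
  qed
  have compl: "diff Y (diff Y B) = B" if "sub B Y" for B
    by (rule ext) (use that in \<open>auto simp: sub_def\<close>)
  have Y_W: "Y \<epsilon> W"
  proof -
    have "diff X Y = emp" by (rule ext) auto
    then show ?thesis using P(2) by (simp add: in_W sub_def)
  qed
  have top: "top Y W"
    unfolding top_def
  proof (intro conjI HOL.allI HOL.impI Y_W)
    show "sub U Y" if "U \<epsilon> W" for U using that in_W by blast
  next
    fix U V Q assume *: "U \<epsilon> W \<and> V \<epsilon> W \<and> (\<forall>x. x \<epsilon> Q \<longleftrightarrow> x \<epsilon> U \<and> x \<epsilon> V)"
    then have "diff X Q = cup (diff X U) (diff X V)" by (intro ext) auto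
    then show "Q \<epsilon> W" using * P(4) unfolding in_W sub_def by auto
  next
    fix S assume S: "sub S W"
    have "P (diff X (uni S))" if "X \<epsilon> uni S"
    proof -
      obtain U where U: "U \<epsilon> S" "X \<epsilon> U" using \<open>X \<epsilon> uni S\<close> by auto
      then have "P (diff X U)" using S in_W unfolding sub_def by blast
      moreover have "sub (diff X (uni S)) (diff X U)" using U by (auto simp: sub_def)
      ultimately show ?thesis by (rule P(5))
    qed
    then show "uni S \<epsilon> W" using S unfolding in_W sub_def by auto
  qed
  have sing: "upr x x \<epsilon> W \<and> diff Y (upr x x) \<epsilon> W" if "x \<epsilon> X" for x
    using small[of "upr x x"] big[of "upr x x"] that P(3) by (auto simp: sub_def)
  have "creg R z L Y W"
  proof (rule clopen_base_creg[OF top])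
    fix U x assume U: "U \<epsilon> W" "x \<epsilon> U"
    show "\<exists>V. V \<epsilon> W \<and> diff Y V \<epsilon> W \<and> x \<epsilon> V \<and> sub V U"
    proof (cases "x = X")
      case True
      have "sub (diff Y U) X" using U True by (auto simp: sub_def)
      then show ?thesis using U small[of "diff Y U"] by (intro exI[of _ U]) (simp add: sub_def)
    next
      case False
      then have "x \<epsilon> X" using U in_W unfolding sub_def by auto
      then show ?thesis using sing U by (intro exI[of _ "upr x x"]) (auto simp: sub_def)
    qed
  qed
  moreover have "t1 Y W"
    unfolding t1_def
  proof (intro conjI HOL.allI HOL.impI top)
    fix x y assume xy: "x \<epsilon> Y \<and> y \<epsilon> Y \<and> x \<noteq> y"
    show "\<exists>U. U \<epsilon> W \<and> x \<epsilon> U \<and> \<not> y \<epsilon> U"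
    proof (cases "x = X")
      case True
      then show ?thesis using xy sing[of y] by (intro exI[of _ "diff Y (upr y y)"]) auto
    next
      case False
      then show ?thesis using xy sing[of x] by (intro exI[of _ "upr x x"]) auto
    qed
  qed
  ultimately obtain K where stab: "stab K" and
    K: "\<And>U. U \<epsilon> W \<Longrightarrow> diff Y U \<epsilon> W \<Longrightarrow> K U" and gd: "\<And>U. K U \<Longrightarrow> gdelta W U"
    using stable by blast
  have K_union: "K (diff Y (uni S))" if S: "ctb S" "\<And>B. B \<epsilon> S \<Longrightarrow> K (diff Y B)" for S
  proof -
    \<comment> \<open>Stability concerns nonempty families; including the whole space
      \<open>Y\<close> covers the case of empty \<open>S\<close> and does not change the
      intersection.\<close>
    let ?V = "cup (repl S (diff Y)) (upr Y Y)"
    have T_d: "T (\<lambda>e. diff Y (e 0))" by (intro dfn)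
    have V: "B \<epsilon> ?V \<longleftrightarrow> (\<exists>C. C \<epsilon> S \<and> B = diff Y C) \<or> B = Y" for B
      by (simp add: repl[OF T_d])
    have "diff Y Y = emp" by (rule ext) auto
    then have "K Y" using K[OF Y_W] small[of emp] by (simp add: sub_def)
    then have "\<forall>B. B \<epsilon> ?V \<longrightarrow> K B" unfolding V using S(2) by blast
    moreover have "ctb ?V"
      using ctb_cup[OF ctb_repl[OF S(1) T_d]] ctb_fin[OF fin_insert[OF fin_emp]]
      by (metis ctb_cup ctb_subset in_cup in_upr sub_def)
    moreover have "x \<epsilon> diff Y (uni S) \<longleftrightarrow> (\<forall>B. B \<epsilon> ?V \<longrightarrow> x \<epsilon> B)" for x
    proof -
      have "(\<forall>B. B \<epsilon> ?V \<longrightarrow> x \<epsilon> B) \<longleftrightarrow> x \<epsilon> Y \<and> (\<forall>C. C \<epsilon> S \<longrightarrow> x \<epsilon> diff Y C)" unfolding V by blast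
      then show ?thesis unfolding in_diff in_uni by blast
    qed
    moreover have "Y \<epsilon> ?V" by simp
    ultimately show ?thesis using stab unfolding stab_def by blast
  qed
  have "K (diff Y B)" if B: "B \<epsilon> F" for B
  proof -
    obtain S where S: "ctb S" "\<forall>C. C \<epsilon> S \<longrightarrow> P C" "B = uni S"
      using F(2) B unfolding cu_def by blast
    have "K (diff Y C)" if C: "C \<epsilon> S" for C
    proof -
      have "z \<epsilon> B" if "z \<epsilon> C" for z using C that unfolding S(3) in_uni by blast
      then have "sub C X" unfolding sub_def X_def in_uni using B by blast
      moreover from this have "sub C Y" by (simp add: sub_def)
      ultimately show ?thesis using K[of "diff Y C"] big[of C] small[of C] S(2) C compl by simp
    qed
    then show ?thesis using K_union S by simp
  qed
  \<comment> \<open>This difference is the singleton of the added point. Stability has been used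
    twice: for each member of \<open>F\<close>, and now for \<open>F\<close> itself.\<close>
  then have "K (diff Y X)" using K_union[OF F(1)] unfolding X_def by blast
  then obtain V where V: "ctb V" "sub V W" "\<And>x. x \<epsilon> diff Y X \<longleftrightarrow> (\<forall>B. B \<epsilon> V \<longrightarrow> x \<epsilon> B)"
    using gd unfolding gdelta_def by blast
  have T_d: "T (\<lambda>e. diff X (e 0))" by (intro dfn)
  note r = repl[OF T_d, of _ V]
  have "ctb (repl V (diff X))" using V(1) T_d by (rule ctb_repl)
  moreover have "\<forall>B. B \<epsilon> repl V (diff X) \<longrightarrow> P B"
  proof (intro HOL.allI HOL.impI)
    fix B assume "B \<epsilon> repl V (diff X)"
    then obtain U where U: "U \<epsilon> V" "B = diff X U" using r by blast
    have "X \<epsilon> diff Y X" by simp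
    then have "X \<epsilon> U" using V(3) U by blast
    then show "P B" using U V(2) in_W unfolding sub_def by blast
  qed
  moreover have "X = uni (repl V (diff X))"
  proof (rule ext)
    fix x
    show "x \<epsilon> X \<longleftrightarrow> x \<epsilon> uni (repl V (diff X))"
    proof
      assume x: "x \<epsilon> X"
      then have "\<not> x \<epsilon> diff Y X" by simp
      then obtain U where "U \<epsilon> V" "\<not> x \<epsilon> U" using V(3) by blast
      then show "x \<epsilon> uni (repl V (diff X))" unfolding in_uni r using x in_diff by blast
    next
      assume "x \<epsilon> uni (repl V (diff X))"
      then show "x \<epsilon> X" unfolding in_uni r using in_diff by blast
    qed
  qed
  ultimately show "cu P (uni F)" unfolding cu_def X_def by blast
qed

lemma gdelta_open: "U \<epsilon> W \<Longrightarrow> gdelta W U"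
  unfolding gdelta_def
  by (rule exI[of _ "upr U U"])
    (use ctb_fin[OF fin_insert[OF fin_emp, of U]] in \<open>auto simp: sub_def intro: ctb_subset\<close>)

lemma sub_insert_emp: "sub (upr x x) (cup emp (upr x x))"
  by (simp add: sub_def)

text \<open>The ideals of countable and of finite sets give the two union principles from the same
  hypothesis.\<close>

lemma unions_of_stable:
  assumes "\<And>X W. creg R z L X W \<Longrightarrow> t1 X W \<Longrightarrow>
      \<exists>K. stab K \<and> (\<forall>U. U \<epsilon> W \<and> diff X U \<epsilon> W \<longrightarrow> K U) \<and> (\<forall>U. K U \<longrightarrow> gdelta W U)"
  shows "ut (cu ctb) \<and> ut (cu fin)"
proof
  have fin: "fin (upr x x)" for x
    using fin_subset[OF fin_insert[OF fin_emp]] sub_insert_emp by blast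
  show "ut (cu ctb)"
    by (rule union_of_stable[OF _ _ _ _ _ assms])
      (use fin ctb_fin ctb_cup ctb_subset in \<open>auto intro: dfn\<close>)
  show "ut (cu fin)"
    by (rule union_of_stable[OF _ _ _ _ _ assms])
      (use fin fin_cup fin_subset in \<open>auto intro: dfn\<close>)
qed

end


section \<open>Rings of differences\<close>

text \<open>These axioms hold both for the natural numbers of a model and for its nonnegative reals,
  so that the ring of differences is constructed once for both. \<open>diff_ex\<close> makes the
  induced order total.\<close>

class nsemi = comm_semiring_1 +
  assumes add_cancel: "a + b = a + c \<Longrightarrow> b = c"
    and add_eq_zero: "a + b = 0 \<Longrightarrow> a = 0"
    and diff_ex: "\<exists>d. a = b + d \<or> b = a + d"
    and no_zero_div: "a * b = 0 \<Longrightarrow> a = 0 \<or> b = 0"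
begin

lemma add_cancel_iff: "b + a = c + a \<longleftrightarrow> b = c"
  using add_cancel by (metis add.commute)

end

definition grel :: "'a::nsemi \<times> 'a \<Rightarrow> 'a \<times> 'a \<Rightarrow> bool" where
  "grel p q \<longleftrightarrow> fst p + snd q = fst q + snd p"

lemma equivp_grel: "equivp (grel :: 'a::nsemi \<times> 'a \<Rightarrow> _)"
proof (rule equivpI)
  show "transp (grel :: 'a \<times> 'a \<Rightarrow> _)"
  proof (rule transpI)
    fix p q r :: "'a \<times> 'a" assume "grel p q" "grel q r"
    then have 1: "fst p + snd q = fst q + snd p" "fst q + snd r = fst r + snd q"
      by (simp_all add: grel_def)
    have "(fst p + snd r) + (snd q + fst q) = (fst p + snd q) + (fst q + snd r)" by (simp add: ac_simps)
    also have "\<dots> = (fst r + snd p) + (snd q + fst q)" unfolding 1 by (simp add: ac_simps)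
    finally show "grel p r" by (simp add: grel_def add_cancel_iff)
  qed
qed (auto simp: grel_def reflp_def symp_def)

quotient_type (overloaded) 'a gr = "'a::nsemi \<times> 'a" / grel
  morphisms Rep_gr Abs_gr
  by (rule equivp_grel)

lift_definition emb :: "'a::nsemi \<Rightarrow> 'a gr" is "\<lambda>a. (a, 0)" .

instantiation gr :: (nsemi) comm_ring_1
begin

lift_definition zero_gr :: "'a gr" is "(0, 0)" .
lift_definition one_gr :: "'a gr" is "(1, 0)" .

lift_definition plus_gr :: "'a gr \<Rightarrow> 'a gr \<Rightarrow> 'a gr" is "\<lambda>(a, b) (c, d). (a + c, b + d)"
proof (clarsimp simp: grel_def)
  fix a b a' b' c d c' d' :: 'a assume "a + b' = a' + b" "c + d' = c' + d"
  then have "(a + b') + (c + d') = (a' + b) + (c' + d)" by simp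
  then show "a + c + (b' + d') = a' + c' + (b + d)" by (simp add: ac_simps)
qed

lift_definition uminus_gr :: "'a gr \<Rightarrow> 'a gr" is "\<lambda>(a, b). (b, a)"
  by (clarsimp simp: grel_def) (simp add: ac_simps)

lift_definition times_gr :: "'a gr \<Rightarrow> 'a gr \<Rightarrow> 'a gr" is
  "\<lambda>(a, b) (c, d). (a * c + b * d, a * d + b * c)"
proof (clarsimp simp: grel_def)
  fix a b a' b' c d c' d' :: 'a assume 1: "a + b' = a' + b" and 2: "c + d' = c' + d"
  \<comment> \<open>Adding \<open>b' * c + a' * d\<close> to both sides lets the two hypotheses be
    applied in turn; cancellation removes it again.\<close>
  have "(a * c + b * d + (a' * d' + b' * c')) + (b' * c + a' * d) =
      (a + b') * c + (a' + b) * d + (a' * d' + b' * c')"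
    by (simp add: algebra_simps)
  also have "\<dots> = (a' + b) * c + (a + b') * d + (a' * d' + b' * c')" by (simp only: 1)
  also have "\<dots> = a' * (c + d') + b' * (c' + d) + (a * d + b * c)" by (simp add: algebra_simps)
  also have "\<dots> = a' * (c' + d) + b' * (c + d') + (a * d + b * c)" by (simp only: 2)
  also have "\<dots> = (a' * c' + b' * d' + (a * d + b * c)) + (b' * c + a' * d)" by (simp add: algebra_simps)
  finally show "a * c + b * d + (a' * d' + b' * c') = a' * c' + b' * d' + (a * d + b * c)"
    by (simp add: add_cancel_iff)
qed

definition minus_gr :: "'a gr \<Rightarrow> 'a gr \<Rightarrow> 'a gr" where "x - y = x + - (y :: 'a gr)"

instance
proof
  fix x y w :: "'a gr"
  show "x + y + w = x + (y + w)" by transfer (clarsimp simp: grel_def ac_simps)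
  show "x + y = y + x" by transfer (clarsimp simp: grel_def ac_simps)
  show "0 + x = x" by transfer (clarsimp simp: grel_def)
  show "- x + x = 0" by transfer (clarsimp simp: grel_def ac_simps)
  show "x - y = x + - y" by (rule minus_gr_def)
  show "x * y * w = x * (y * w)" by transfer (clarsimp simp: grel_def algebra_simps)
  show "x * y = y * x" by transfer (clarsimp simp: grel_def algebra_simps)
  show "1 * x = x" by transfer (clarsimp simp: grel_def)
  show "(x + y) * w = x * w + y * w" by transfer (clarsimp simp: grel_def algebra_simps)
  show "(0 :: 'a gr) \<noteq> 1" by transfer (simp add: grel_def)
qed

end

lemma emb_simps: "emb 0 = 0" "emb 1 = 1" "emb (a + b) = emb a + emb b" "emb (a * b) = emb a * emb b"
  by (transfer, simp add: grel_def)+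

lemma emb_eq: "emb a = emb b \<longleftrightarrow> a = b"
  by transfer (simp add: grel_def)

lemma gr_diff: "\<exists>a b. x = emb a - emb b"
  unfolding minus_gr_def by transfer (auto simp: grel_def)

lemma gr_cases: obtains a where "x = emb a" | a where "x = - emb a" "a \<noteq> 0"
proof -
  obtain a b where x: "x = emb a - emb b" using gr_diff by blast
  obtain d where "a = b + d \<or> b = a + d" using diff_ex by blast
  then have "x = emb d \<or> x = - emb d" by (auto simp: x emb_simps)
  then show ?thesis using that emb_simps(1) by (metis neg_0_equal_iff_equal)
qed

definition gpos :: "'a::nsemi gr \<Rightarrow> bool" where
  "gpos x \<longleftrightarrow> (\<exists>a. a \<noteq> 0 \<and> x = emb a)"

lemma gpos:
  fixes x y :: "'a::nsemi gr"
  shows "gpos x \<Longrightarrow> gpos y \<Longrightarrow> gpos (x + y)" "gpos x \<Longrightarrow> gpos y \<Longrightarrow> gpos (x * y)"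
    "\<not> gpos (0 :: 'a gr)" "gpos x \<or> x = 0 \<or> gpos (- x)" "gpos (1 :: 'a gr)"
proof -
  show "gpos x \<Longrightarrow> gpos y \<Longrightarrow> gpos (x + y)" unfolding gpos_def by (metis add_eq_zero emb_simps(3))
  show "gpos x \<Longrightarrow> gpos y \<Longrightarrow> gpos (x * y)" unfolding gpos_def by (metis no_zero_div emb_simps(4))
  show "\<not> gpos (0 :: 'a gr)" unfolding gpos_def by (metis emb_eq emb_simps(1))
  show "gpos x \<or> x = 0 \<or> gpos (- x)" unfolding gpos_def
    by (cases x rule: gr_cases) (use emb_simps(1) in \<open>metis minus_minus\<close>)+
  show "gpos (1 :: 'a gr)" unfolding gpos_def by (metis emb_simps(2) zero_neq_one)
qed

instantiation gr :: (nsemi) linordered_idom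
begin

definition less_gr :: "'a gr \<Rightarrow> 'a gr \<Rightarrow> bool" where "x < y \<longleftrightarrow> gpos (y - x)"
definition less_eq_gr :: "'a gr \<Rightarrow> 'a gr \<Rightarrow> bool" where "x \<le> y \<longleftrightarrow> x = y \<or> gpos (y - x)"
definition abs_gr_eq: "\<bar>x\<bar> = (if x < 0 then - x else (x :: 'a gr))"
definition sgn_gr_eq: "sgn x = (if x = 0 then 0 else if 0 < x then 1 else - (1 :: 'a gr))"

instance
proof
  fix x y w :: "'a gr"
  have asym: "\<not> (gpos (y - x) \<and> gpos (x - y))" for x y :: "'a gr"
    using gpos(1)[of "y - x" "x - y"] gpos(3) by auto
  show "x < y \<longleftrightarrow> x \<le> y \<and> \<not> y \<le> x"
    using asym[of y x] gpos(3) unfolding less_gr_def less_eq_gr_def by auto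
  show "x \<le> x" by (simp add: less_eq_gr_def)
  show "x \<le> y \<Longrightarrow> y \<le> w \<Longrightarrow> x \<le> w"
    using gpos(1)[of "w - y" "y - x"] unfolding less_eq_gr_def by auto
  show "x \<le> y \<Longrightarrow> y \<le> x \<Longrightarrow> x = y" using asym[of y x] unfolding less_eq_gr_def by auto
  show "x \<le> y \<or> y \<le> x" using gpos(4)[of "y - x"] unfolding less_eq_gr_def by auto
  show "x \<le> y \<Longrightarrow> w + x \<le> w + y" unfolding less_eq_gr_def by auto
  show "x < y \<Longrightarrow> 0 < w \<Longrightarrow> w * x < w * y"
    using gpos(2)[of w "y - x"] unfolding less_gr_def by (simp add: right_diff_distrib)
  show "\<bar>x\<bar> = (if x < 0 then - x else x)" by (rule abs_gr_eq)
  show "sgn x = (if x = 0 then 0 else if 0 < x then 1 else - 1)" by (rule sgn_gr_eq)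
qed

end

lemma emb_nonneg: "0 \<le> emb a"
  unfolding less_eq_gr_def gpos_def by (cases "a = 0") (auto simp: emb_simps)

lemma nonneg_emb: "0 \<le> x \<Longrightarrow> \<exists>a. x = emb a"
  using emb_simps(1) unfolding less_eq_gr_def gpos_def diff_zero by metis

lemma emb_le: "emb a \<le> emb b \<longleftrightarrow> (\<exists>d. b = a + d)"
proof
  assume "emb a \<le> emb b"
  then obtain d where "emb b - emb a = emb d" using nonneg_emb[of "emb b - emb a"] by auto
  then have "emb b = emb (a + d)" by (simp add: emb_simps algebra_simps)
  then show "\<exists>d. b = a + d" unfolding emb_eq by blast
next
  assume "\<exists>d. b = a + d"
  then show "emb a \<le> emb b" using emb_nonneg by (auto simp: emb_simps)
qed


section \<open>Nonnegative Dedekind cuts\<close>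

text \<open>Containing all negative elements makes the cut nonnegative. The field is arbitrary,
  since the rationals of a model may be non-Archimedean seen from outside.\<close>

definition ncut :: "'q::linordered_field set \<Rightarrow> bool" where
  "ncut C \<longleftrightarrow> (\<forall>q. q < 0 \<longrightarrow> q \<in> C) \<and> (\<exists>b. b \<notin> C) \<and> (\<forall>x y. x \<in> C \<and> y < x \<longrightarrow> y \<in> C) \<and>
    (\<forall>x. x \<in> C \<longrightarrow> (\<exists>y. y \<in> C \<and> x < y))"

text \<open>The cut and its complement come arbitrarily close. In a non-Archimedean field this
  fails, for instance, for the elements bounded by a genuine natural number. Subtraction,
  cancellation and inversion depend on it.\<close>

definition arch :: "'q::linordered_field set \<Rightarrow> bool" where
  "arch C \<longleftrightarrow> (\<forall>d>0. \<exists>x. x \<in> C \<and> x + d \<notin> C)"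

definition czero :: "'q::linordered_field set" where "czero = {q. q < 0}"
definition cone :: "'q::linordered_field set" where "cone = {q. q < 1}"
definition cadd :: "'q::linordered_field set \<Rightarrow> 'q set \<Rightarrow> 'q set" where
  "cadd C D = {q. \<exists>x y. x \<in> C \<and> y \<in> D \<and> q = x + y}"
text \<open>A zero factor has no positive members, and the product must then be
  \<open>czero\<close>; hence the negative elements are put in separately.\<close>

definition cmult :: "'q::linordered_field set \<Rightarrow> 'q set \<Rightarrow> 'q set" where
  "cmult C D = {q. q < 0 \<or> (\<exists>x y. x \<in> C \<and> y \<in> D \<and> 0 < x \<and> 0 < y \<and> q \<le> x * y)}"
text \<open>Here and in \<open>cinv\<close> the condition avoids subtraction and division, as only
  sums, products and the order of fractions are shown to be definable later.\<close>

definition cdiff :: "'q::linordered_field set \<Rightarrow> 'q set \<Rightarrow> 'q set" where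
  "cdiff D C = {q. \<exists>c. c \<notin> C \<and> c + q \<in> D}"
definition cinv :: "'q::linordered_field set \<Rightarrow> 'q set" where
  "cinv D = {q. \<exists>s. s \<notin> D \<and> q * s < 1}"

lemma
  assumes "ncut C"
  shows ncut_neg: "q < 0 \<Longrightarrow> q \<in> C"
    and ncut_bound: "\<exists>b. b \<notin> C"
    and ncut_lower: "x \<in> C \<Longrightarrow> y < x \<Longrightarrow> y \<in> C"
    and ncut_open: "x \<in> C \<Longrightarrow> \<exists>y. y \<in> C \<and> x < y"
    and ncut_less: "x \<in> C \<Longrightarrow> b \<notin> C \<Longrightarrow> x < b"
    and ncut_out: "b \<notin> C \<Longrightarrow> 0 \<le> b"
  using assms unfolding ncut_def by (blast, blast, blast, blast, metis linorder_neqE, metis not_le)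

lemma ncutI:
  assumes "\<And>q. q < 0 \<Longrightarrow> q \<in> C" "b \<notin> C" "\<And>x y. x \<in> C \<Longrightarrow> y < x \<Longrightarrow> y \<in> C"
    "\<And>x. x \<in> C \<Longrightarrow> \<exists>y. y \<in> C \<and> x < y"
  shows "ncut C"
  using assms unfolding ncut_def by blast

lemma ncut_linear: "ncut C \<Longrightarrow> ncut D \<Longrightarrow> C \<subseteq> D \<or> D \<subseteq> C"
  by (meson ncut_less ncut_lower subsetI)

lemma ncut_pos:
  assumes "ncut C" "C \<noteq> czero"
  shows "\<exists>x. x \<in> C \<and> 0 < x"
proof -
  obtain y where "y \<in> C" "\<not> y < 0" using assms ncut_neg unfolding czero_def by blast
  then show ?thesis using ncut_open[OF assms(1)] by (meson linorder_not_less order_le_less_trans)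
qed

lemma ncut_czero: "ncut (czero :: 'q::linordered_field set)"
  unfolding czero_def by (rule ncutI[of _ 0]) (auto dest: dense)

lemma ncut_cone: "ncut (cone :: 'q::linordered_field set)"
  unfolding cone_def by (rule ncutI[of _ 1]) (auto dest: dense intro: less_trans)

lemma cadd_iff: "q \<in> cadd C D \<longleftrightarrow> (\<exists>x. x \<in> C \<and> q - x \<in> D)"
proof
  assume "q \<in> cadd C D"
  then obtain x y where "x \<in> C" "y \<in> D" "q = x + y" unfolding cadd_def by blast
  then have "x \<in> C \<and> q - x \<in> D" by simp
  then show "\<exists>x. x \<in> C \<and> q - x \<in> D" by blast
next
  assume "\<exists>x. x \<in> C \<and> q - x \<in> D"
  then obtain x where "x \<in> C" "q - x \<in> D" "q = x + (q - x)" by auto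
  then show "q \<in> cadd C D" unfolding cadd_def by blast
qed

lemma ncut_cadd:
  assumes C: "ncut C" and D: "ncut D"
  shows "ncut (cadd C D)"
proof -
  obtain b c where bc: "b \<notin> C" "c \<notin> D" using ncut_bound C D by blast
  show ?thesis
  proof (rule ncutI[of _ "b + c"])
    show "q \<in> cadd C D" if "q < 0" for q
      unfolding cadd_iff using ncut_neg[OF C, of "q / 2"] ncut_neg[OF D, of "q / 2"] that
      by (intro exI[of _ "q / 2"]) (simp add: field_simps)
    show "b + c \<notin> cadd C D"
      unfolding cadd_def using ncut_less[OF C _ bc(1)] ncut_less[OF D _ bc(2)] add_strict_mono by force
    show "y \<in> cadd C D" if "x \<in> cadd C D" "y < x" for x y
      using that ncut_lower[OF D] unfolding cadd_iff by (meson diff_strict_right_mono)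
    show "\<exists>y. y \<in> cadd C D \<and> x < y" if x: "x \<in> cadd C D" for x
    proof -
      obtain p q where "p \<in> C" "q \<in> D" "x = p + q" using x unfolding cadd_def by blast
      moreover obtain q' where "q' \<in> D" "q < q'" using ncut_open[OF D] calculation by blast
      ultimately show ?thesis unfolding cadd_def by (intro exI[of _ "p + q'"]) auto
    qed
  qed
qed

lemma cadd_commute: "cadd C D = cadd D C"
  unfolding cadd_def by (auto simp: add.commute)

lemma cadd_assoc: "cadd (cadd B C) D = cadd B (cadd C D)"
proof -
  have "q \<in> cadd (cadd B C) D \<longleftrightarrow> (\<exists>x y w. x \<in> B \<and> y \<in> C \<and> w \<in> D \<and> q = x + y + w)" for q
    unfolding cadd_def by blast
  moreover have "q \<in> cadd B (cadd C D) \<longleftrightarrow> (\<exists>x y w. x \<in> B \<and> y \<in> C \<and> w \<in> D \<and> q = x + y + w)" for q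
    unfolding cadd_def by (auto simp: add.assoc)
  ultimately show ?thesis by blast
qed

lemma cadd_czero: "ncut C \<Longrightarrow> cadd czero C = C"
proof (intro set_eqI iffI)
  assume C: "ncut C"
  show "q \<in> C" if "q \<in> cadd czero C" for q
    using that ncut_lower[OF C] unfolding cadd_iff czero_def by fastforce
  show "q \<in> cadd czero C" if q: "q \<in> C" for q
  proof -
    obtain y where "y \<in> C" "q < y" using ncut_open[OF C q] by blast
    then show ?thesis unfolding cadd_iff czero_def by (intro exI[of _ "q - y"]) simp
  qed
qed

lemma ncut_cmult:
  assumes C: "ncut C" and D: "ncut D"
  shows "ncut (cmult C D)"
proof -
  obtain b c where bc: "b \<notin> C" "c \<notin> D" using ncut_bound C D by blast
  show ?thesis
  proof (rule ncutI[of _ "b * c"])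
    show "q \<in> cmult C D" if "q < 0" for q using that unfolding cmult_def by blast
    show "b * c \<notin> cmult C D"
    proof
      assume "b * c \<in> cmult C D"
      moreover have "0 \<le> b * c" using ncut_out[OF C bc(1)] ncut_out[OF D bc(2)] by simp
      ultimately obtain x y where "x \<in> C" "y \<in> D" "0 < x" "0 < y" "b * c \<le> x * y"
        unfolding cmult_def by force
      moreover have "x * y < b * c"
        using calculation ncut_less[OF C _ bc(1)] ncut_less[OF D _ bc(2)] by (intro mult_strict_mono) force+
      ultimately show False by simp
    qed
    show "y \<in> cmult C D" if "x \<in> cmult C D" "y < x" for x y
      using that unfolding cmult_def by force
    show "\<exists>y. y \<in> cmult C D \<and> x < y" if "x \<in> cmult C D" for x
    proof (cases "x < 0")
      case True
      then show ?thesis unfolding cmult_def by (intro exI[of _ "x / 2"]) auto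
    next
      case False
      then obtain p q where pq: "p \<in> C" "q \<in> D" "0 < p" "0 < q" "x \<le> p * q"
        using \<open>x \<in> cmult C D\<close> unfolding cmult_def by blast
      then obtain q' where q': "q' \<in> D" "q < q'" using ncut_open[OF D] by blast
      then have "p * q < p * q'" "0 < q'" using pq(3,4) by simp_all
      then have "x < p * q'" using pq(5) by (meson order_le_less_trans)
      moreover have "p * q' \<in> cmult C D" using pq(1,3) q'(1) \<open>0 < q'\<close> unfolding cmult_def by auto
      ultimately show ?thesis by blast
    qed
  qed
qed

lemma cmult_commute: "cmult C D = cmult D C"
  unfolding cmult_def by (auto simp: mult.commute) (metis mult.commute)+

lemma cmult_assoc: "cmult (cmult B C) D = cmult B (cmult C D)"
proof -
  let ?P = "\<lambda>q. q < 0 \<or> (\<exists>x y w. x \<in> B \<and> y \<in> C \<and> w \<in> D \<and> 0 < x \<and> 0 < y \<and> 0 < w \<and> q \<le> x * y * w)"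
  have "q \<in> cmult (cmult B C) D \<longleftrightarrow> ?P q" for q
  proof
    assume q: "q \<in> cmult (cmult B C) D"
    show "?P q"
    proof (cases "q < 0")
      case False
      then obtain p w where p: "p \<in> cmult B C" "w \<in> D" "0 < p" "0 < w" "q \<le> p * w"
        using q unfolding cmult_def[of _ D] by blast
      then obtain x y where x: "x \<in> B" "y \<in> C" "0 < x" "0 < y" "p \<le> x * y" unfolding cmult_def by force
      have "p * w \<le> x * y * w" using x p by simp
      then show ?thesis using x p by (meson order_trans)
    qed simp
  next
    assume P: "?P q"
    show "q \<in> cmult (cmult B C) D"
    proof (cases "q < 0")
      case False
      then obtain x y w where x: "x \<in> B" "y \<in> C" "w \<in> D" "0 < x" "0 < y" "0 < w" "q \<le> x * y * w"
        using P by blast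
      then have "x * y \<in> cmult B C" "0 < x * y" unfolding cmult_def by auto
      then show ?thesis using x(3,6,7) unfolding cmult_def[of _ D] by blast
    qed (simp add: cmult_def)
  qed
  moreover have "q \<in> cmult B (cmult C D) \<longleftrightarrow> ?P q" for q
  proof
    assume q: "q \<in> cmult B (cmult C D)"
    show "?P q"
    proof (cases "q < 0")
      case False
      then obtain p x where p: "p \<in> cmult C D" "x \<in> B" "0 < p" "0 < x" "q \<le> x * p"
        using q unfolding cmult_def[of B] by blast
      then obtain y w where y: "y \<in> C" "w \<in> D" "0 < y" "0 < w" "p \<le> y * w" unfolding cmult_def by force
      have "x * p \<le> x * y * w" using y p by (simp add: mult.assoc)
      then show ?thesis using y p by (meson order_trans)
    qed simp
  next
    assume P: "?P q"
    show "q \<in> cmult B (cmult C D)"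
    proof (cases "q < 0")
      case False
      then obtain x y w where x: "x \<in> B" "y \<in> C" "w \<in> D" "0 < x" "0 < y" "0 < w" "q \<le> x * y * w"
        using P by blast
      then have "y * w \<in> cmult C D" unfolding cmult_def by blast
      moreover have "0 < y * w" "q \<le> x * (y * w)" using x by (simp_all add: mult.assoc)
      ultimately show ?thesis using x(1,4) unfolding cmult_def[of B] by blast
    qed (simp add: cmult_def)
  qed
  ultimately show ?thesis by (intro set_eqI) (simp only:)
qed

lemma cmult_cone: "ncut C \<Longrightarrow> cmult cone C = C"
proof (intro set_eqI iffI)
  assume C: "ncut C"
  show "q \<in> C" if q: "q \<in> cmult cone C" for q
  proof (cases "q < 0")
    case False
    then obtain x y where x: "x < 1" "y \<in> C" "0 < x" "0 < y" "q \<le> x * y"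
      using q unfolding cmult_def cone_def by blast
    then have "x * y < 1 * y" by (intro mult_strict_right_mono)
    then have "q < y" using x(5) by simp
    then show ?thesis using x ncut_lower[OF C] by blast
  qed (use C ncut_neg in blast)
  show "q \<in> cmult cone C" if q: "q \<in> C" for q
  proof (cases "q < 0")
    case False
    obtain y where y: "y \<in> C" "q < y" using ncut_open[OF C q] by blast
    have "0 < y" using False y by simp
    \<comment> \<open>The factor below 1 is the midpoint of \<open>q / y\<close> and 1.\<close>
    moreover have "(q + y) / (2 * y) < 1" "0 < (q + y) / (2 * y)" "q \<le> (q + y) / (2 * y) * y"
      using False y by (simp_all add: field_simps)
    ultimately show ?thesis using y unfolding cmult_def cone_def by blast
  qed (simp add: cmult_def)
qed

lemma cmult_czero: "cmult czero C = czero"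
  unfolding cmult_def czero_def by auto

text \<open>When \<open>e\<close> is not positive, it has no product to go into. Enlarging
  \<open>d\<close> to \<open>d'\<close> inside \<open>C\<close> creates the slack
  \<open>x * (d' - d)\<close>, whose negative is a member of the other product.\<close>

lemma cmult_cadd_aux1:
  assumes C: "ncut C" and "x \<in> B" "0 < x" "d \<in> C" "0 < d" "e \<le> 0" "q \<le> x * (d + e)"
  shows "q \<in> cadd (cmult B C) (cmult B D)"
proof -
  obtain d' where d': "d' \<in> C" "d < d'" using ncut_open[OF C] assms by blast
  have "x * (d + e) \<le> x * d" using assms by simp
  then have "q + x * (d' - d) \<le> x * d'" using assms by (simp add: algebra_simps)
  moreover have "0 < d'" using d' assms by simp
  ultimately have "q + x * (d' - d) \<in> cmult B C" using d' assms unfolding cmult_def by blast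
  moreover have "- (x * (d' - d)) \<in> cmult B D" using d' assms by (simp add: cmult_def)
  ultimately show ?thesis unfolding cadd_def by (force intro: exI[of _ "q + x * (d' - d)"])
qed

lemma cmult_cadd_aux2:
  assumes C: "ncut C" and "a < 0" "b \<in> cmult B D" "0 \<le> a + b"
  shows "a + b \<in> cmult B (cadd C D)"
proof -
  obtain x e where x: "x \<in> B" "e \<in> D" "0 < x" "0 < e" "b \<le> x * e"
    using assms unfolding cmult_def by force
  \<comment> \<open>Being negative, this lies in \<open>C\<close>. Since only half of
    \<open>a\<close> is spent, \<open>x * (?d + e)\<close> is at least \<open>a / 2 + b\<close>,
    hence above \<open>a + b\<close> and positive.\<close>
  let ?d = "a / (2 * x)"
  have "?d < 0" using assms x by (simp add: divide_neg_pos)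
  then have "?d \<in> C" using ncut_neg[OF C] by blast
  then have s: "?d + e \<in> cadd C D" using x unfolding cadd_def by blast
  have xs: "x * (?d + e) = a / 2 + x * e" using x by (simp add: field_simps)
  then have "0 < x * (?d + e)" using assms x by simp
  then have "0 < ?d + e" using x by (simp add: zero_less_mult_iff)
  moreover have "a + b \<le> x * (?d + e)" unfolding xs using assms x by simp
  ultimately show ?thesis using s x unfolding cmult_def by blast
qed

lemma cmult_cadd:
  assumes B: "ncut B" and C: "ncut C" and D: "ncut D"
  shows "cmult B (cadd C D) = cadd (cmult B C) (cmult B D)"
proof (intro set_eqI iffI)
  fix q assume q: "q \<in> cmult B (cadd C D)"
  show "q \<in> cadd (cmult B C) (cmult B D)"
  proof (cases "q < 0")
    case True
    have "ncut (cadd (cmult B C) (cmult B D))" by (intro ncut_cadd ncut_cmult assms)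
    then show ?thesis using True by (rule ncut_neg)
  next
    case False
    then obtain x d e where x: "x \<in> B" "0 < x" "d \<in> C" "e \<in> D" "0 < d + e" "q \<le> x * (d + e)"
      using q unfolding cmult_def[of B "cadd C D"] by (auto simp: cadd_def)
    consider "e \<le> 0" | "d \<le> 0" | "0 < d" "0 < e" by linarith
    then show ?thesis
    proof cases
      case 1
      then show ?thesis using cmult_cadd_aux1[OF C x(1,2,3) _ 1 x(6)] x by simp
    next
      case 2
      then have "q \<in> cadd (cmult B D) (cmult B C)"
        using cmult_cadd_aux1[OF D x(1,2,4) _ 2] x by (simp add: add.commute)
      then show ?thesis by (simp add: cadd_commute)
    next
      case 3
      have "q - x * e \<le> x * d" using x(6) by (simp add: algebra_simps)
      then have "x * e \<in> cmult B D" "q - x * e \<in> cmult B C"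
        using x(1-4) 3 unfolding cmult_def by blast+
      then show ?thesis unfolding cadd_def by (force intro: exI[of _ "q - x * e"])
    qed
  qed
next
  fix q assume "q \<in> cadd (cmult B C) (cmult B D)"
  then obtain a b where ab: "a \<in> cmult B C" "b \<in> cmult B D" "q = a + b" unfolding cadd_def by blast
  show "q \<in> cmult B (cadd C D)"
  proof (cases "q < 0")
    case True
    then show ?thesis by (simp add: cmult_def)
  next
    case False
    then consider "a < 0" | "b < 0" | "0 \<le> a" "0 \<le> b" by linarith
    then show ?thesis
    proof cases
      case 1
      then show ?thesis using cmult_cadd_aux2[OF C 1 ab(2)] False ab by simp
    next
      case 2
      then have "b + a \<in> cmult B (cadd D C)" using cmult_cadd_aux2[OF D 2 ab(1)] False ab by simp
      then show ?thesis using ab by (simp add: cadd_commute add.commute)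
    next
      case 3
      obtain x d where x: "x \<in> B" "d \<in> C" "0 < x" "0 < d" "a \<le> x * d" using ab 3 unfolding cmult_def by force
      obtain y e where y: "y \<in> B" "e \<in> D" "0 < y" "0 < e" "b \<le> y * e" using ab 3 unfolding cmult_def by force
      \<comment> \<open>A common first factor is needed for distributivity; the larger of the two is
        still a member of \<open>B\<close>.\<close>
      define m where "m = max x y"
      have m: "m \<in> B" "0 < m" using x y unfolding m_def max_def by auto
      have "x * d \<le> m * d" "y * e \<le> m * e" using x y unfolding m_def by simp_all
      then have "a + b \<le> m * d + m * e" using x(5) y(5) by (meson add_mono order_trans)
      then have "q \<le> m * (d + e)" using ab by (simp add: distrib_left)
      moreover have "d + e \<in> cadd C D" "0 < d + e" using x y unfolding cadd_def by auto
      ultimately show ?thesis using m unfolding cmult_def by blast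
    qed
  qed
qed

lemma cdiff:
  assumes C: "ncut C" and D: "ncut D" and arch: "arch C" and CD: "C \<subseteq> D" "C \<noteq> D"
  shows "ncut (cdiff D C)" "cadd C (cdiff D C) = D"
proof -
  obtain b c where b: "b \<notin> D" and c: "c \<in> D" "c \<notin> C" using ncut_bound[OF D] CD by blast
  show "ncut (cdiff D C)"
  proof (rule ncutI[of _ b])
    show "q \<in> cdiff D C" if "q < 0" for q
      using c that ncut_lower[OF D c(1), of "c + q"] unfolding cdiff_def by auto
    show "b \<notin> cdiff D C"
    proof
      assume "b \<in> cdiff D C"
      then obtain c where "c \<notin> C" "c + b \<in> D" unfolding cdiff_def by blast
      then show False using ncut_out[OF C, of c] ncut_less[OF D _ b, of "c + b"] by simp
    qed
    show "y \<in> cdiff D C" if "x \<in> cdiff D C" "y < x" for x y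
      using that ncut_lower[OF D] unfolding cdiff_def by (blast intro: add_strict_left_mono)
    show "\<exists>y. y \<in> cdiff D C \<and> x < y" if x: "x \<in> cdiff D C" for x
    proof -
      obtain c where c: "c \<notin> C" "c + x \<in> D" using x unfolding cdiff_def by blast
      obtain y where "y \<in> D" "c + x < y" using ncut_open[OF D c(2)] by blast
      then show ?thesis using c unfolding cdiff_def
        by (intro exI[of _ "y - c"]) (auto simp: algebra_simps intro!: exI[of _ c])
    qed
  qed
  show "cadd C (cdiff D C) = D"
  proof (intro set_eqI iffI)
    fix q assume "q \<in> cadd C (cdiff D C)"
    then obtain x c p where x: "x \<in> C" "c \<notin> C" "c + p \<in> D" "q = x + p" unfolding cadd_def cdiff_def by blast
    then have "q < c + p" using ncut_less[OF C x(1,2)] by simp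
    then show "q \<in> D" using ncut_lower[OF D x(3)] by blast
  next
    fix q assume "q \<in> D"
    then obtain q' where q': "q' \<in> D" "q < q'" using ncut_open[OF D] by blast
    \<comment> \<open>The element \<open>x + (q' - q)\<close> outside \<open>C\<close> certifies
      \<open>q - x\<close> as a member of the difference, because the two add up to
      \<open>q'\<close>.\<close>
    then obtain x where x: "x \<in> C" "x + (q' - q) \<notin> C" using arch unfolding arch_def by force
    then have "q - x \<in> cdiff D C" using q' unfolding cdiff_def by (auto intro!: exI[of _ "x + (q' - q)"])
    then show "q \<in> cadd C (cdiff D C)" using x unfolding cadd_iff by blast
  qed
qed

text \<open>Suppose \<open>e\<close> lies in \<open>E\<close> but not in \<open>D\<close>, and
  enlarge it to \<open>e'\<close> in \<open>E\<close>. By \<open>arch\<close>, some \<open>x\<close>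
  leaves \<open>C\<close> when increased by \<open>e' - e\<close>; but writing \<open>x + e'\<close>
  as \<open>c + d\<close> forces \<open>c\<close> beyond that point.\<close>

lemma cadd_cancel_aux:
  assumes C: "ncut C" and D: "ncut D" and E: "ncut E" and arch: "arch C" and eq: "cadd C D = cadd C E"
  shows "E \<subseteq> D"
proof
  fix e assume e: "e \<in> E"
  show "e \<in> D"
  proof (rule ccontr)
    assume eD: "e \<notin> D"
    obtain e' where e': "e' \<in> E" "e < e'" using ncut_open[OF E e] by blast
    then obtain x where x: "x \<in> C" "x + (e' - e) \<notin> C" using arch unfolding arch_def by force
    have "x + e' \<in> cadd C D" unfolding eq using x e' unfolding cadd_def by blast
    then obtain c d where c: "c \<in> C" "d \<in> D" "x + e' = c + d" unfolding cadd_def by blast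
    have "d < e" using ncut_less[OF D c(2) eD] .
    then have "x + (e' - e) < c" using c(3) by (simp add: algebra_simps)
    then show False using ncut_lower[OF C c(1)] x by blast
  qed
qed

lemma cadd_cancel:
  "ncut C \<Longrightarrow> ncut D \<Longrightarrow> ncut E \<Longrightarrow> arch C \<Longrightarrow> cadd C D = cadd C E \<Longrightarrow> D = E"
  using cadd_cancel_aux[of C D E] cadd_cancel_aux[of C E D] by auto

lemma cadd_eq_czero:
  assumes C: "ncut C" and D: "ncut D" and eq: "cadd C D = czero"
  shows "C = czero"
proof (rule ccontr)
  assume "C \<noteq> czero"
  then obtain x where x: "x \<in> C" "0 < x" using ncut_pos[OF C] by blast
  moreover from this have "- (x / 2) \<in> D" using ncut_neg[OF D, of "- (x / 2)"] by simp
  ultimately have "x + - (x / 2) \<in> cadd C D" unfolding cadd_def by blast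
  then show False unfolding eq czero_def using x by simp
qed

lemma cmult_eq_czero:
  assumes C: "ncut C" and D: "ncut D" and eq: "cmult C D = czero"
  shows "C = czero \<or> D = czero"
proof (rule ccontr)
  assume nz: "\<not> (C = czero \<or> D = czero)"
  obtain x where "x \<in> C" "0 < x" using ncut_pos[OF C] nz by blast
  moreover obtain y where "y \<in> D" "0 < y" using ncut_pos[OF D] nz by blast
  ultimately have x: "x \<in> C" "0 < x" "y \<in> D" "0 < y" by simp_all
  then have "x * y \<in> cmult C D" unfolding cmult_def by blast
  then show False unfolding eq czero_def using mult_pos_pos[OF x(2,4)] by simp
qed

lemma cinv:
  assumes D: "ncut D" and arch: "arch D" and nz: "D \<noteq> czero"
  shows "ncut (cinv D)" "cmult D (cinv D) = cone"
proof -
  obtain p where p: "p \<in> D" "0 < p" using ncut_pos[OF D nz] by blast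
  have out: "p < s" if "s \<notin> D" for s using ncut_less[OF D p(1) that] .
  obtain b where b: "b \<notin> D" using ncut_bound[OF D] by blast
  show ci: "ncut (cinv D)"
  proof (rule ncutI[of _ "1 / p"])
    show "q \<in> cinv D" if "q < 0" for q
    proof -
      have "q * b < 0" using that out[OF b] p by (simp add: mult_neg_pos)
      then show ?thesis using b unfolding cinv_def by force
    qed
    show "1 / p \<notin> cinv D"
      using out p unfolding cinv_def by (auto simp: field_simps) (meson not_less_iff_gr_or_eq)
    show "y \<in> cinv D" if x: "x \<in> cinv D" "y < x" for x y
    proof -
      obtain s where s: "s \<notin> D" "x * s < 1" using x unfolding cinv_def by blast
      have "y * s < x * s" using x out[OF s(1)] p by simp
      then show ?thesis using s unfolding cinv_def by force
    qed
    show "\<exists>y. y \<in> cinv D \<and> x < y" if x: "x \<in> cinv D" for x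
    proof -
      obtain s where s: "s \<notin> D" "x * s < 1" using x unfolding cinv_def by blast
      have "0 < s" using out[OF s(1)] p by simp
      then have "(x + 1 / s) / 2 * s < 1" "x < (x + 1 / s) / 2" using s by (simp_all add: field_simps)
      then show ?thesis using s unfolding cinv_def by blast
    qed
  qed
  show "cmult D (cinv D) = cone"
  proof (intro set_eqI iffI)
    fix q assume q: "q \<in> cmult D (cinv D)"
    show "q \<in> cone"
    proof (cases "q < 0")
      case False
      then obtain x y s where x: "x \<in> D" "0 < x" "0 < y" "q \<le> x * y" "s \<notin> D" "y * s < 1"
        using q unfolding cmult_def cinv_def by blast
      have "x * y < s * y" using ncut_less[OF D x(1,5)] x by simp
      also have "\<dots> < 1" using x(6) by (simp add: mult.commute)
      finally show ?thesis using x(4) by (simp add: cone_def)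
    qed (simp add: cone_def)
  next
    fix q :: 'a assume q: "q \<in> cone"
    show "q \<in> cmult D (cinv D)"
    proof (cases "q < 0")
      case False
      then have q: "0 \<le> q" "q < 1" using q by (simp_all add: cone_def)
      \<comment> \<open>Chosen so that \<open>q * e < p * (1 - q)\<close>; for every
        \<open>x\<close> at least \<open>p\<close> this gives \<open>q * (x + e) < x\<close>, which
        leaves room for \<open>y\<close> between \<open>q / x\<close> and
        \<open>1 / (x + e)\<close>.\<close>
      define e where "e = p * (1 - q) / 2"
      have e: "0 < e" using p q by (simp add: e_def)
      then obtain x0 where x0: "x0 \<in> D" "x0 + e \<notin> D" using arch unfolding arch_def by blast
      \<comment> \<open>Raising \<open>x0\<close> to at least \<open>p\<close> stays within
        \<open>D\<close>, and \<open>x + e\<close> remains outside because it is no smaller than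
        \<open>x0 + e\<close>.\<close>
      define x where "x = max x0 p"
      have x: "x \<in> D" "p \<le> x" using x0 p unfolding x_def max_def by auto
      have xe: "x + e \<notin> D" 
      proof
        assume "x + e \<in> D"
        moreover have "x0 + e \<le> x + e" by (simp add: x_def)
        ultimately show False using x0 ncut_lower[OF D, of "x + e" "x0 + e"] by (cases "x0 = x") auto
      qed
      have "p * (1 - q) \<le> x * (1 - q)" using x q by simp
      moreover have "q * e < p * (1 - q)"
      proof -
        have "q * e \<le> e" using q e by (simp add: mult_left_le_one_le)
        then show ?thesis using e by (simp add: e_def)
      qed
      ultimately have "q * (x + e) < x" by (simp add: algebra_simps)
      moreover have pos: "0 < x" "0 < x + e" using x p e by simp_all
      ultimately have lt: "q / x < 1 / (x + e)" by (simp add: field_simps)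
      obtain y where y: "q / x < y" "y < 1 / (x + e)" using dense[OF lt] by blast
      have "0 \<le> q / x" using q pos by simp
      then have "0 < y" using y(1) by (rule le_less_trans)
      with y have "0 < y" "q \<le> x * y" "y * (x + e) < 1" using pos by (simp_all add: field_simps)
      then show ?thesis using x xe pos unfolding cmult_def cinv_def by blast
    qed (simp add: cmult_def)
  qed
qed

lemma cadd_superset: "ncut C \<Longrightarrow> ncut D \<Longrightarrow> C \<subseteq> cadd C D"
proof
  fix q assume C: "ncut C" and D: "ncut D" and "q \<in> C"
  then obtain y where y: "y \<in> C" "q < y" using ncut_open by blast
  then have "q - y \<in> D" using ncut_neg[OF D, of "q - y"] by simp
  then show "q \<in> cadd C D" using y unfolding cadd_iff by blast
qed


section \<open>Fractions over discretely ordered semirings\<close>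

class dnsemi = nsemi +
  assumes discrete: "a \<noteq> 0 \<Longrightarrow> \<exists>b. a = b + 1"

definition ofn :: "'n::nsemi \<Rightarrow> 'n gr fract" where "ofn k = Fract (emb k) 1"

lemma ofn_simps: "ofn 0 = 0" "ofn (k + 1) = ofn k + 1"
  unfolding ofn_def by (simp_all add: emb_simps Zero_fract_def One_fract_def)

text \<open>By discreteness a positive denominator is a successor \<open>n + 1\<close>. Hence every
  triple of numbers denotes a fraction, and no code has to be excluded later.\<close>

lemma fract_form:
  fixes q :: "'n::dnsemi gr fract"
  shows "\<exists>a b n. q = Fract (emb a - emb b) (emb n + 1)"
proof -
  obtain x y where q: "q = Fract x y" "y \<noteq> 0" by (cases q) auto
  have "\<exists>x y. q = Fract x y \<and> 0 < y"
  proof (cases "0 < y")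
    case False
    then have "0 < - y" "q = Fract (- x) (- y)" using q by (simp_all add: eq_fract)
    then show ?thesis by blast
  qed (use q in blast)
  then obtain x y where q: "q = Fract x y" "0 < y" by blast
  obtain c where c: "y = emb c" using nonneg_emb[of y] q by auto
  then have "c \<noteq> 0" using q by (auto simp: emb_simps)
  then obtain n where "c = n + 1" using discrete by blast
  moreover obtain a b where "x = emb a - emb b" using gr_diff by blast
  ultimately show ?thesis using q c by (auto simp: emb_simps)
qed

text \<open>Archimedean only relative to the numbers of type \<open>'n\<close>: as the denominator
  is at least 1, the fraction is at most \<open>a\<close>.\<close>

lemma ofn_unbounded:
  fixes q :: "'n::dnsemi gr fract"
  shows "\<exists>k. q \<le> ofn k"
proof -
  obtain a b n where q: "q = Fract (emb a - emb b) (emb n + 1)" using fract_form by blast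
  have 1: "0 < emb n + (1 :: 'n gr)" using emb_nonneg[of n] by (simp add: add_nonneg_pos)
  have "(emb a - emb b) * 1 \<le> emb a * (emb n + 1)"
    using emb_nonneg[of a] emb_nonneg[of b] emb_nonneg[of n] by (simp add: algebra_simps mult_nonneg_nonneg)
  then have "q \<le> ofn a" using 1 unfolding q ofn_def by (simp add: le_fract)
  then show ?thesis by blast
qed

text \<open>If adding \<open>d\<close> never left \<open>C\<close>, induction from -1 would put all
  \<open>- 1 + ofn k * d\<close> into \<open>C\<close>, and these are unbounded. The induction over
  \<open>'n\<close> is left as a premise, as it holds only for suitable \<open>C\<close>.\<close>

lemma arch_of_induct:
  fixes C :: "'n::dnsemi gr fract set"
  assumes C: "ncut C"
    and induct: "\<And>x d. x \<in> C \<Longrightarrow> (\<And>k. x + ofn k * d \<in> C \<Longrightarrow> x + ofn k * d + d \<in> C) \<Longrightarrow>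
      (\<And>k. x + ofn k * d \<in> C)"
  shows "arch C"
  unfolding arch_def
proof (intro HOL.allI HOL.impI)
  fix d :: "'n gr fract" assume d: "0 < d"
  show "\<exists>x. x \<in> C \<and> x + d \<notin> C"
  proof (rule ccontr)
    assume "\<not> (\<exists>x. x \<in> C \<and> x + d \<notin> C)"
    moreover have "- 1 \<in> C" using ncut_neg[OF C] by simp
    ultimately have all: "- 1 + ofn k * d \<in> C" for k using induct[of "- 1" d] by blast
    obtain b where b: "b \<notin> C" using ncut_bound[OF C] by blast
    obtain k where "(b + 1) / d \<le> ofn k" using ofn_unbounded by blast
    then have "b + 1 \<le> ofn k * d" using d by (simp add: pos_divide_le_eq)
    then have "b \<le> - 1 + ofn k * d" by simp
    moreover have "- 1 + ofn k * d < b" using ncut_less[OF C all b] .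
    ultimately show False by simp
  qed
qed


section \<open>Arithmetic in a model\<close>

context zf
begin

lemma add_commute: "n \<epsilon> om \<Longrightarrow> m \<epsilon> om \<Longrightarrow> add m n = add n m"
  by (induction n rule: om_induct) (intro dfn, auto)

lemma add_assoc: "k \<epsilon> om \<Longrightarrow> m \<epsilon> om \<Longrightarrow> n \<epsilon> om \<Longrightarrow> add (add m n) k = add m (add n k)"
  by (induction k rule: om_induct) (intro dfn, auto)

lemma add_left_commute: "k \<epsilon> om \<Longrightarrow> m \<epsilon> om \<Longrightarrow> n \<epsilon> om \<Longrightarrow> add m (add n k) = add n (add m k)"
  by (metis add_assoc add_commute)

lemma add_cancel: "k \<epsilon> om \<Longrightarrow> m \<epsilon> om \<Longrightarrow> n \<epsilon> om \<Longrightarrow> add k m = add k n \<Longrightarrow> m = n"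
proof (induction k rule: om_induct)
  case definable show ?case by (intro dfn)
qed auto

lemma add_eq_emp: "m \<epsilon> om \<Longrightarrow> n \<epsilon> om \<Longrightarrow> add m n = emp \<Longrightarrow> m = emp"
  using om_cases[of m] by auto

lemma nat_diff_ex: "m \<epsilon> om \<Longrightarrow> n \<epsilon> om \<Longrightarrow> \<exists>d. d \<epsilon> om \<and> (m = add n d \<or> n = add m d)"
proof (induction m rule: om_induct)
  case definable show ?case by (intro dfn)
next
  case zero then show ?case by (intro exI[of _ n]) simp
next
  case (suc m)
  then obtain d where d: "d \<epsilon> om" "m = add n d \<or> n = add m d" by blast
  from d(2) show ?case
  proof
    assume "m = add n d"
    then show ?thesis using d suc by (intro exI[of _ "suc d"]) simp
  next
    assume n: "n = add m d"
    consider "d = emp" | k where "k \<epsilon> om" "d = suc k" using om_cases[OF d(1)] by blast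
    then show ?thesis
    proof cases
      case 1
      then show ?thesis using n suc by (intro exI[of _ "suc emp"]) simp
    next
      case 2
      then show ?thesis using n suc by (intro exI[of _ k]) simp
    qed
  qed
qed

definition mul :: "'a \<Rightarrow> 'a \<Rightarrow> 'a" where
  "mul m n = rc emp (lam om (\<lambda>x. add x m)) n"

lemma T_mul [dfn]: "T s \<Longrightarrow> T t \<Longrightarrow> T (\<lambda>e. mul (s e) (t e))"
  by (rule T2[of mul], unfold mul_def, intro dfn)

lemma fn_add: "m \<epsilon> om \<Longrightarrow> fn (lam om (\<lambda>x. add x m)) om om"
  by (rule fn_lam) (auto intro: dfn)

lemma mul_in [simp]: "m \<epsilon> om \<Longrightarrow> n \<epsilon> om \<Longrightarrow> mul m n \<epsilon> om"
  unfolding mul_def by (rule rc_in[OF fn_add]) simp_all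

lemma mul_zero [simp]: "m \<epsilon> om \<Longrightarrow> mul m emp = emp"
  unfolding mul_def by (rule rc_zero[OF fn_add]) simp_all

lemma mul_suc [simp]: "m \<epsilon> om \<Longrightarrow> n \<epsilon> om \<Longrightarrow> mul m (suc n) = add (mul m n) m"
proof -
  assume *: "m \<epsilon> om" "n \<epsilon> om"
  have "T (\<lambda>e. add (e 0) m)" by (intro dfn)
  then show ?thesis
    using rc_suc[OF fn_add[OF *(1)] zero_om *(2)] mul_in[OF *] by (simp add: mul_def)
qed

lemma zero_mul [simp]: "n \<epsilon> om \<Longrightarrow> mul emp n = emp"
  by (induction n rule: om_induct) (intro dfn, auto)

lemma suc_mul [simp]: "n \<epsilon> om \<Longrightarrow> m \<epsilon> om \<Longrightarrow> mul (suc m) n = add (mul m n) n"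
proof (induction n rule: om_induct)
  case definable show ?case by (intro dfn)
next
  case zero then show ?case by simp
next
  case (suc n)
  then show ?case by (simp add: add_assoc add_commute[of m n])
qed

lemma mul_commute: "n \<epsilon> om \<Longrightarrow> m \<epsilon> om \<Longrightarrow> mul m n = mul n m"
  by (induction n rule: om_induct) (intro dfn, auto)

lemma mul_distrib: "k \<epsilon> om \<Longrightarrow> m \<epsilon> om \<Longrightarrow> n \<epsilon> om \<Longrightarrow> mul (add m n) k = add (mul m k) (mul n k)"
proof (induction k rule: om_induct)
  case definable show ?case by (intro dfn)
next
  case zero then show ?case by simp
next
  case (suc k)
  then show ?case by (simp add: add_assoc add_left_commute[where m = "mul n k" and n = m and k = n])
qed

lemma mul_assoc: "k \<epsilon> om \<Longrightarrow> m \<epsilon> om \<Longrightarrow> n \<epsilon> om \<Longrightarrow> mul (mul m n) k = mul m (mul n k)"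
proof (induction k rule: om_induct)
  case definable show ?case by (intro dfn)
next
  case zero then show ?case by simp
next
  case (suc k)
  then show ?case
    by (simp add: mul_commute[of "add (mul n k) n" m] mul_distrib mul_commute[of m "mul n k"] mul_commute[of m n])
qed

lemma mul_eq_emp: "m \<epsilon> om \<Longrightarrow> n \<epsilon> om \<Longrightarrow> mul m n = emp \<Longrightarrow> m = emp \<or> n = emp"
  using om_cases[of m] om_cases[of n] by auto

text \<open>
  \<open>V dec t\<close> extends the notion of definability to terms with values in a type other than the
  universe, whose elements are coded by elements of the model via \<open>dec\<close>.
\<close>

definition V :: "('a \<Rightarrow> 'b) \<Rightarrow> ((nat \<Rightarrow> 'a) \<Rightarrow> 'b) \<Rightarrow> bool" where
  "V dec t \<longleftrightarrow> D (\<lambda>e. dec (e 0) = t (\<lambda>n. e (Suc n)))"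

text \<open>All that has to be known about a decoding is that having equal decoded values is a
  definable relation between codes.\<close>

lemma V_term: "D (\<lambda>e. dec (e 0) = dec (e (Suc 0))) \<Longrightarrow> T t \<Longrightarrow> V dec (\<lambda>e. dec (t e))"
  unfolding V_def by (rule D2[where R = "\<lambda>x y. dec x = dec y"], assumption, rule T_var, erule T_weaken)

lemma V_const: "D (\<lambda>e. dec (e 0) = dec (e (Suc 0))) \<Longrightarrow> surj dec \<Longrightarrow> V dec (\<lambda>e. c)"
  using V_term[of dec "\<lambda>e. k" for k, OF _ T_const] by (metis surjD)

lemma V_weaken: "V dec s \<Longrightarrow> V dec (\<lambda>e. s (\<lambda>n. e (Suc n)))"
proof -
  assume "V dec s"
  from D_reindex[OF this[unfolded V_def], of "case_nat (\<lambda>e. e 0) (\<lambda>k e. e (Suc (Suc k)))"]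
  show ?thesis unfolding V_def by (simp split: nat.split)
qed

text \<open>The value lies outside the universe, so a code of it is quantified instead.\<close>

lemma V_subst:
  assumes "surj dec" "V dec s" "D (\<lambda>e. P (\<lambda>n. e (Suc n)) (dec (e 0)))"
  shows "D (\<lambda>e. P e (s e))"
proof -
  have "D (\<lambda>e. \<exists>x. dec x = s e \<and> P e (dec x))"
    by (rule D_ex, rule D_and) (use assms(2,3) in \<open>simp_all add: V_def\<close>)
  moreover have "(\<exists>x. dec x = s e \<and> P e (dec x)) \<longleftrightarrow> P e (s e)" for e
    using surjD[OF assms(1), of "s e"] by metis
  ultimately show ?thesis by simp
qed

lemma V_D2:
  assumes "surj dec" "surj dec'" "D (\<lambda>e. R (dec (e 0)) (dec' (e (Suc 0))))" "V dec s" "V dec' t"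
  shows "D (\<lambda>e. R (s e) (t e))"
  by (rule V_subst[where P = "\<lambda>e. R (s e)", OF assms(2) assms(5)],
      rule V_subst[where P = "\<lambda>e x. R x (dec' (e 0))", OF assms(1) V_weaken[OF assms(4)]], fact)

lemma V_fun1:
  assumes "surj dec" "D (\<lambda>e. dec' (e (Suc 0)) = F (dec (e 0)))" "V dec s"
  shows "V dec' (\<lambda>e. F (s e))"
  unfolding V_def
  by (rule V_subst[where P = "\<lambda>e x. dec' (e 0) = F x", OF assms(1) V_weaken[OF assms(3)]], fact)

lemma V_fun2:
  assumes "surj dec" "surj dec'" "D (\<lambda>e. dec'' (e (Suc (Suc 0))) = F (dec (e 0)) (dec' (e (Suc 0))))"
    "V dec s" "V dec' t"
  shows "V dec'' (\<lambda>e. F (s e) (t e))"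
  unfolding V_def
  by (rule V_subst[where P = "\<lambda>e x. dec'' (e 0) = F (s (\<lambda>n. e (Suc n))) x", OF assms(2) V_weaken[OF assms(5)]],
      rule V_subst[where P = "\<lambda>e x. dec'' (e (Suc 0)) = F x (dec' (e 0))", OF assms(1) V_weaken[OF V_weaken[OF assms(4)]]],
      fact)

lemma V_all: "surj dec \<Longrightarrow> D (\<lambda>e. P (\<lambda>n. e (Suc n)) (dec (e 0))) \<Longrightarrow> D (\<lambda>e. \<forall>q. P e q)"
proof -
  assume "surj dec" and P: "D (\<lambda>e. P (\<lambda>n. e (Suc n)) (dec (e 0)))"
  then have "(\<forall>q. P e q) \<longleftrightarrow> (\<forall>x. P e (dec x))" for e by (metis surjD)
  then show ?thesis using D_all[of "\<lambda>e x. P e (dec x)", OF P] by simp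
qed

lemma V_ex: "surj dec \<Longrightarrow> D (\<lambda>e. P (\<lambda>n. e (Suc n)) (dec (e 0))) \<Longrightarrow> D (\<lambda>e. \<exists>q. P e q)"
  using D_not[OF V_all[of dec "\<lambda>e q. \<not> P e q"]] D_not by simp

definition pr1 :: "'a \<Rightarrow> 'a" where "pr1 p = pick (uni p) (\<lambda>x. \<exists>y. p = pair x y)"
definition pr2 :: "'a \<Rightarrow> 'a" where "pr2 p = pick (uni p) (\<lambda>y. \<exists>x. p = pair x y)"

lemma T_pr [dfn]: "T t \<Longrightarrow> T (\<lambda>e. pr1 (t e))" "T t \<Longrightarrow> T (\<lambda>e. pr2 (t e))"
  by (rule T1[of pr1], unfold pr1_def, intro dfn, assumption)
    (rule T1[of pr2], unfold pr2_def, intro dfn)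

lemma pr [simp]: "pr1 (pair x y) = x" "pr2 (pair x y) = y"
  unfolding pr1_def pr2_def
  by (rule pick, intro dfn, auto intro: exI[of _ "upr x y"] simp: pair_mem)+

end

text \<open>\<open>ab\<close> identifies \<open>om\<close> with a HOL type, so that types built
  generically over \<open>'n\<close> can be interpreted in the model.\<close>

locale zf_nat = zf E for E :: "'a \<Rightarrow> 'a \<Rightarrow> bool" (infix "\<epsilon>" 50) +
  fixes ab :: "'a \<Rightarrow> 'n::dnsemi"
  assumes ab_inj: "m \<epsilon> om \<Longrightarrow> n \<epsilon> om \<Longrightarrow> ab m = ab n \<Longrightarrow> m = n"
    and ab_surj: "\<exists>n. n \<epsilon> om \<and> ab n = k"
    and ab_zero: "ab emp = 0"
    and ab_one: "ab (suc emp) = 1"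
    and ab_add: "m \<epsilon> om \<Longrightarrow> n \<epsilon> om \<Longrightarrow> ab (add m n) = ab m + ab n"
    and ab_mul: "m \<epsilon> om \<Longrightarrow> n \<epsilon> om \<Longrightarrow> ab (mul m n) = ab m * ab n"
begin

lemma ab_suc: "n \<epsilon> om \<Longrightarrow> ab (suc n) = ab n + 1"
  using ab_add[of n "suc emp"] by (simp add: ab_one)

text \<open>The default value 0 lets every element of the universe code a number, so quantifiers
  over codes need no restriction.\<close>

definition nn :: "'a \<Rightarrow> 'a" where "nn x = (if x \<epsilon> om then x else emp)"
definition nb :: "'a \<Rightarrow> 'n" where "nb x = ab (nn x)"

lemma T_nn [dfn]: "T t \<Longrightarrow> T (\<lambda>e. nn (t e))"
  by (rule T1[of nn], unfold nn_def, intro dfn)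

lemma nn_om [simp]: "nn x \<epsilon> om"
  by (simp add: nn_def)

lemma nb_eq: "nb x = nb y \<longleftrightarrow> nn x = nn y"
  using ab_inj[OF nn_om nn_om, of x y] by (auto simp: nb_def)

lemma nb_om: "x \<epsilon> om \<Longrightarrow> nb x = ab x"
  by (simp add: nb_def nn_def)

lemma surj_nb: "surj nb"
  using ab_surj nb_om by (metis surjI)

lemma D_nb0: "D (\<lambda>e. nb (e 0) = nb (e (Suc 0)))"
  unfolding nb_eq by (intro dfn)

lemma V_nb [dfn]: "T t \<Longrightarrow> V nb (\<lambda>e. nb (t e))" "V nb (\<lambda>e. k)"
  by (rule V_term[OF D_nb0], assumption) (rule V_const[OF D_nb0 surj_nb])

lemma nb_op: "nb x + nb y = nb (add (nn x) (nn y))" "nb x * nb y = nb (mul (nn x) (nn y))"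
  by (simp_all add: nb_om ab_add ab_mul) (simp_all add: nb_def)

lemma V_nb_op [dfn]:
  assumes "V nb s" "V nb t"
  shows "V nb (\<lambda>e. s e + t e)" "V nb (\<lambda>e. s e * t e)"
proof -
  have "D (\<lambda>e. nb (e (Suc (Suc 0))) = nb (e 0) + nb (e (Suc 0)))"
    unfolding nb_op nb_eq by (intro dfn)
  then show "V nb (\<lambda>e. s e + t e)" using assms by (rule V_fun2[OF surj_nb surj_nb])
  have "D (\<lambda>e. nb (e (Suc (Suc 0))) = nb (e 0) * nb (e (Suc 0)))"
    unfolding nb_op nb_eq by (intro dfn)
  then show "V nb (\<lambda>e. s e * t e)" using assms by (rule V_fun2[OF surj_nb surj_nb])
qed

lemma D_nb_eq [dfn]: "V nb s \<Longrightarrow> V nb t \<Longrightarrow> D (\<lambda>e. s e = t e)"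
  by (rule V_D2[OF surj_nb surj_nb, where R = "(=)"]) (rule D_nb0)

lemmas D_nb_ex [dfn] = V_ex[OF surj_nb]

text \<open>With the next two definitions, the triple of \<open>i\<close>, \<open>j\<close> and
  \<open>k\<close> codes the fraction (i - j) / (k + 1).\<close>

definition fa :: "'a \<Rightarrow> 'n" where "fa x = nb (pr1 (pr1 x))"
definition fb :: "'a \<Rightarrow> 'n" where "fb x = nb (pr2 (pr1 x))"
definition fc :: "'a \<Rightarrow> 'n" where "fc x = nb (pr2 x) + 1"

lemma V_f [dfn]:
  "T t \<Longrightarrow> V nb (\<lambda>e. fa (t e))" "T t \<Longrightarrow> V nb (\<lambda>e. fb (t e))" "T t \<Longrightarrow> V nb (\<lambda>e. fc (t e))"
  unfolding fa_def fb_def fc_def by (intro dfn, assumption)+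

definition val :: "'a \<Rightarrow> 'n gr fract" where "val x = Fract (emb (fa x) - emb (fb x)) (emb (fc x))"

definition Qs :: 'a where "Qs = prd (prd om om) om"

lemma fc_pos: "0 < emb (fc x)"
  using emb_nonneg[of "nb (pr2 x)"] by (simp add: fc_def emb_simps add_nonneg_pos)

lemma val_Qs: "\<exists>x. x \<epsilon> Qs \<and> val x = q"
proof -
  obtain a b n where q: "q = Fract (emb a - emb b) (emb n + 1)" using fract_form by blast
  obtain i j k where "i \<epsilon> om" "ab i = a" "j \<epsilon> om" "ab j = b" "k \<epsilon> om" "ab k = n" using ab_surj by metis
  then have "pair (pair i j) k \<epsilon> Qs \<and> val (pair (pair i j) k) = q"
    by (simp add: Qs_def val_def fa_def fb_def fc_def nb_om q emb_simps)
  then show ?thesis by blast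
qed

lemma surj_val: "surj val"
  using val_Qs by (metis surjI)

lemma fc_nz: "emb (fc x) \<noteq> 0"
  using fc_pos[of x] by auto

lemma gr_eq: "emb a - emb b = emb c - emb d \<longleftrightarrow> a + d = c + b"
proof -
  have "emb a - emb b = emb c - emb d \<longleftrightarrow> emb a + emb d = emb c + emb b" by (auto simp: algebra_simps)
  then show ?thesis by (simp flip: emb_simps add: emb_eq)
qed

lemma fract_gr_eq:
  assumes "emb c \<noteq> 0" "emb c' \<noteq> 0"
  shows "Fract (emb a - emb b) (emb c) = Fract (emb a' - emb b') (emb c') \<longleftrightarrow> a * c' + b' * c = a' * c + b * c'"
  unfolding eq_fract(1)[OF assms] left_diff_distrib emb_simps(4)[symmetric] gr_eq ..

lemma gr_le: "emb a - emb b \<le> emb c - emb d \<longleftrightarrow> (\<exists>k. c + b = a + d + k)"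
proof -
  have "emb a - emb b \<le> emb c - emb d \<longleftrightarrow> emb a + emb d \<le> emb c + emb b" by (auto simp: algebra_simps)
  then show ?thesis by (simp flip: emb_simps add: emb_le)
qed

text \<open>Cross-multiplying and moving the negative parts to the other side turns relations
  between fractions into relations between sums and products of numbers, which \<open>dfn\<close>
  covers.\<close>

lemma val_eq: "val x = val y \<longleftrightarrow> fa x * fc y + fb y * fc x = fa y * fc x + fb x * fc y"
  unfolding val_def by (rule fract_gr_eq) (rule fc_nz)+

lemma val_le: "val x \<le> val y \<longleftrightarrow> (\<exists>k. fa y * fc x + fb x * fc y = fa x * fc y + fb y * fc x + k)"
proof -
  have "val x \<le> val y \<longleftrightarrow> (emb (fa x) - emb (fb x)) * emb (fc y) \<le> (emb (fa y) - emb (fb y)) * emb (fc x)"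
    unfolding val_def using fc_pos[of x] fc_pos[of y] by (simp add: le_fract)
  then show ?thesis by (simp add: left_diff_distrib gr_le flip: emb_simps(3,4))
qed

lemma val_add: "val w = val x + val y \<longleftrightarrow>
   fa w * (fc x * fc y) + (fb x * fc y + fb y * fc x) * fc w = (fa x * fc y + fa y * fc x) * fc w + fb w * (fc x * fc y)"
proof -
  have "val x + val y = Fract (emb (fa x * fc y + fa y * fc x) - emb (fb x * fc y + fb y * fc x)) (emb (fc x * fc y))"
    unfolding val_def by (simp add: fc_nz emb_simps algebra_simps)
  moreover have nz: "emb (fc x * fc y) \<noteq> 0" by (simp add: emb_simps fc_nz)
  ultimately show ?thesis unfolding val_def[of w] by (simp only: fract_gr_eq[OF fc_nz nz])
qed

lemma val_mult: "val w = val x * val y \<longleftrightarrow>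
   fa w * (fc x * fc y) + (fa x * fb y + fb x * fa y) * fc w = (fa x * fa y + fb x * fb y) * fc w + fb w * (fc x * fc y)"
proof -
  have "val x * val y = Fract (emb (fa x * fa y + fb x * fb y) - emb (fa x * fb y + fb x * fa y)) (emb (fc x * fc y))"
    unfolding val_def by (simp add: fc_nz emb_simps algebra_simps)
  moreover have nz: "emb (fc x * fc y) \<noteq> 0" by (simp add: emb_simps fc_nz)
  ultimately show ?thesis unfolding val_def[of w] by (simp only: fract_gr_eq[OF fc_nz nz])
qed

lemma val_ofn: "val x = ofn k \<longleftrightarrow> fa x = k * fc x + fb x"
proof -
  have "val x = ofn k \<longleftrightarrow> emb (fa x) - emb (fb x) = emb (k * fc x) - emb 0"
    unfolding val_def ofn_def by (simp add: eq_fract fc_nz emb_simps)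
  then show ?thesis unfolding gr_eq by simp
qed

lemma D_val0: "D (\<lambda>e. val (e 0) = val (e (Suc 0)))"
  unfolding val_eq by (intro dfn)

lemma V_val [dfn]: "T t \<Longrightarrow> V val (\<lambda>e. val (t e))" "V val (\<lambda>e. q)"
  by (rule V_term[OF D_val0], assumption) (rule V_const[OF D_val0 surj_val])

lemma V_val_op [dfn]:
  assumes "V val s" "V val t"
  shows "V val (\<lambda>e. s e + t e)" "V val (\<lambda>e. s e * t e)"
proof -
  have "D (\<lambda>e. val (e (Suc (Suc 0))) = val (e 0) + val (e (Suc 0)))" unfolding val_add by (intro dfn)
  then show "V val (\<lambda>e. s e + t e)" using assms by (rule V_fun2[OF surj_val surj_val])
  have "D (\<lambda>e. val (e (Suc (Suc 0))) = val (e 0) * val (e (Suc 0)))" unfolding val_mult by (intro dfn)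
  then show "V val (\<lambda>e. s e * t e)" using assms by (rule V_fun2[OF surj_val surj_val])
qed

lemma V_val_ofn [dfn]: "V nb t \<Longrightarrow> V val (\<lambda>e. ofn (t e))"
  by (rule V_fun1[OF surj_nb]) (unfold val_ofn, intro dfn)

lemma D_val_eq [dfn]: "V val s \<Longrightarrow> V val t \<Longrightarrow> D (\<lambda>e. s e = t e)"
  by (rule V_D2[OF surj_val surj_val, where R = "(=)"]) (rule D_val0)

lemma D_val_le [dfn]: "V val s \<Longrightarrow> V val t \<Longrightarrow> D (\<lambda>e. s e \<le> t e)"
  by (rule V_D2[OF surj_val surj_val, where R = "(\<le>)"]) (unfold val_le, intro dfn)

lemma D_val_less [dfn]: "V val s \<Longrightarrow> V val t \<Longrightarrow> D (\<lambda>e. s e < t e)"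
  unfolding not_le[symmetric] by (intro dfn)

lemmas D_val_quant [dfn] = V_all[OF surj_val] V_ex[OF surj_val]

definition VS :: "((nat \<Rightarrow> 'a) \<Rightarrow> 'n gr fract set) \<Rightarrow> bool" where
  "VS S \<longleftrightarrow> D (\<lambda>e. val (e 0) \<in> S (\<lambda>n. e (Suc n)))"

text \<open>Definability with parameters from the model. It holds of every \<open>cutof c\<close>,
  and by separation every such set arises in this way.\<close>

definition coded :: "'n gr fract set \<Rightarrow> bool" where
  "coded C \<longleftrightarrow> D (\<lambda>e. val (e 0) \<in> C)"

definition cutof :: "'a \<Rightarrow> 'n gr fract set" where
  "cutof c = {q. \<exists>x. x \<epsilon> c \<and> val x = q}"

lemma VS_const [dfn]: "coded C \<Longrightarrow> VS (\<lambda>e. C)"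
  by (simp add: coded_def VS_def)

lemma D_in [dfn]: "V val t \<Longrightarrow> VS S \<Longrightarrow> D (\<lambda>e. t e \<in> S e)"
  unfolding VS_def by (rule V_subst[OF surj_val])

lemma VS_cutof [dfn]: "T t \<Longrightarrow> VS (\<lambda>e. cutof (t e))"
proof -
  assume t: "T t"
  have "D (\<lambda>e. val (e 0) \<in> cutof (e (Suc 0)))" unfolding cutof_def mem_Collect_eq by (intro dfn)
  then show ?thesis unfolding VS_def
    by (rule D2[where R = "\<lambda>x c. val x \<in> cutof c"]) (intro T_weaken dfn t)+
qed

lemma coded_Collect: "D (\<lambda>e. P (val (e 0))) \<Longrightarrow> coded {q. P q}"
  unfolding coded_def by simp

lemma coded_ops:
  "coded czero" "coded cone"
  "coded C \<Longrightarrow> coded C' \<Longrightarrow> coded (cadd C C')"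
  "coded C \<Longrightarrow> coded C' \<Longrightarrow> coded (cmult C C')"
  "coded C \<Longrightarrow> coded C' \<Longrightarrow> coded (cdiff C C')"
  "coded C \<Longrightarrow> coded (cinv C)"
  unfolding czero_def cone_def cadd_def cmult_def cdiff_def cinv_def
  by (rule coded_Collect, intro dfn; assumption)+

lemma coded_cutof: "coded (cutof c)"
  unfolding coded_def by (intro dfn)

text \<open>This is where definability pays off: it permits induction along the possibly nonstandard
  \<open>om\<close>, as \<open>arch_of_induct\<close> demands.\<close>

lemma coded_arch:
  assumes C: "ncut C" and coded: "coded C"
  shows "arch C"
proof (rule arch_of_induct[OF C])
  fix x d k
  assume x: "x \<in> C" and step: "\<And>k. x + ofn k * d \<in> C \<Longrightarrow> x + ofn k * d + d \<in> C"
  obtain n where n: "n \<epsilon> om" "ab n = k" using ab_surj by blast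
  from n(1) have "x + ofn (nb n) * d \<in> C"
  proof (induction n rule: om_induct)
    case definable show ?case by (intro dfn coded)
  next
    case zero
    then show ?case using x by (simp add: nb_om ab_zero ofn_simps)
  next
    case (suc n)
    have "ofn (nb (suc n)) = ofn (nb n) + 1" using suc by (simp add: nb_om ab_suc ofn_simps)
    then show ?case using step[of "nb n"] suc by (simp add: distrib_right add.assoc)
  qed
  then show "x + ofn k * d \<in> C" using n by (simp add: nb_om)
qed

end


section \<open>Existence of the reals in a model\<close>

definition has_reals :: "(nat \<Rightarrow> nat \<Rightarrow> bool) \<Rightarrow> bool" where
  "has_reals E \<longleftrightarrow> (\<exists>R z u A M L. zf.reals E R z u A M L)"

text \<open>
  The natural numbers, rationals and reals of a model without reals, if there is one, are turned
  into types; otherwise these types are built from the genuine natural numbers.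
\<close>

definition isbad :: bool where "isbad \<longleftrightarrow> (\<exists>E. zf E \<and> \<not> has_reals E)"
definition E0 :: "nat \<Rightarrow> nat \<Rightarrow> bool" where "E0 = (SOME E. zf E \<and> \<not> has_reals E)"

lemma zf_E0: "isbad \<Longrightarrow> zf E0" and bad_E0: "isbad \<Longrightarrow> \<not> has_reals E0"
  unfolding isbad_def E0_def by (metis (mono_tags, lifting) someI_ex)+

definition N0 :: "nat set" where "N0 = {x. isbad \<longrightarrow> E0 x (zf.om E0)}"
definition zero0 :: nat where "zero0 = (if isbad then zf.emp E0 else 0)"
definition one0 :: nat where "one0 = (if isbad then zf.suc E0 (zf.emp E0) else 1)"
definition add0 :: "nat \<Rightarrow> nat \<Rightarrow> nat" where "add0 m n = (if isbad then zf.add E0 m n else m + n)"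
definition mul0 :: "nat \<Rightarrow> nat \<Rightarrow> nat" where "mul0 m n = (if isbad then zf.mul E0 m n else m * n)"

text \<open>The laws of \<open>dnsemi\<close> on a carrier set, so that they can be verified for
  \<open>om\<close> and for the genuine numbers before a type is carved out.\<close>

locale arithmetic =
  fixes N :: "'a set" and o1 o2 :: 'a and a m :: "'a \<Rightarrow> 'a \<Rightarrow> 'a"
  assumes closed: "o1 \<in> N" "o2 \<in> N" "x \<in> N \<Longrightarrow> y \<in> N \<Longrightarrow> a x y \<in> N" "x \<in> N \<Longrightarrow> y \<in> N \<Longrightarrow> m x y \<in> N"
    and a_assoc: "x \<in> N \<Longrightarrow> y \<in> N \<Longrightarrow> w \<in> N \<Longrightarrow> a (a x y) w = a x (a y w)"
    and a_comm: "x \<in> N \<Longrightarrow> y \<in> N \<Longrightarrow> a x y = a y x"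
    and a_unit: "x \<in> N \<Longrightarrow> a o1 x = x"
    and m_assoc: "x \<in> N \<Longrightarrow> y \<in> N \<Longrightarrow> w \<in> N \<Longrightarrow> m (m x y) w = m x (m y w)"
    and m_comm: "x \<in> N \<Longrightarrow> y \<in> N \<Longrightarrow> m x y = m y x"
    and m_unit: "x \<in> N \<Longrightarrow> m o2 x = x"
    and m_distrib: "x \<in> N \<Longrightarrow> y \<in> N \<Longrightarrow> w \<in> N \<Longrightarrow> m (a x y) w = a (m x w) (m y w)"
    and m_zero: "x \<in> N \<Longrightarrow> m o1 x = o1"
    and o1_o2: "o1 \<noteq> o2"
    and a_cancel: "x \<in> N \<Longrightarrow> y \<in> N \<Longrightarrow> w \<in> N \<Longrightarrow> a x y = a x w \<Longrightarrow> y = w"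
    and a_zero: "x \<in> N \<Longrightarrow> y \<in> N \<Longrightarrow> a x y = o1 \<Longrightarrow> x = o1"
    and a_diff: "x \<in> N \<Longrightarrow> y \<in> N \<Longrightarrow> \<exists>d\<in>N. x = a y d \<or> y = a x d"
    and m_nz: "x \<in> N \<Longrightarrow> y \<in> N \<Longrightarrow> m x y = o1 \<Longrightarrow> x = o1 \<or> y = o1"
    and disc: "x \<in> N \<Longrightarrow> x \<noteq> o1 \<Longrightarrow> \<exists>y\<in>N. x = a y o2"

lemma (in zf) arithmetic_om: "arithmetic {x. x \<epsilon> om} emp (suc emp) add mul"
proof
  fix x y assume "x \<in> {x. x \<epsilon> om}" and y: "y \<in> {x. x \<epsilon> om}"
  then have x: "x \<epsilon> om" "y \<epsilon> om" by simp_all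
  show "add x y = add y x" using x(2,1) by (rule add_commute)
  show "mul x y = mul y x" using x(2,1) by (rule mul_commute)
  show "\<exists>d\<in>{x. x \<epsilon> om}. x = add y d \<or> y = add x d" using nat_diff_ex[OF x] by blast
  show "add x y = emp \<Longrightarrow> x = emp" using x by (rule add_eq_emp)
  show "mul x y = emp \<Longrightarrow> x = emp \<or> y = emp" using x by (rule mul_eq_emp)
next
  fix x y w assume "x \<in> {x. x \<epsilon> om}" "y \<in> {x. x \<epsilon> om}" "w \<in> {x. x \<epsilon> om}"
  then have x: "x \<epsilon> om" "y \<epsilon> om" "w \<epsilon> om" by simp_all
  show "add (add x y) w = add x (add y w)" using x(3,1,2) by (rule add_assoc)
  show "mul (mul x y) w = mul x (mul y w)" using x(3,1,2) by (rule mul_assoc)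
  show "mul (add x y) w = add (mul x w) (mul y w)" using x(3,1,2) by (rule mul_distrib)
  show "add x y = add x w \<Longrightarrow> y = w" using x by (rule add_cancel)
next
  fix x assume "x \<in> {x. x \<epsilon> om}" "x \<noteq> emp"
  then obtain y where "y \<epsilon> om" "x = suc y" using om_cases[of x] by auto
  then show "\<exists>y\<in>{x. x \<epsilon> om}. x = add y (suc emp)" by (intro bexI[of _ y]) simp_all
qed simp_all

lemma arithmetic_nat: "arithmetic UNIV 0 1 (+) ((*) :: nat \<Rightarrow> _)"
proof
  show "\<exists>d\<in>UNIV. x = y + d \<or> y = x + d" for x y :: nat by (simp, presburger)
  show "\<exists>y\<in>UNIV. x = y + 1" if "x \<noteq> 0" for x :: nat using that not0_implies_Suc by auto
qed (simp_all add: distrib_right)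

lemma arithmetic0: "arithmetic N0 zero0 one0 add0 mul0"
proof (cases isbad)
  case True
  then have "N0 = {x. E0 x (zf.om E0)}" "zero0 = zf.emp E0" "one0 = zf.suc E0 (zf.emp E0)"
    "add0 = zf.add E0" "mul0 = zf.mul E0"
    by (simp_all add: N0_def zero0_def one0_def add0_def mul0_def fun_eq_iff)
  then show ?thesis using zf.arithmetic_om[OF zf_E0[OF True]] by simp
next
  case False
  then have "N0 = UNIV" "zero0 = 0" "one0 = 1" "add0 = (+)" "mul0 = (*)"
    by (simp_all add: N0_def zero0_def one0_def add0_def mul0_def fun_eq_iff)
  then show ?thesis using arithmetic_nat by simp
qed

interpretation N0: arithmetic N0 zero0 one0 add0 mul0
  by (rule arithmetic0)

typedef mnat = N0
  using N0.closed(1) by blast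

setup_lifting type_definition_mnat

instantiation mnat :: dnsemi
begin

lift_definition zero_mnat :: mnat is zero0 by (rule N0.closed)
lift_definition one_mnat :: mnat is one0 by (rule N0.closed)
lift_definition plus_mnat :: "mnat \<Rightarrow> mnat \<Rightarrow> mnat" is add0 by (rule N0.closed)
lift_definition times_mnat :: "mnat \<Rightarrow> mnat \<Rightarrow> mnat" is mul0 by (rule N0.closed)

instance
proof
  fix a b c :: mnat
  show "a + b + c = a + (b + c)" by transfer (rule N0.a_assoc)
  show "a + b = b + a" by transfer (rule N0.a_comm)
  show "0 + a = a" by transfer (rule N0.a_unit)
  show "a * b * c = a * (b * c)" by transfer (rule N0.m_assoc)
  show "a * b = b * a" by transfer (rule N0.m_comm)
  show "1 * a = a" by transfer (rule N0.m_unit)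
  show "(a + b) * c = a * c + b * c" by transfer (rule N0.m_distrib)
  show "0 * a = 0" by transfer (rule N0.m_zero)
  show "a * 0 = 0" by transfer (simp add: N0.m_comm[of _ zero0] N0.m_zero N0.closed)
  show "(0 :: mnat) \<noteq> 1" by transfer (rule N0.o1_o2)
  show "a + b = a + c \<Longrightarrow> b = c" by transfer (rule N0.a_cancel)
  show "a + b = 0 \<Longrightarrow> a = 0" by transfer (rule N0.a_zero)
  show "\<exists>d. a = b + d \<or> b = a + d" by transfer (use N0.a_diff in auto)
  show "a * b = 0 \<Longrightarrow> a = 0 \<or> b = 0" by transfer (rule N0.m_nz)
  show "a \<noteq> 0 \<Longrightarrow> \<exists>b. a = b + 1" by transfer (use N0.disc in auto)
qed

end

lemma zf_nat_E0: "isbad \<Longrightarrow> zf_nat E0 Abs_mnat"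
proof -
  assume bad: isbad
  interpret zf E0 using zf_E0 bad .
  have N: "m \<in> N0 \<longleftrightarrow> E0 m om" for m using bad by (simp add: N0_def)
  show ?thesis
  proof
    show "E0 m om \<Longrightarrow> E0 n om \<Longrightarrow> Abs_mnat m = Abs_mnat n \<Longrightarrow> m = n" for m n
      using Abs_mnat_inject N by blast
    show "\<exists>n. E0 n om \<and> Abs_mnat n = k" for k
      using Rep_mnat[of k] Rep_mnat_inverse N by blast
    show "Abs_mnat emp = 0" using bad by (simp add: zero_mnat_def zero0_def)
    show "Abs_mnat (suc emp) = 1" using bad by (simp add: one_mnat_def one0_def)
    show "Abs_mnat (add m n) = Abs_mnat m + Abs_mnat n" if "E0 m om" "E0 n om" for m n
      using bad that N by (simp add: plus_mnat_def Abs_mnat_inverse add0_def)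
    show "Abs_mnat (mul m n) = Abs_mnat m * Abs_mnat n" if "E0 m om" "E0 n om" for m n
      using bad that N by (simp add: times_mnat_def Abs_mnat_inverse mul0_def)
  qed
qed

definition coded0 :: "mnat gr fract set \<Rightarrow> bool" where
  "coded0 C \<longleftrightarrow> (isbad \<longrightarrow> zf_nat.coded E0 Abs_mnat C)"

lemma coded0_ops:
  "coded0 czero" "coded0 cone"
  "coded0 C \<Longrightarrow> coded0 C' \<Longrightarrow> coded0 (cadd C C')"
  "coded0 C \<Longrightarrow> coded0 C' \<Longrightarrow> coded0 (cmult C C')"
  "coded0 C \<Longrightarrow> coded0 C' \<Longrightarrow> coded0 (cdiff C C')"
  "coded0 C \<Longrightarrow> coded0 (cinv C)"
  unfolding coded0_def using zf_nat.coded_ops[OF zf_nat_E0] by simp_all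

lemma coded0_arch:
  assumes C: "ncut C" and coded: "coded0 C"
  shows "arch C"
proof (cases isbad)
  case True
  then show ?thesis using zf_nat.coded_arch[OF zf_nat_E0] assms unfolding coded0_def by blast
next
  case False
  show ?thesis
  proof (rule arch_of_induct[OF C])
    fix x d k
    assume x: "x \<in> C" and step: "\<And>k. x + ofn k * d \<in> C \<Longrightarrow> x + ofn k * d + d \<in> C"
    have abs: "Abs_mnat 0 = 0" "Abs_mnat (Suc n) = Abs_mnat n + 1" for n
      using False by (simp_all add: zero_mnat_def zero0_def one_mnat_def one0_def plus_mnat_def add0_def
          Abs_mnat_inverse N0_def)
    have "x + ofn (Abs_mnat n) * d \<in> C" for n
    proof (induction n)
      case 0 then show ?case using x by (simp add: abs ofn_simps)
    next
      case (Suc n)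
      then show ?case using step[of "Abs_mnat n"] by (simp add: abs ofn_simps distrib_right add.assoc)
    qed
    from this[of "Rep_mnat k"] show "x + ofn k * d \<in> C" by (simp add: Rep_mnat_inverse)
  qed
qed

text \<open>The restriction to definable cuts makes them Archimedean and provides each of them with
  a code in the model.\<close>

typedef preal = "{C :: mnat gr fract set. ncut C \<and> coded0 C}"
  using ncut_czero coded0_ops(1) by blast

setup_lifting type_definition_preal

instantiation preal :: nsemi
begin

lift_definition zero_preal :: preal is czero by (simp add: ncut_czero coded0_ops)
lift_definition one_preal :: preal is cone by (simp add: ncut_cone coded0_ops)
lift_definition plus_preal :: "preal \<Rightarrow> preal \<Rightarrow> preal" is cadd by (simp add: ncut_cadd coded0_ops)
lift_definition times_preal :: "preal \<Rightarrow> preal \<Rightarrow> preal" is cmult by (simp add: ncut_cmult coded0_ops)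

instance
proof
  fix a b c :: preal
  \<comment> \<open>\<open>cdiff\<close> is only known to be a cut for a proper inclusion, so equal
    cuts are treated separately with difference zero.\<close>
  have diff: "\<exists>d. ncut d \<and> coded0 d \<and> B = cadd A d"
    if "ncut A" "coded0 A" "ncut B" "coded0 B" "A \<subseteq> B" for A B
  proof (cases "A = B")
    case True
    then show ?thesis using that cadd_czero[of A] cadd_commute[of A czero] ncut_czero coded0_ops(1)
      by (intro exI[of _ czero]) simp
  next
    case False
    then show ?thesis using cdiff[of A B] coded0_ops(5)[of B A] coded0_arch[of A] that
      by (intro exI[of _ "cdiff B A"]) simp
  qed
  show "a + b + c = a + (b + c)" by transfer (rule cadd_assoc)
  show "a + b = b + a" by transfer (rule cadd_commute)
  show "0 + a = a" by transfer (simp add: cadd_czero)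
  show "a * b * c = a * (b * c)" by transfer (rule cmult_assoc)
  show "a * b = b * a" by transfer (rule cmult_commute)
  show "1 * a = a" by transfer (simp add: cmult_cone)
  show "(a + b) * c = a * c + b * c"
    by transfer (simp add: cmult_cadd cmult_commute[of "cadd _ _"] cmult_commute[of _ "_ :: mnat gr fract set"])
  show "0 * a = 0" by transfer (rule cmult_czero)
  show "a * 0 = 0" by transfer (simp add: cmult_czero cmult_commute[of _ czero])
  show "(0 :: preal) \<noteq> 1"
  proof (transfer, rule notI)
    assume "(czero :: mnat gr fract set) = cone"
    moreover have "(0 :: mnat gr fract) \<in> cone" "(0 :: mnat gr fract) \<notin> czero" by (simp_all add: cone_def czero_def)
    ultimately show False by simp
  qed
  show "a + b = a + c \<Longrightarrow> b = c" by transfer (use cadd_cancel coded0_arch in blast)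
  show "a + b = 0 \<Longrightarrow> a = 0" by transfer (use cadd_eq_czero in blast)
  show "\<exists>d. a = b + d \<or> b = a + d"
  proof -
    have "\<exists>d. y = x + d" if sub: "Rep_preal x \<subseteq> Rep_preal y" for x y
    proof -
      obtain d where "ncut d" "coded0 d" "Rep_preal y = cadd (Rep_preal x) d"
        using diff[OF _ _ _ _ sub] Rep_preal[of x] Rep_preal[of y] by auto
      then have "y = x + Abs_preal d"
        unfolding Rep_preal_inject[symmetric] plus_preal.rep_eq by (simp add: Abs_preal_inverse)
      then show ?thesis by blast
    qed
    then show ?thesis using ncut_linear[of "Rep_preal a" "Rep_preal b"] Rep_preal[of a] Rep_preal[of b] by blast
  qed
  show "a * b = 0 \<Longrightarrow> a = 0 \<or> b = 0" by transfer (use cmult_eq_czero in blast)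
qed

end

lemma preal_inverse: "a \<noteq> 0 \<Longrightarrow> \<exists>b. a * b = (1 :: preal)"
  by transfer (use cinv coded0_arch coded0_ops(6) in blast)

lemma preal_le: "(\<exists>d. b = a + d) \<longleftrightarrow> Rep_preal a \<subseteq> Rep_preal b"
proof
  have R: "ncut (Rep_preal x)" for x using Rep_preal[of x] by simp
  show "Rep_preal a \<subseteq> Rep_preal b" if ex: "\<exists>d. b = a + d"
  proof -
    obtain d where "b = a + d" using ex by blast
    then show ?thesis using cadd_superset[OF R[of a] R[of d]] by (simp add: plus_preal.rep_eq)
  qed
  assume sub: "Rep_preal a \<subseteq> Rep_preal b"
  obtain d where "a = b + d \<or> b = a + d" using diff_ex by blast
  then show "\<exists>d. b = a + d"
  proof
    assume "a = b + d"
    then have "Rep_preal b \<subseteq> Rep_preal a" using cadd_superset[OF R[of b] R[of d]] by (simp add: plus_preal.rep_eq)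
    then have "b = a + 0" using sub Rep_preal_inject by simp
    then show ?thesis by blast
  qed blast
qed

lemma mreal_inverse:
  fixes x :: "preal gr"
  assumes "x \<noteq> 0"
  shows "\<exists>y. x * y = 1"
proof (cases x rule: gr_cases)
  case (1 a)
  then have "a \<noteq> 0" using assms by (auto simp: emb_simps)
  then obtain b where "a * b = 1" using preal_inverse by blast
  then show ?thesis using 1 by (intro exI[of _ "emb b"]) (simp flip: emb_simps(4), simp add: emb_simps)
next
  case (2 a)
  then obtain b where "a * b = 1" using preal_inverse by blast
  then show ?thesis using 2 by (intro exI[of _ "- emb b"]) (simp flip: emb_simps(4), simp add: emb_simps)
qed

section \<open>The complete ordered field of the fixed model\<close>

locale bad_model = zf_nat E0 Abs_mnat +
  assumes bad: isbad
begin

text \<open>Sets that code no cut decode to 0, so that again every element of the universe is a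
  code.\<close>

definition pdec :: "nat \<Rightarrow> preal" where
  "pdec c = (if ncut (cutof c) then Abs_preal (cutof c) else 0)"

lemma coded0: "coded0 C \<longleftrightarrow> coded C"
  using bad by (simp add: coded0_def)

lemma Rep_pdec: "Rep_preal (pdec c) = (if ncut (cutof c) then cutof c else czero)"
  unfolding pdec_def by (simp add: Abs_preal_inverse coded0 coded_cutof zero_preal.rep_eq)

text \<open>Among the sets that code the same cut, the one containing all codes in \<open>Qs\<close>
  is canonical.\<close>

definition enc :: "mnat gr fract set \<Rightarrow> nat" where
  "enc C = sep Qs (\<lambda>x. val x \<in> C)"

lemma cutof_enc: "coded C \<Longrightarrow> cutof (enc C) = C"
proof -
  assume "coded C"
  then have enc: "E0 x (enc C) \<longleftrightarrow> E0 x Qs \<and> val x \<in> C" for x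
    unfolding enc_def coded_def by (rule sep)
  show ?thesis
  proof (rule set_eqI)
    fix q
    obtain x where "E0 x Qs" "val x = q" using val_Qs by blast
    then show "q \<in> cutof (enc C) \<longleftrightarrow> q \<in> C" unfolding cutof_def enc by auto
  qed
qed

lemma coded_Rep: "coded (Rep_preal p)" and ncut_Rep: "ncut (Rep_preal p)"
  using Rep_preal[of p] coded0 by auto

lemma pdec_enc: "pdec (enc (Rep_preal p)) = p"
  unfolding pdec_def cutof_enc[OF coded_Rep] by (simp add: ncut_Rep Rep_preal_inverse)

lemma surj_pdec: "surj pdec"
  using pdec_enc by (rule surjI)

lemma D_ncut_cutof [dfn]: "T t \<Longrightarrow> D (\<lambda>e. ncut (cutof (t e)))"
  by (rule D1[where R = "\<lambda>c. ncut (cutof c)"], unfold ncut_def, intro dfn)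

lemma D_in_pdec: "D (\<lambda>e. val (e 0) \<in> Rep_preal (pdec (e (Suc 0))))"
proof -
  have "val x \<in> Rep_preal (pdec c) \<longleftrightarrow> ncut (cutof c) \<and> val x \<in> cutof c \<or> \<not> ncut (cutof c) \<and> val x < 0" for x c
    by (simp add: Rep_pdec czero_def)
  then show ?thesis by (simp only:) (intro dfn)
qed

lemma VS_pdec [dfn]: "T t \<Longrightarrow> VS (\<lambda>e. Rep_preal (pdec (t e)))"
  unfolding VS_def
  by (rule D2[where R = "\<lambda>x c. val x \<in> Rep_preal (pdec c)"], rule D_in_pdec, rule T_var, erule T_weaken)

lemma D_pdec0: "D (\<lambda>e. pdec (e 0) = pdec (e (Suc 0)))"
  unfolding Rep_preal_inject[symmetric] set_eq_iff by (intro dfn)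

lemma V_pdec [dfn]: "T t \<Longrightarrow> V pdec (\<lambda>e. pdec (t e))" "V pdec (\<lambda>e. p)"
  by (rule V_term[OF D_pdec0], assumption) (rule V_const[OF D_pdec0 surj_pdec])

lemma V_pdec_op [dfn]:
  assumes "V pdec s" "V pdec t"
  shows "V pdec (\<lambda>e. s e + t e)" "V pdec (\<lambda>e. s e * t e)"
proof -
  have "D (\<lambda>e. pdec (e (Suc (Suc 0))) = pdec (e 0) + pdec (e (Suc 0)))"
    unfolding Rep_preal_inject[symmetric] set_eq_iff plus_preal.rep_eq cadd_def mem_Collect_eq by (intro dfn)
  then show "V pdec (\<lambda>e. s e + t e)" using assms by (rule V_fun2[OF surj_pdec surj_pdec])
  have "D (\<lambda>e. pdec (e (Suc (Suc 0))) = pdec (e 0) * pdec (e (Suc 0)))"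
    unfolding Rep_preal_inject[symmetric] set_eq_iff times_preal.rep_eq cmult_def mem_Collect_eq by (intro dfn)
  then show "V pdec (\<lambda>e. s e * t e)" using assms by (rule V_fun2[OF surj_pdec surj_pdec])
qed

lemma D_pdec_eq [dfn]: "V pdec s \<Longrightarrow> V pdec t \<Longrightarrow> D (\<lambda>e. s e = t e)"
  by (rule V_D2[OF surj_pdec surj_pdec, where R = "(=)"]) (rule D_pdec0)

lemmas D_pdec_ex [dfn] = V_ex[OF surj_pdec]

definition p1 :: "nat \<Rightarrow> preal" where "p1 x = pdec (pr1 x)"
definition p2 :: "nat \<Rightarrow> preal" where "p2 x = pdec (pr2 x)"
definition rdec :: "nat \<Rightarrow> preal gr" where "rdec x = emb (p1 x) - emb (p2 x)"

lemma V_p [dfn]: "T t \<Longrightarrow> V pdec (\<lambda>e. p1 (t e))" "T t \<Longrightarrow> V pdec (\<lambda>e. p2 (t e))"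
  unfolding p1_def p2_def by (intro dfn, assumption)+

lemma rdec_eq: "rdec x = rdec y \<longleftrightarrow> p1 x + p2 y = p1 y + p2 x"
  unfolding rdec_def gr_eq by simp

lemma rdec_le: "rdec x \<le> rdec y \<longleftrightarrow> (\<exists>k. p1 y + p2 x = p1 x + p2 y + k)"
  unfolding rdec_def gr_le by simp

lemma rdec_add: "rdec w = rdec x + rdec y \<longleftrightarrow> p1 w + (p2 x + p2 y) = (p1 x + p1 y) + p2 w"
proof -
  have "rdec x + rdec y = emb (p1 x + p1 y) - emb (p2 x + p2 y)" by (simp add: rdec_def emb_simps)
  then show ?thesis unfolding rdec_def[of w] by (simp only: gr_eq)
qed

lemma rdec_mult: "rdec w = rdec x * rdec y \<longleftrightarrow>
    p1 w + (p1 x * p2 y + p2 x * p1 y) = (p1 x * p1 y + p2 x * p2 y) + p2 w"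
proof -
  have "rdec x * rdec y = emb (p1 x * p1 y + p2 x * p2 y) - emb (p1 x * p2 y + p2 x * p1 y)"
    by (simp add: rdec_def emb_simps algebra_simps)
  then show ?thesis unfolding rdec_def[of w] by (simp only: gr_eq)
qed

lemma rdec_emb: "rdec x = emb p + rdec y \<longleftrightarrow> p1 x + p2 y = (p + p1 y) + p2 x"
proof -
  have "emb p + rdec y = emb (p + p1 y) - emb (p2 y)" by (simp add: rdec_def emb_simps)
  then show ?thesis unfolding rdec_def[of x] by (simp only: gr_eq)
qed

text \<open>Only canonical codes are kept, so that equal cuts are the same element of the
  model.\<close>

definition PC :: nat where
  "PC = sep (Pw Qs) (\<lambda>c. ncut (cutof c) \<and> c = sep Qs (\<lambda>x. val x \<in> cutof c))"

lemma in_PC: "E0 c PC \<longleftrightarrow> ncut (cutof c) \<and> c = enc (cutof c)"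
proof -
  have "E0 c PC \<longleftrightarrow> E0 c (Pw Qs) \<and> ncut (cutof c) \<and> c = enc (cutof c)"
    unfolding PC_def enc_def by (rule sep) (intro dfn)
  moreover have "E0 x (enc (cutof c)) \<longleftrightarrow> E0 x Qs \<and> val x \<in> cutof c" for x
    unfolding enc_def by (rule sep) (intro dfn coded_cutof)
  ultimately show ?thesis unfolding in_Pw sub_def by metis
qed

lemma PC_enc: "E0 (enc (Rep_preal p)) PC"
  unfolding in_PC cutof_enc[OF coded_Rep] using ncut_Rep by blast

lemma PC_inj: "E0 c PC \<Longrightarrow> E0 d PC \<Longrightarrow> pdec c = pdec d \<Longrightarrow> c = d"
  unfolding in_PC by (metis Rep_pdec)

text \<open>A real is a difference in many ways; demanding that one of the two parts vanish leaves
  exactly one pair.\<close>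

definition RR :: nat where
  "RR = sep (prd PC PC) (\<lambda>x. p1 x = 0 \<or> p2 x = 0)"

lemma in_RR: "E0 x RR \<longleftrightarrow> E0 x (prd PC PC) \<and> (p1 x = 0 \<or> p2 x = 0)"
  unfolding RR_def by (rule sep) (intro dfn)

lemma RR_inj: "E0 x RR \<Longrightarrow> E0 y RR \<Longrightarrow> rdec x = rdec y \<longleftrightarrow> x = y"
proof -
  assume x: "E0 x RR" and y: "E0 y RR"
  have "x = y" if eq: "rdec x = rdec y"
  proof -
    have "p1 x + p2 y = p1 y + p2 x" using eq rdec_eq by simp
    moreover have "p1 x = 0 \<or> p2 x = 0" "p1 y = 0 \<or> p2 y = 0" using x y in_RR by auto
    ultimately have "p1 x = p1 y \<and> p2 x = p2 y"
      by (metis add.commute add.right_neutral add_eq_zero add_cancel)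
    moreover obtain a b where "x = pair a b" "E0 a PC" "E0 b PC" using x in_RR in_prd by auto
    moreover obtain c d where "y = pair c d" "E0 c PC" "E0 d PC" using y in_RR in_prd by auto
    ultimately show ?thesis using PC_inj by (simp add: p1_def p2_def)
  qed
  then show ?thesis by blast
qed

lemma RR_surj: "\<exists>x. E0 x RR \<and> rdec x = r"
proof (cases r rule: gr_cases)
  case (1 a)
  let ?x = "pair (enc (Rep_preal a)) (enc (Rep_preal 0))"
  have "E0 ?x RR \<and> rdec ?x = r"
    using 1 by (simp add: in_RR PC_enc p1_def p2_def pdec_enc rdec_def emb_simps)
  then show ?thesis by blast
next
  case (2 a)
  let ?x = "pair (enc (Rep_preal 0)) (enc (Rep_preal a))"
  have "E0 ?x RR \<and> rdec ?x = r"
    using 2 by (simp add: in_RR PC_enc p1_def p2_def pdec_enc rdec_def emb_simps)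
  then show ?thesis by blast
qed

definition cd :: "preal gr \<Rightarrow> nat" where "cd r = (SOME x. E0 x RR \<and> rdec x = r)"

lemma cd: "E0 (cd r) RR" "rdec (cd r) = r"
  using someI_ex[OF RR_surj[of r]] unfolding cd_def by blast+

definition graph :: "(nat \<Rightarrow> nat \<Rightarrow> nat \<Rightarrow> bool) \<Rightarrow> nat" where
  "graph P = sep (prd (prd RR RR) RR) (\<lambda>p. P (pr1 (pr1 p)) (pr2 (pr1 p)) (pr2 p))"

lemma opv_graph:
  assumes "D (\<lambda>e. P (e 0) (e (Suc 0)) (e (Suc (Suc 0))))"
  shows "opv (graph P) x y w \<longleftrightarrow> E0 x RR \<and> E0 y RR \<and> E0 w RR \<and> P x y w"
proof -
  have "E0 p (graph P) \<longleftrightarrow> E0 p (prd (prd RR RR) RR) \<and> P (pr1 (pr1 p)) (pr2 (pr1 p)) (pr2 p)" for p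
    unfolding graph_def by (rule sep) (intro D3[OF assms] dfn)
  then show ?thesis by (auto simp: opv_def)
qed

lemma opn_graph:
  assumes "D (\<lambda>e. P (e 0) (e (Suc 0)) (e (Suc (Suc 0))))"
    and "\<And>x y. E0 x RR \<Longrightarrow> E0 y RR \<Longrightarrow> \<exists>w. E0 w RR \<and> (\<forall>v. E0 v RR \<longrightarrow> P x y v \<longleftrightarrow> v = w)"
  shows "opn (graph P) RR"
proof -
  have *: "E0 p (graph P) \<longleftrightarrow> E0 p (prd (prd RR RR) RR) \<and> P (pr1 (pr1 p)) (pr2 (pr1 p)) (pr2 p)" for p
    unfolding graph_def by (rule sep) (intro D3[OF assms(1)] dfn)
  show ?thesis
    unfolding opn_def fn_def
  proof (intro conjI HOL.allI HOL.impI)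
    fix p assume "E0 p (graph P)"
    then show "\<exists>x y. E0 x (prd RR RR) \<and> E0 y RR \<and> p = pair x y" unfolding * in_prd by blast
  next
    fix p v w assume "E0 (pair p v) (graph P) \<and> E0 (pair p w) (graph P)"
    then show "v = w" unfolding * using assms(2) by (auto simp: in_prd) metis
  next
    fix p assume "E0 p (prd RR RR)"
    then obtain x y where "E0 x RR" "E0 y RR" "p = pair x y" by (auto simp: in_prd)
    moreover from this obtain w where "E0 w RR" "P x y w" using assms(2) by blast
    ultimately have "E0 (pair p w) (graph P)" unfolding * by simp
    then show "\<exists>w. E0 (pair p w) (graph P)" by blast
  qed
qed

lemma cmon_graph:
  assumes D: "D (\<lambda>e. rdec (e (Suc (Suc 0))) = F (rdec (e 0)) (rdec (e (Suc 0))))"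
    and F: "\<And>x y. F x y = F y x" "\<And>x y w. F (F x y) w = F x (F y w)" "\<And>x. F i x = x"
  shows "cmon RR (cd i) (graph (\<lambda>x y w. rdec w = F (rdec x) (rdec y)))"
proof -
  note o = opv_graph[OF D]
  have "opn (graph (\<lambda>x y w. rdec w = F (rdec x) (rdec y))) RR"
    by (rule opn_graph[OF D]) (metis RR_inj RR_surj)
  then show ?thesis unfolding cmon_def o by (auto simp: cd F(2,3) intro: F(1))
qed

abbreviation "AA \<equiv> graph (\<lambda>x y w. rdec w = rdec x + rdec y)"
abbreviation "MM \<equiv> graph (\<lambda>x y w. rdec w = rdec x * rdec y)"

lemma D_rdec: "D (\<lambda>e. rdec (e (Suc (Suc 0))) = rdec (e 0) + rdec (e (Suc 0)))"
  "D (\<lambda>e. rdec (e (Suc (Suc 0))) = rdec (e 0) * rdec (e (Suc 0)))"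
  unfolding rdec_add rdec_mult by (intro dfn)+

definition LL :: nat where
  "LL = sep (prd RR RR) (\<lambda>p. rdec (pr1 p) \<le> rdec (pr2 p))"

lemma in_LL: "E0 p LL \<longleftrightarrow> E0 p (prd RR RR) \<and> rdec (pr1 p) \<le> rdec (pr2 p)"
  unfolding LL_def rdec_le by (rule sep) (intro dfn)

lemma pair_LL: "E0 (pair x y) LL \<longleftrightarrow> E0 x RR \<and> E0 y RR \<and> rdec x \<le> rdec y"
  by (auto simp: in_LL)

lemma fld_RR: "fld RR (cd 0) (cd 1) AA MM"
proof -
  have "\<exists>w. E0 w RR \<and> rdec w = - r" for r using RR_surj by blast
  moreover have "\<exists>w. E0 w RR \<and> rdec x * rdec w = 1" if "rdec x \<noteq> 0" for x
    using mreal_inverse[OF that] RR_surj by metis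
  moreover have "x \<noteq> cd 0 \<longleftrightarrow> rdec x \<noteq> 0" if "E0 x RR" for x using that RR_inj cd by metis
  moreover have "cd 0 \<noteq> cd 1" using cd(2)[of 0] cd(2)[of 1] by (metis zero_neq_one)
  moreover have "cmon RR (cd 0) AA" by (rule cmon_graph[OF D_rdec(1)]) (simp_all add: add.commute add.assoc)
  moreover have "cmon RR (cd 1) MM" by (rule cmon_graph[OF D_rdec(2)]) (simp_all add: mult.commute mult.assoc)
  ultimately show ?thesis
    unfolding fld_def opv_graph[OF D_rdec(1)] opv_graph[OF D_rdec(2)]
    by (simp add: cd distrib_left) (metis add.right_inverse)
qed

lemma lin_RR: "lin RR LL"
  unfolding lin_def pair_LL using RR_inj by (auto simp: sub_def in_LL)

lemma cpl_RR: "cpl RR LL"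
  unfolding cpl_def
proof (intro HOL.allI HOL.impI, elim conjE)
  fix S assume S: "sub S RR" and "\<exists>s. E0 s S" and "\<exists>b. ub RR LL S b"
  then obtain s b where s: "E0 s S" and b: "ub RR LL S b" by blast
  have SR: "E0 x RR" if "E0 x S" for x using S that unfolding sub_def by blast
  have ub: "ub RR LL S c \<longleftrightarrow> E0 c RR \<and> (\<forall>x. E0 x S \<longrightarrow> rdec x \<le> rdec c)" for c
    unfolding ub_def pair_LL using SR by blast
  \<comment> \<open>Shifting by a fixed \<open>s\<close> in \<open>S\<close> makes the relevant
    members nonnegative: \<open>U\<close> is the union of the cuts of \<open>x - s\<close> over
    those \<open>x\<close> in \<open>S\<close> that are at least \<open>s\<close>.\<close>
  define U where "U = {q. \<exists>x p. E0 x S \<and> rdec x = emb p + rdec s \<and> q \<in> Rep_preal p}"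
  have "coded U"
    unfolding U_def
  proof (rule coded_Collect)
    \<comment> \<open>Quantifying over codes instead of cuts shows that \<open>U\<close> is
      definable, with the set \<open>S\<close> of the model as a parameter.\<close>
    have "(\<exists>x p. E0 x S \<and> rdec x = emb p + rdec s \<and> q \<in> Rep_preal p) \<longleftrightarrow>
        (\<exists>x c. E0 x S \<and> rdec x = emb (pdec c) + rdec s \<and> q \<in> Rep_preal (pdec c))" for q
      by (metis pdec_enc)
    then show "D (\<lambda>e. \<exists>x p. E0 x S \<and> rdec x = emb p + rdec s \<and> val (e 0) \<in> Rep_preal p)"
      by (simp only: rdec_emb) (intro dfn)
  qed
  have bound: "Rep_preal p \<subseteq> Rep_preal pc"
    if "ub RR LL S c" "rdec c = emb pc + rdec s" "E0 x S" "rdec x = emb p + rdec s" for c pc x p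
  proof -
    have "emb p \<le> emb pc" using that ub by (metis add_le_cancel_right)
    then show ?thesis unfolding emb_le preal_le .
  qed
  have over: "\<exists>pc. rdec c = emb pc + rdec s" if "ub RR LL S c" for c
    using nonneg_emb[of "rdec c - rdec s"] that s ub by (auto simp: algebra_simps)
  obtain pb where pb: "rdec b = emb pb + rdec s" using over b by blast
  have "ncut U"
  proof -
    obtain q where q: "q \<notin> Rep_preal pb" using ncut_bound[OF ncut_Rep] by blast
    show ?thesis
    proof (rule ncutI[of _ q])
      have "rdec s = emb 0 + rdec s" by (simp add: emb_simps)
      then show "q \<in> U" if "q < 0" for q
        using s ncut_neg[OF ncut_Rep[of 0] that] unfolding U_def by blast
      show "q \<notin> U" unfolding U_def using bound[OF b pb] q by blast
      show "y \<in> U" if "x \<in> U" "y < x" for x y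
        using that ncut_lower[OF ncut_Rep] unfolding U_def by blast
      show "\<exists>y. y \<in> U \<and> x < y" if "x \<in> U" for x
        using that ncut_open[OF ncut_Rep] unfolding U_def by blast
    qed
  qed
  then have Rep_U: "Rep_preal (Abs_preal U) = U"
    using \<open>coded U\<close> by (simp add: Abs_preal_inverse coded0)
  \<comment> \<open>The supremum is the union of the cuts shifted back by \<open>s\<close>.\<close>
  let ?t = "cd (emb (Abs_preal U) + rdec s)"
  have "ub RR LL S ?t"
    unfolding ub cd(2)
  proof (intro conjI HOL.allI HOL.impI cd(1))
    fix x assume x: "E0 x S"
    show "rdec x \<le> emb (Abs_preal U) + rdec s"
    proof (cases "rdec x \<le> rdec s")
      case True
      then show ?thesis using emb_nonneg[of "Abs_preal U"] by (simp add: add_increasing)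
    next
      case False
      then obtain p where p: "rdec x = emb p + rdec s"
        using nonneg_emb[of "rdec x - rdec s"] by (auto simp: algebra_simps)
      have "Rep_preal p \<subseteq> Rep_preal (Abs_preal U)" unfolding Rep_U unfolding U_def using x p by blast
      then have "emb p \<le> emb (Abs_preal U)" unfolding emb_le preal_le .
      then show ?thesis using p by simp
    qed
  qed
  moreover have "E0 (pair ?t c) LL" if c: "ub RR LL S c" for c
  proof -
    obtain pc where pc: "rdec c = emb pc + rdec s" using over c by blast
    have "Rep_preal (Abs_preal U) \<subseteq> Rep_preal pc" unfolding Rep_U unfolding U_def using bound[OF c pc] by blast
    then have "emb (Abs_preal U) \<le> emb pc" unfolding emb_le preal_le .
    then show ?thesis using c unfolding pair_LL ub by (simp add: cd pc)
  qed
  ultimately show "\<exists>t. ub RR LL S t \<and> (\<forall>b. ub RR LL S b \<longrightarrow> E0 (pair t b) LL)" by blast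
qed

lemma reals_RR: "reals RR (cd 0) (cd 1) AA MM LL"
  unfolding reals_def opv_graph[OF D_rdec(1)] opv_graph[OF D_rdec(2)] pair_LL
  using fld_RR lin_RR cpl_RR by (auto simp: cd)

end

text \<open>The construction is not carried out in \<open>E\<close>: if \<open>E\<close> lacks
  reals, then the globally fixed \<open>E0\<close> lacks them too, and it is \<open>E0\<close> that
  yields the contradiction.\<close>

theorem model_has_reals:
  assumes "zf E"
  shows "has_reals E"
proof (rule ccontr)
  assume "\<not> has_reals E"
  then have bad: isbad using assms unfolding isbad_def by blast
  interpret bad_model using zf_nat_E0[OF bad] bad unfolding bad_model_def bad_model_axioms_def by blast
  show False using reals_RR bad_E0[OF bad] unfolding has_reals_def by blast
qed

section \<open>The three implications\<close>

theorem theorem5p3: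
  shows "(ZF \<turnstile> (CMC \<^bold>\<longrightarrow> G_T3half_Gdd_Gd \<^bold>\<and> Z_CR_Zd_Z) 0) \<and>
    (ZF \<turnstile> (G_T3half_Gdd_Gd \<^bold>\<longrightarrow> UT_cuc_cuc \<^bold>\<and> UT_cuf_cuf) 0) \<and>
    (ZF \<turnstile> (Z_CR_Zd_Z \<^bold>\<longrightarrow> UT_cuc_cuc \<^bold>\<and> UT_cuf_cuf) 0)"
proof -
  have "sat E (=) e ((CMC \<^bold>\<longrightarrow> G_T3half_Gdd_Gd \<^bold>\<and> Z_CR_Zd_Z) 0) \<and>
      sat E (=) e ((G_T3half_Gdd_Gd \<^bold>\<longrightarrow> UT_cuc_cuc \<^bold>\<and> UT_cuf_cuf) 0) \<and>
      sat E (=) e ((Z_CR_Zd_Z \<^bold>\<longrightarrow> UT_cuc_cuc \<^bold>\<and> UT_cuf_cuf) 0)"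
    if "zf E" for E :: "nat \<Rightarrow> nat \<Rightarrow> bool" and e
  proof -
    interpret zf E by fact
    have sat: "sat E (=) e (f 0) \<longleftrightarrow> ev e f 0 e" for f by (simp add: sem_def)
    have loc: "model_reals E R z u A M L" if "reals R z u A M L" for R z u A M L
      using that by unfold_locales
    obtain R z u A M L where reals: "reals R z u A M L"
      using model_has_reals[OF \<open>zf E\<close>] unfolding has_reals_def by blast
    interpret model_reals E R z u A M L using reals by (rule loc)
    \<comment> \<open>The intermediate class consists of the G-delta sets themselves; clopen sets
      belong to it because they are open.\<close>
    have "ut (cu ctb) \<and> ut (cu fin)"
      if "\<And>X W. creg R z L X W \<and> t1 X W \<Longrightarrow> stab (gdelta W)"
      by (rule unions_of_stable) (use that gdelta_open in blast)
    moreover have "ut (cu ctb) \<and> ut (cu fin)"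
      if "\<And>X W. creg R z L X W \<Longrightarrow> stab (zset R z L X W)"
    proof (rule unions_of_stable)
      fix X W assume "creg R z L X W"
      then have "top X W" "stab (zset R z L X W)" using that unfolding creg_def by blast+
      \<comment> \<open>Here the intermediate class consists of the zero-sets.\<close>
      then show "\<exists>K. stab K \<and> (\<forall>U. E U W \<and> E (diff X U) W \<longrightarrow> K U) \<and> (\<forall>U. K U \<longrightarrow> gdelta W U)"
        using zset_clopen zset_gdelta by blast
    qed
    moreover have "stab (gdelta W)" if cmc "t1 X W" for X W
      using gdelta_stable that unfolding t1_def by blast
    \<comment> \<open>Part (i) concerns every complete ordered field of the model, not just the one
      fixed above.\<close>
    moreover have "stab (zset R z L X W)" if cmc "reals R z u A M L" "creg R z L X W" for R z u A M L X W
      using model_reals.zset_stable[OF loc] that unfolding creg_def by blast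
    ultimately show ?thesis
      unfolding sat sem_connectives ev_cmc ev_G ev_Z ev_ut using reals by blast
  qed
  then show ?thesis by (intro conjI ZF_complete) blast+
qed

end
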